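(* Assume (A1)–(A4) (listed in the context). Let $\bar\eta\in\mathbb S^1$ be hyperbolic with respect to the index $j_0$ and let $a_{j_0}$ vanish in $\bar\eta$ to order $\ell$. Assume further that $\bar\gamma_{j_0}(\bar\eta)\ge2\ell$. Then there is a sufficiently small conical neighbourhood of $\bar\eta$ such that for dual indices $p\in[1,2]$, $pq=p+q$ (with $q=\infty$ if $p=1$), and regularity $r>2(1/p-1/q)$ $$\|e^{\mathrm it\nu_{j_0}^{\pm}(\mathrm D)}f\|_q\lesssim(1+t)^{-\frac1{2\ell}\left(\frac1p-\frac1q\right)}\|f\|_{p,r},\qquad t\ge0,$$ for all $f$ (with finite right-hand side) whose Fourier transform $\hat f$ is supported in this conical neighbourhood; the implied constant is independent of $t$ and $f$.
   Context: Constants: $\kappa>0$, $\gamma\in\mathbb R\setminus\{0\}$. The map $A:\mathbb S^1\to\mathbb C^{2\times2}$ satisfies (A1) $A$ is real-analytic on $\mathbb S^1$; (A2) $A(\eta)$ is self-adjoint and positive for all $\eta\in\mathbb S^1$. The eigenvalues $\varkappa_1,\varkappa_2$ of $A(\eta)$ and corresponding normalised eigenvectors $r_1,r_2:\mathbb S^1\to\mathbb S^1\subset\mathbb R^2$ (orthonormal) are assumed to be globally defined smooth, real-analytic functions of $\eta\in\mathbb S^1$. (A3) $A(\eta)$ has two distinct eigenvalues for every $\eta\in\mathbb S^1$. Put $\omega_j=\sqrt{\varkappa_j}$ and, for $\xi\ne0$, $\eta=\xi/|\xi|$, $\omega_j(\xi)=|\xi|\omega_j(\eta)$. The coupling functions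 are $a_j(\eta)=r_j(\eta)\cdot\eta$, $a_j(\xi)=r_j(\eta)\cdot\xi=|\xi|a_j(\eta)$, and $$B(\xi)=\begin{pmatrix}\omega_1(\xi)&0&0&0&\mathrm i\gamma a_1(\xi)\\0&\omega_2(\xi)&0&0&\mathrm i\gamma a_2(\xi)\\0&0&-\omega_1(\xi)&0&\mathrm i\gamma a_1(\xi)\\0&0&0&-\omega_2(\xi)&\mathrm i\gamma a_2(\xi)\\-\frac{\mathrm i\gamma}2a_1(\xi)&-\frac{\mathrm i\gamma}2a_2(\xi)&-\frac{\mathrm i\gamma}2a_1(\xi)&-\frac{\mathrm i\gamma}2a_2(\xi)&\mathrm i\kappa|\xi|^2\end{pmatrix}.$$ A direction $\eta\in\mathbb S^1$ is hyperbolic if $B(\xi)$, $\xi=|\xi|\eta\neq0$, has a real eigenvalue (this depends only on $\eta$); it is hyperbolic with respect to the index $j_0$ if $\pm\omega_{j_0}(\xi)\in\operatorname{spec}B(\xi)$ (under (A3) this means $a_{j_0}(\eta)=0$). (A4) $\gamma^2\neq2\varkappa_{j_0}(\bar\eta)-\operatorname{tr}A(\bar\eta)$ for all hyperbolic directions $\bar\eta$ with respect to $j_0$. For $\bar\eta$ hyperbolic with respect to $j_0$, $\nu_{j_0}^\pm(\xi)$ denotes, for $\xi$ in a small conical neighbourhood of $\bar\eta$, the pair of eigenvalues of $B(\xi)$ depending continuously on $\xi$ with $\nu_{j_0}^\pm(|\xi|\bar\eta)=\pm\omega_{j_0}(|\xi|\bar\eta)$ (hyperbolic eigenvalues). $e^{\mathrm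 it\nu(\mathrm D)}$ is the Fourier multiplier with symbol $e^{\mathrm it\nu(\xi)}$. $\bar\gamma_j(\eta)$ denotes the order of contact between the $j$-th sheet $S_j=\{\omega_j^{-1}(\eta)\eta\mid\eta\in\mathbb S^1\}$ of the Fresnel curve and its tangent in the point $\omega_j^{-1}(\eta)\eta$ (order of contact 2 means non-vanishing curvature). Norms: $\|\cdot\|_q$ is the $L^q(\mathbb R^2)$ norm and $\|f\|_{p,r}=\|\langle \mathrm D\rangle^rf\|_{L^p}$, where $\langle\mathrm D\rangle$ has symbol $(1+|\xi|^2)^{1/2}$. *)

theory Defs
  imports "HOL-Probability.Essential_Supremum" "HOL-Library.Extended_Nat"
begin

section \<open>The unit circle\<close>

definition rot :: "real^2 \<Rightarrow> real^2" where
  "rot v = vector [- (v $ 2), v $ 1]"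

text \<open>For a unit vector \<open>\<eta>\<close>, \<open>circ_arc \<eta>\<close> is the arc-length parametrisation of the unit circle with
  \<open>circ_arc \<eta> 0 = \<eta>\<close>. Local notions on the circle near \<open>\<eta>\<close> are expressed in this parameter.\<close>

definition circ_arc :: "real^2 \<Rightarrow> real \<Rightarrow> real^2" where
  "circ_arc \<eta> t = cos t *\<^sub>R \<eta> + sin t *\<^sub>R rot \<eta>"

definition real_analytic_on_circle :: "(real^2 \<Rightarrow> 'b::real_normed_vector) \<Rightarrow> bool" where
  "real_analytic_on_circle f \<longleftrightarrow>
     (\<forall>\<eta>\<in>sphere 0 1. \<exists>c e. e > 0 \<and> (\<forall>t. \<bar>t\<bar> < e \<longrightarrow> (\<lambda>n. t ^ n *\<^sub>R c n) sums f (circ_arc \<eta> t)))"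

text \<open>Order of the zero at \<open>0\<close> of a smooth function: \<open>0\<close> if \<open>f 0 \<noteq> 0\<close>, and \<open>\<infinity>\<close> if all
  derivatives vanish.\<close>

definition vanishing_order :: "(real \<Rightarrow> real) \<Rightarrow> enat" where
  "vanishing_order f = (INF n\<in>{n. (deriv ^^ n) f 0 \<noteq> 0}. enat n)"


section \<open>Matrices\<close>

definition spectrum :: "complex^'n^'n \<Rightarrow> complex set" where
  "spectrum M = {z. \<exists>v. v \<noteq> 0 \<and> M *v v = z *s v}"

definition self_adjoint :: "complex^'n^'n \<Rightarrow> bool" where
  "self_adjoint M \<longleftrightarrow> (\<forall>i j. M $ i $ j = cnj (M $ j $ i))"

text \<open>The real inner product \<open>v \<bullet> w\<close> on \<open>complex^'n\<close> is the real part of the Hermitian one; for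
  self-adjoint \<open>M\<close> the Hermitian form at \<open>v\<close> is real, so nothing is lost.\<close>

definition positive_definite :: "complex^'n^'n \<Rightarrow> bool" where
  "positive_definite M \<longleftrightarrow> (\<forall>v. v \<noteq> 0 \<longrightarrow> 0 < v \<bullet> (M *v v))"

text \<open>\<open>vk j \<eta>\<close> and \<open>r j \<eta>\<close>, \<open>j = 1, 2\<close>, are the eigenvalues and a real orthonormal system of
  eigenvectors of \<open>A \<eta>\<close>.\<close>

definition eigensystem ::
  "(real^2 \<Rightarrow> complex^2^2) \<Rightarrow> (2 \<Rightarrow> real^2 \<Rightarrow> real) \<Rightarrow> (2 \<Rightarrow> real^2 \<Rightarrow> real^2) \<Rightarrow> bool" where
  "eigensystem A vk r \<longleftrightarrow> (\<forall>\<eta>\<in>sphere 0 1.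
     (\<forall>j. A \<eta> *v (\<chi> i. complex_of_real (r j \<eta> $ i))
            = complex_of_real (vk j \<eta>) *s (\<chi> i. complex_of_real (r j \<eta> $ i))) \<and>
     (\<forall>j. norm (r j \<eta>) = 1) \<and> r 1 \<eta> \<bullet> r 2 \<eta> = 0)"


section \<open>The symbol matrix and its hyperbolic directions\<close>

text \<open>\<open>omega\<close> and \<open>coupling\<close> are the functions homogeneous of degree one in \<open>\<xi>\<close>; on the unit
  circle they are \<open>sqrt \<circ> vk j\<close> and \<open>\<lambda>\<eta>. r j \<eta> \<bullet> \<eta>\<close>.\<close>

definition omega :: "(2 \<Rightarrow> real^2 \<Rightarrow> real) \<Rightarrow> 2 \<Rightarrow> real^2 \<Rightarrow> real" where
  "omega vk j \<xi> = norm \<xi> * sqrt (vk j (\<xi> /\<^sub>R norm \<xi>))"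

definition coupling :: "(2 \<Rightarrow> real^2 \<Rightarrow> real^2) \<Rightarrow> 2 \<Rightarrow> real^2 \<Rightarrow> real" where
  "coupling r j \<xi> = r j (\<xi> /\<^sub>R norm \<xi>) \<bullet> \<xi>"

definition B_matrix ::
  "real \<Rightarrow> real \<Rightarrow> (2 \<Rightarrow> real^2 \<Rightarrow> real) \<Rightarrow> (2 \<Rightarrow> real^2 \<Rightarrow> real^2) \<Rightarrow> real^2 \<Rightarrow> complex^5^5" where
  "B_matrix \<kappa> \<gamma> vk r \<xi> =
    (let w1 = complex_of_real (omega vk 1 \<xi>); w2 = complex_of_real (omega vk 2 \<xi>);
         b1 = \<i> * complex_of_real (\<gamma> * coupling r 1 \<xi>);
         b2 = \<i> * complex_of_real (\<gamma> * coupling r 2 \<xi>)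
     in vector
      [vector [w1, 0, 0, 0, b1],
       vector [0, w2, 0, 0, b2],
       vector [0, 0, - w1, 0, b1],
       vector [0, 0, 0, - w2, b2],
       vector [- b1 / 2, - b2 / 2, - b1 / 2, - b2 / 2, \<i> * complex_of_real (\<kappa> * (norm \<xi>)\<^sup>2)]])"

definition hyperbolic ::
  "real \<Rightarrow> real \<Rightarrow> (2 \<Rightarrow> real^2 \<Rightarrow> real) \<Rightarrow> (2 \<Rightarrow> real^2 \<Rightarrow> real^2) \<Rightarrow> real^2 \<Rightarrow> bool" where
  "hyperbolic \<kappa> \<gamma> vk r \<eta> \<longleftrightarrow> \<eta> \<in> sphere 0 1 \<and>
     (\<forall>\<rho>>0. \<exists>x::real. complex_of_real x \<in> spectrum (B_matrix \<kappa> \<gamma> vk r (\<rho> *\<^sub>R \<eta>)))"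

definition hyperbolic_wrt ::
  "real \<Rightarrow> real \<Rightarrow> (2 \<Rightarrow> real^2 \<Rightarrow> real) \<Rightarrow> (2 \<Rightarrow> real^2 \<Rightarrow> real^2) \<Rightarrow> 2 \<Rightarrow> real^2 \<Rightarrow> bool" where
  "hyperbolic_wrt \<kappa> \<gamma> vk r j \<eta> \<longleftrightarrow> hyperbolic \<kappa> \<gamma> vk r \<eta> \<and>
     (\<forall>\<rho>>0. {complex_of_real (omega vk j (\<rho> *\<^sub>R \<eta>)), - complex_of_real (omega vk j (\<rho> *\<^sub>R \<eta>))}
              \<subseteq> spectrum (B_matrix \<kappa> \<gamma> vk r (\<rho> *\<^sub>R \<eta>)))"

definition conical_nbhd :: "real^2 \<Rightarrow> (real^2) set \<Rightarrow> bool" where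
  "conical_nbhd \<eta> \<Gamma> \<longleftrightarrow>
     open \<Gamma> \<and> \<eta> \<in> \<Gamma> \<and> 0 \<notin> \<Gamma> \<and> (\<forall>\<xi>\<in>\<Gamma>. \<forall>\<rho>>0. \<rho> *\<^sub>R \<xi> \<in> \<Gamma>)"

text \<open>\<open>s\<close> is the sign \<open>1\<close> or \<open>-1\<close> selecting one of the two hyperbolic eigenvalues.\<close>

definition hyperbolic_eigenvalue ::
  "real \<Rightarrow> real \<Rightarrow> (2 \<Rightarrow> real^2 \<Rightarrow> real) \<Rightarrow> (2 \<Rightarrow> real^2 \<Rightarrow> real^2) \<Rightarrow> 2 \<Rightarrow> real^2 \<Rightarrow> real
     \<Rightarrow> (real^2) set \<Rightarrow> (real^2 \<Rightarrow> complex) \<Rightarrow> bool" where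
  "hyperbolic_eigenvalue \<kappa> \<gamma> vk r j \<eta> s \<Gamma> \<nu> \<longleftrightarrow>
     conical_nbhd \<eta> \<Gamma> \<and> continuous_on \<Gamma> \<nu> \<and>
     (\<forall>\<xi>\<in>\<Gamma>. \<nu> \<xi> \<in> spectrum (B_matrix \<kappa> \<gamma> vk r \<xi>)) \<and>
     (\<forall>\<rho>>0. \<nu> (\<rho> *\<^sub>R \<eta>) = complex_of_real (s * omega vk j (\<rho> *\<^sub>R \<eta>)))"


section \<open>Fresnel curve\<close>

text \<open>The \<open>j\<close>-th sheet, parametrised by the angle measured from the direction \<open>\<eta>\<close>.\<close>

definition fresnel :: "(2 \<Rightarrow> real^2 \<Rightarrow> real) \<Rightarrow> 2 \<Rightarrow> real^2 \<Rightarrow> real \<Rightarrow> real^2" where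
  "fresnel vk j \<eta> t = inverse (omega vk j (circ_arc \<eta> t)) *\<^sub>R circ_arc \<eta> t"

text \<open>Order of contact with the tangent line: the order of vanishing, along the curve, of a
  linear functional cutting out the tangent line. It is \<open>2\<close> iff the curvature is non-zero.\<close>

definition contact_order :: "(2 \<Rightarrow> real^2 \<Rightarrow> real) \<Rightarrow> 2 \<Rightarrow> real^2 \<Rightarrow> enat" where
  "contact_order vk j \<eta> =
     (let c = fresnel vk j \<eta>; N = rot (vector_derivative c (at 0))
      in vanishing_order (\<lambda>t. (c t - c 0) \<bullet> N))"


section \<open>Lebesgue norms\<close>

definition Lp_norm :: "ennreal \<Rightarrow> (real^2 \<Rightarrow> complex) \<Rightarrow> ennreal" where
  "Lp_norm p f =
     (if p = \<infinity> then esssup lborel (\<lambda>x. ennreal (norm (f x)))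
      else let I = (\<integral>\<^sup>+x. ennreal (norm (f x) powr enn2real p) \<partial>lborel)
           in if I = \<infinity> then \<infinity> else ennreal (enn2real I powr (1 / enn2real p)))"

text \<open>In \<open>ennreal\<close> the equation \<open>p * q = p + q\<close> would hold for \<open>q = \<infinity>\<close> whatever \<open>p \<ge> 1\<close> is, hence the
  case distinction.\<close>

definition dual_exponents :: "real \<Rightarrow> ennreal \<Rightarrow> bool" where
  "dual_exponents p q \<longleftrightarrow>
     (if p = 1 then q = \<infinity> else q \<noteq> \<infinity> \<and> p * enn2real q = p + enn2real q)"


section \<open>Fourier transform and Fourier multipliers\<close>

definition partial :: "2 \<Rightarrow> (real^2 \<Rightarrow> complex) \<Rightarrow> real^2 \<Rightarrow> complex" where
  "partial i f x = frechet_derivative f (at x) (axis i 1)"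

text \<open>Schwartz space: all iterated partial derivatives (indexed by lists of coordinate
  directions) exist, are differentiable and decay rapidly.\<close>

definition schwartz :: "(real^2 \<Rightarrow> complex) \<Rightarrow> bool" where
  "schwartz \<phi> \<longleftrightarrow> (\<forall>is. (\<forall>x. foldr partial is \<phi> differentiable at x) \<and>
     (\<forall>k::nat. bounded (range (\<lambda>x. (1 + norm x) ^ k *\<^sub>R foldr partial is \<phi> x))))"

definition fourier :: "(real^2 \<Rightarrow> complex) \<Rightarrow> real^2 \<Rightarrow> complex" where
  "fourier \<phi> \<xi> = (LINT x|lborel. exp (- \<i> * complex_of_real (x \<bullet> \<xi>)) * \<phi> x) / complex_of_real (2 * pi)"

text \<open>Functions that define a tempered distribution by integration.\<close>

definition tempered :: "(real^2 \<Rightarrow> complex) \<Rightarrow> bool" where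
  "tempered u \<longleftrightarrow> u \<in> borel_measurable lborel \<and>
     (\<exists>N::nat. integrable lborel (\<lambda>x. u x / complex_of_real ((1 + norm x) ^ N)))"

text \<open>The Fourier transform of the tempered distribution \<open>f\<close> is the function \<open>F\<close>. Both \<open>f\<close> and \<open>F\<close>
  matter only up to null sets.\<close>

definition has_fourier_transform :: "(real^2 \<Rightarrow> complex) \<Rightarrow> (real^2 \<Rightarrow> complex) \<Rightarrow> bool" where
  "has_fourier_transform f F \<longleftrightarrow> tempered f \<and> tempered F \<and>
     (\<forall>\<phi>. schwartz \<phi> \<longrightarrow> (LINT \<xi>|lborel. F \<xi> * \<phi> \<xi>) = (LINT x|lborel. f x * fourier \<phi> x))"

text \<open>\<open>fourier_multiplier m f h\<close> expresses \<open>m(D) f = h\<close>, which determines \<open>h\<close> up to null sets.\<close>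

definition fourier_multiplier ::
  "(real^2 \<Rightarrow> complex) \<Rightarrow> (real^2 \<Rightarrow> complex) \<Rightarrow> (real^2 \<Rightarrow> complex) \<Rightarrow> bool" where
  "fourier_multiplier m f h \<longleftrightarrow>
     (\<exists>F. has_fourier_transform f F \<and> has_fourier_transform h (\<lambda>\<xi>. m \<xi> * F \<xi>))"

text \<open>The representative \<open>F\<close> of the Fourier transform can be chosen to vanish everywhere outside
  \<open>\<Gamma>\<close>, that is, it vanishes almost everywhere there.\<close>

definition fourier_supported :: "(real^2) set \<Rightarrow> (real^2 \<Rightarrow> complex) \<Rightarrow> bool" where
  "fourier_supported \<Gamma> f \<longleftrightarrow> (\<exists>F. has_fourier_transform f F \<and> (\<forall>\<xi>. \<xi> \<notin> \<Gamma> \<longrightarrow> F \<xi> = 0))"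

definition bessel_symbol :: "real \<Rightarrow> real^2 \<Rightarrow> complex" where
  "bessel_symbol s \<xi> = complex_of_real ((1 + (norm \<xi>)\<^sup>2) powr (s / 2))"

end

theory Submission
  imports Defs "HOL-Probability.Probability" "HOL-Analysis.FPS_Convergence"
begin

text \<open>
  No oscillation is needed. Let \<open>a\<close> be the coupling function that vanishes at the hyperbolic
  direction. The hyperbolic eigenvalue \<open>\<nu> = \<rho> z\<close> satisfies \<open>z\<^sup>2 - \<omega>\<^sup>2 = \<gamma>\<^sup>2 a\<^sup>2 / D\<close>, and (A4) together
  with the separation of the two sheets bounds \<open>D\<close> away from zero uniformly in the frequency
  \<open>\<rho> > 0\<close>, including the limit \<open>\<rho> \<rightarrow> 0\<close>. Taking imaginary parts gives
  \<open>Im \<nu> \<ge> c (\<rho> / (1 + \<rho>))\<^sup>2 \<bar>\<phi>\<bar>\<^bsup>2l\<^esup>\<close> at angular distance \<open>\<phi>\<close>, so the multiplier \<open>exp (\<i>t\<nu>)\<close> is small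
  outside an angle of size \<open>t\<^bsup>-1/(2l)\<^esup>\<close>: for every \<open>\<sigma> > 2\<close> the integral of its modulus against
  \<open>\<langle>\<xi>\<rangle>\<^bsup>-\<sigma>\<^esup>\<close> over the sector is \<open>O((1 + t)\<^bsup>-1/(2l)\<^esup>)\<close>. The theorem follows by
  applying the Hausdorff--Young inequality, Hoelder's inequality with exponent \<open>1 / (1/p - 1/q)\<close>,
  and the Hausdorff--Young inequality again. The latter is proved by real interpolation between
  \<open>L\<^sup>1 \<rightarrow> L\<^sup>\<infinity>\<close> and \<open>L\<^sup>2 \<rightarrow> L\<^sup>2\<close>, for which constants depending on \<open>p\<close> are harmless.
\<close>

section \<open>Lebesgue measure on the plane\<close>

text \<open>Eliminating the eigenvector of the arrow matrix \<open>B_matrix\<close> gives D = 1 - i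
  \<kappa> \<rho> / z - \<gamma>^2 b^2 / (z^2 - \<omega>'^2), where b and \<omega>' belong to the
  other sheet. At the hyperbolic direction b^2 = 1, so the real part of D is 1 - \<gamma>^2 /
  (\<omega>^2 - \<omega>'^2), and (A4) makes it non-zero because tr A is the sum of both
  eigenvalues. The term with \<kappa> \<rho> is purely imaginary there and cannot cancel it; hence
  one angular neighbourhood serves all frequencies. Since |D| grows at most like 1 + \<rho>, Im z is
  at least of size \<rho> a^2 / (1 + \<rho>)^2, and multiplication by \<rho> explains the factor
  (\<rho> / (1 + \<rho>))^2. Its degeneration at \<rho> = 0 is harmless: the arc left undamped at a
  small radius \<rho> has length about \<rho>^(1 - 1/l) t^(-1/(2l)), bounded in \<rho> as l \<ge> 1.
  The condition on the regularity says exactly that Hoelder's exponent raises the Bessel weight to a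
  power above 2, the threshold of integrability in the plane. Fourier transforms are taken in the
  sense of tempered distributions, so the inequalities for integrable functions have to be extended
  and identified with that notion by a uniqueness argument.\<close>

lemma lborel_integral_scaleR:
  fixes f :: "'a::euclidean_space \<Rightarrow> 'b::{banach, second_countable_topology}"
  assumes "c \<noteq> 0"
  shows "(LBINT x. f x) = \<bar>c\<bar> ^ DIM('a) *\<^sub>R (LBINT x. f (t + c *\<^sub>R x))"
proof (cases "f \<in> borel_measurable borel")
  case True
  then show ?thesis
    by (subst lborel_affine[OF assms, of t]) (simp add: integral_density integral_distr)
next
  case False
  \<comment> \<open>Without measurability both integrals have the default value 0. Measurability of
    the substituted function would pass back to \<open>f\<close> through the inverse affine
    map.\<close>
  have "(\<lambda>x. f (t + c *\<^sub>R x)) \<notin> borel_measurable borel"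
  proof
    assume "(\<lambda>x. f (t + c *\<^sub>R x)) \<in> borel_measurable borel"
    then have "(\<lambda>x. f (t + c *\<^sub>R ((1/c) *\<^sub>R (x - t)))) \<in> borel_measurable borel"
      by (rule measurable_compose[rotated]) simp
    with False assms show False by simp
  qed
  with False have "\<not> integrable lborel f" "\<not> integrable lborel (\<lambda>x. f (t + c *\<^sub>R x))"
    using borel_measurable_integrable by fastforce+
  then show ?thesis by (simp add: not_integrable_integral_eq)
qed

lemma lborel_integrable_scaleR:
  fixes f :: "'a::euclidean_space \<Rightarrow> 'b::{banach, second_countable_topology}"
  assumes "c \<noteq> 0" "integrable lborel f"
  shows "integrable lborel (\<lambda>x. f (t + c *\<^sub>R x))"
proof -
  have m: "f \<in> borel_measurable borel" using assms(2) by auto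
  have "integrable (density (distr lborel borel (\<lambda>x. t + c *\<^sub>R x)) (\<lambda>_. \<bar>c\<bar>^DIM('a))) f"
    using assms(2) lborel_affine[OF assms(1), of t] by simp
  then have "integrable (distr lborel borel (\<lambda>x. t + c *\<^sub>R x)) (\<lambda>x. (\<bar>c\<bar>^DIM('a)) *\<^sub>R f x)"
    using m by (subst (asm) integrable_density) auto
  then have "integrable lborel (\<lambda>x. \<bar>c\<bar> ^ DIM('a) *\<^sub>R f (t + c *\<^sub>R x))"
    using m by (subst (asm) integrable_distr_eq) auto
  then have "integrable lborel (\<lambda>x. inverse (\<bar>c\<bar> ^ DIM('a)) *\<^sub>R \<bar>c\<bar> ^ DIM('a) *\<^sub>R f (t + c *\<^sub>R x))"
    by (rule integrable_scaleR_right)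
  then show ?thesis using assms(1) by simp
qed

lemma lborel_nn_integral_scaleR:
  fixes f :: "'a::euclidean_space \<Rightarrow> ennreal"
  assumes "c \<noteq> 0" and [measurable]: "f \<in> borel_measurable borel"
  shows "(\<integral>\<^sup>+x. f x \<partial>lborel) = ennreal (\<bar>c\<bar> ^ DIM('a)) * (\<integral>\<^sup>+x. f (t + c *\<^sub>R x) \<partial>lborel)"
    by (subst lborel_affine[OF assms(1), of t]) (simp add: nn_integral_density nn_integral_distr nn_integral_cmult ennreal_power)

section \<open>Orthonormal coordinates and rotation invariance in the plane\<close>

lemma rot_nth[simp]: "rot v $ 1 = - (v $ 2)" "rot v $ 2 = v $ 1"
  by (simp_all add: rot_def)

lemma inner_2: "(x::real^2) \<bullet> y = x $ 1 * y $ 1 + x $ 2 * y $ 2"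
  by (simp add: inner_vec_def sum_2)

lemma vec2_eq_iff: "(x::'a^2) = y \<longleftrightarrow> x $ 1 = y $ 1 \<and> x $ 2 = y $ 2"
  by (simp add: vec_eq_iff forall_2)

lemma norm_2_sq: "(norm (x::real^2))\<^sup>2 = (x $ 1)\<^sup>2 + (x $ 2)\<^sup>2"
  unfolding power2_norm_eq_inner inner_2 by (simp add: power2_eq_square)

lemma Basis_real2: "(Basis :: (real^2) set) = {axis 1 1, axis 2 1}"
  by (auto simp: Basis_vec_def UNIV_2)

lemma axis_nth_12: "axis 1 (1::real) $ (1::2) = 1" "axis 1 (1::real) $ (2::2) = 0"
  "axis 2 (1::real) $ (1::2) = 0" "axis 2 (1::real) $ (2::2) = 1"
  by (simp_all add: axis_def)

lemma axis_12: "axis 1 (1::real) \<noteq> (axis (2::2) 1 :: real^2)"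
  by (simp add: axis_eq_axis)

text \<open>Opens the way from \<open>real^2\<close> to Fubini and Tonelli on a product of two
  lines; it suffices to compare the measures of boxes.\<close>

lemma lborel_real2_std:
  "distr (lborel \<Otimes>\<^sub>M lborel) borel (\<lambda>p. fst p *\<^sub>R axis 1 1 + snd p *\<^sub>R axis 2 1) = (lborel :: (real^2) measure)"
proof (rule lborel_eqI[symmetric])
  fix l u :: "real^2"
  assume le0: "\<And>b. b \<in> Basis \<Longrightarrow> l \<bullet> b \<le> u \<bullet> b"
  have le: "l $ 1 \<le> u $ 1" "l $ 2 \<le> u $ 2"
    using le0[of "axis 1 1"] le0[of "axis 2 1"] by (simp_all add: Basis_real2 inner_axis)
  have *: "(\<lambda>p. fst p *\<^sub>R axis 1 1 + snd p *\<^sub>R axis 2 1 :: real^2) -` box l u = box (l$1) (u$1) \<times> box (l$2) (u$2)"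
    by (auto simp: box_def Basis_real2 inner_axis axis_nth_12)
  have "emeasure (distr (lborel \<Otimes>\<^sub>M lborel) borel (\<lambda>p. fst p *\<^sub>R axis 1 1 + snd p *\<^sub>R axis 2 1)) (box l u)
     = emeasure (lborel \<Otimes>\<^sub>M lborel) (box (l$1) (u$1) \<times> box (l$2) (u$2))"
    by (subst emeasure_distr) (simp_all add: * space_pair_measure)
  also have "\<dots> = ennreal ((u$1 - l$1) * (u$2 - l$2))"
    using le by (simp add: lborel.emeasure_pair_measure_Times ennreal_mult)
  finally show "emeasure (distr (lborel \<Otimes>\<^sub>M lborel) borel (\<lambda>p. fst p *\<^sub>R axis 1 1 + snd p *\<^sub>R axis 2 1)) (box l u) = ennreal (\<Prod>b\<in>Basis. (u - l) \<bullet> b)"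
    using axis_12 by (simp add: Basis_real2 inner_axis)
qed simp

text \<open>Preimages of boxes are images under the inverse map, which is orthogonal and so
  preserves their Lebesgue measure; boxes determine the measure.\<close>

lemma distr_lborel_orthogonal:
  fixes T :: "real^2 \<Rightarrow> real^2"
  assumes T: "orthogonal_transformation T"
  shows "distr lborel borel T = lborel"
proof (rule lborel_eqI[symmetric])
  fix l u :: "real^2"
  assume le: "\<And>b. b \<in> Basis \<Longrightarrow> l \<bullet> b \<le> u \<bullet> b"
  define S where "S = inv T"
  have bij: "bij T" and S: "orthogonal_transformation S"
    unfolding S_def using T by (simp_all add: orthogonal_transformation_inv orthogonal_transformation_bij)
  have [measurable]: "T \<in> borel_measurable borel"
    using T by (intro borel_measurable_continuous_onI linear_continuous_on)
      (auto simp: orthogonal_transformation_linear linear_conv_bounded_linear[symmetric])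
  have vim: "T -` box l u = S ` box l u"
    unfolding S_def using bij by (rule bij_vimage_eq_inv_image)
  have lm: "box l u \<in> lmeasurable" by simp
  have m: "S ` box l u \<in> lmeasurable" and eq: "measure lebesgue (S ` box l u) = measure lebesgue (box l u)"
    using measurable_orthogonal_image[OF S lm] measure_orthogonal_image[OF S lm] by auto
  have "emeasure (distr lborel borel T) (box l u) = emeasure lborel (T -` box l u)"
    by (subst emeasure_distr) auto
  also have "\<dots> = emeasure lebesgue (S ` box l u)"
    using measurable_sets[of T borel borel "box l u"] by (simp add: vim)
  also have "\<dots> = ennreal (measure lebesgue (box l u))"
    using m eq by (simp add: emeasure_eq_measure2)
  also have "\<dots> = (\<Prod>b\<in>Basis. (u - l) \<bullet> b)"
    using le by (simp add: measure_lborel_box_eq)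
  finally show "emeasure (distr lborel borel T) (box l u) = (\<Prod>b\<in>Basis. (u - l) \<bullet> b)" .
qed simp

text \<open>Coordinates along and across \<open>\<eta>\<close>, adapted to a thin sector around
  \<open>\<eta>\<close>. They arise from the standard ones by an orthogonal map.\<close>

lemma lborel_real2_rot:
  assumes "norm \<eta> = 1"
  shows "distr (lborel \<Otimes>\<^sub>M lborel) borel (\<lambda>p. fst p *\<^sub>R \<eta> + snd p *\<^sub>R rot \<eta>) = lborel"
proof -
  define T where "T = (\<lambda>x::real^2. x $ 1 *\<^sub>R \<eta> + x $ 2 *\<^sub>R rot \<eta>)"
  have n: "(\<eta>$1)\<^sup>2 + (\<eta>$2)\<^sup>2 = 1" using norm_2_sq[of \<eta>] assms by simp
  have lin: "linear T" unfolding T_def by (intro linearI) (auto simp: algebra_simps)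
  have "T x \<bullet> T y = x \<bullet> y" for x y
  proof -
    have "T x \<bullet> T y = ((\<eta>$1)\<^sup>2 + (\<eta>$2)\<^sup>2) * (x \<bullet> y)"
      by (simp add: T_def inner_2 power2_eq_square algebra_simps)
    then show ?thesis using n by simp
  qed
  then have T: "orthogonal_transformation T"
    using lin by (simp add: orthogonal_transformation_def)
  have [measurable]: "T \<in> borel_measurable borel"
    using lin by (intro borel_measurable_continuous_onI linear_continuous_on)
      (auto simp: linear_conv_bounded_linear[symmetric])
  have "lborel = distr (distr (lborel \<Otimes>\<^sub>M lborel) borel (\<lambda>p. fst p *\<^sub>R axis 1 1 + snd p *\<^sub>R axis 2 1)) borel T"
    by (simp add: lborel_real2_std distr_lborel_orthogonal[OF T])
  also have "\<dots> = distr (lborel \<Otimes>\<^sub>M lborel) borel (T \<circ> (\<lambda>p. fst p *\<^sub>R axis 1 1 + snd p *\<^sub>R axis 2 1))"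
    by (rule distr_distr) simp_all
  also have "T \<circ> (\<lambda>p. fst p *\<^sub>R axis 1 1 + snd p *\<^sub>R axis 2 1) = (\<lambda>p. fst p *\<^sub>R \<eta> + snd p *\<^sub>R rot \<eta>)"
    by (simp add: T_def fun_eq_iff axis_nth_12)
  finally show ?thesis ..
qed

section \<open>Gaussians\<close>

definition gaussian :: "real \<Rightarrow> real^2 \<Rightarrow> real" where
  "gaussian c x = exp (- (c * norm x)\<^sup>2 / 2)"

lemma gaussian_pos: "0 < gaussian c x" "0 \<le> gaussian c x" by (simp_all add: gaussian_def)

lemma gaussian_le_1: "gaussian c x \<le> 1" by (simp add: gaussian_def)

lemma continuous_gaussian[continuous_intros]:
  "continuous_on A f \<Longrightarrow> continuous_on A (\<lambda>x. gaussian c (f x))"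
  unfolding gaussian_def by (intro continuous_intros) auto

lemma measurable_gaussian[measurable]: "gaussian c \<in> borel_measurable borel"
  by (intro borel_measurable_continuous_onI continuous_intros)

lemma gaussian_minus[simp]: "gaussian c (- x) = gaussian c x"
  by (simp add: gaussian_def)

lemma gaussian_minus_commute: "gaussian c (x - y) = gaussian c (y - x)"
  by (simp add: gaussian_def norm_minus_commute)

text \<open>The characteristic function of the standard normal law, multiplied by the normalising
  constant of its density.\<close>

lemma fourier_gaussian_1d:
  fixes t :: real
  shows "has_bochner_integral lborel (\<lambda>s. iexp (t * s) * complex_of_real (exp (- s\<^sup>2 / 2)))
           (complex_of_real (sqrt (2 * pi) * exp (- t\<^sup>2 / 2)))"
proof -
  have norm_eq: "cmod (iexp (t * s)) = 1" for s
    using norm_exp_i_times[of "t * s"] by simp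
  have i0: "integrable lborel (\<lambda>s. exp (- s\<^sup>2 / 2) :: real)"
    using integrable_mult_right[of "sqrt (2 * pi)", OF integrable_normal_density[of 1 0]]
    by (simp add: std_normal_density_def)
  have int: "integrable lborel (\<lambda>s. iexp (t * s) * complex_of_real (exp (- s\<^sup>2 / 2)))"
    by (rule Bochner_Integration.integrable_bound[OF i0]) (auto simp: norm_mult norm_eq)
  have "complex_of_real (exp (- (t^2) / 2)) = (LINT x|std_normal_distribution. iexp (t * x))"
    using char_std_normal_distribution by (simp add: char_def fun_eq_iff)
  also have "\<dots> = (LBINT s. std_normal_density s *\<^sub>R iexp (t * s))"
    by (subst integral_density) auto
  also have "\<dots> = (LBINT s. complex_of_real (1 / sqrt (2 * pi)) * (iexp (t * s) * complex_of_real (exp (- s\<^sup>2 / 2))))"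
    by (intro Bochner_Integration.integral_cong) (auto simp: std_normal_density_def scaleR_conv_of_real)
  also have "\<dots> = complex_of_real (1 / sqrt (2 * pi)) * (LBINT s. (iexp (t * s) * complex_of_real (exp (- s\<^sup>2 / 2))))"
    by (rule integral_mult_right_zero)
  finally have "(LBINT s. (iexp (t * s) * complex_of_real (exp (- s\<^sup>2 / 2))))
      = complex_of_real (sqrt (2 * pi)) * complex_of_real (exp (- (t^2) / 2))"
    by (simp add: field_simps)
  with int show ?thesis by (simp add: has_bochner_integral_iff)
qed

lemma fourier_gaussian_std:
  fixes x :: "real^2"
  shows "has_bochner_integral lborel (\<lambda>\<xi>. iexp (x \<bullet> \<xi>) * complex_of_real (gaussian 1 \<xi>))
           (complex_of_real (2 * pi * gaussian 1 x))"
proof -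
  let ?T = "\<lambda>p. fst p *\<^sub>R axis 1 1 + snd p *\<^sub>R axis 2 1 :: real^2"
  let ?f = "\<lambda>\<xi>::real^2. iexp (x \<bullet> \<xi>) * complex_of_real (gaussian 1 \<xi>)"
  define g where "g t s = iexp (t * s) * complex_of_real (exp (- s\<^sup>2 / 2))" for t s :: real
  have g: "has_bochner_integral lborel (g t) (complex_of_real (sqrt (2 * pi) * exp (- t\<^sup>2 / 2)))" for t
    using fourier_gaussian_1d[of t] unfolding g_def .
  have f: "?f (?T p) = g (x $ 1) (fst p) * g (x $ 2) (snd p)" for p
    by (simp add: g_def gaussian_def norm_2_sq inner_2 axis_nth_12 mult_exp_exp distrib_left
      exp_add[symmetric] flip: of_real_mult of_real_add exp_of_real) (simp add: algebra_simps add_divide_distrib diff_divide_distrib)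
  have [measurable]: "g t \<in> borel_measurable borel" for t
    unfolding g_def by measurable
  have m: "?f \<in> borel_measurable borel" by measurable
  have int: "integrable (lborel \<Otimes>\<^sub>M lborel) (\<lambda>p. g (x $ 1) (fst p) * g (x $ 2) (snd p))"
  proof (rule lborel_pair.Fubini_integrable)
    show "integrable lborel (\<lambda>a. LBINT b. norm (g (x $ 1) (fst (a, b)) * g (x $ 2) (snd (a, b))))"
      using g by (auto simp: norm_mult has_bochner_integral_iff)
    show "AE a in lborel. integrable lborel (\<lambda>b. g (x $ 1) (fst (a, b)) * g (x $ 2) (snd (a, b)))"
      using g by (auto simp: has_bochner_integral_iff)
  qed measurable
  have "integrable (distr (lborel \<Otimes>\<^sub>M lborel) borel ?T) ?f"
    using int by (subst integrable_distr_eq) (auto simp: f)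
  then have I: "integrable lborel ?f" by (simp only: lborel_real2_std)
  have "(LBINT \<xi>. ?f \<xi>) = (LINT \<xi>|distr (lborel \<Otimes>\<^sub>M lborel) borel ?T. ?f \<xi>)"
    by (simp only: lborel_real2_std)
  also have "\<dots> = (LINT p|(lborel \<Otimes>\<^sub>M lborel). g (x $ 1) (fst p) * g (x $ 2) (snd p))"
    by (subst integral_distr) (auto simp: f)
  also have "\<dots> = (LBINT a. LBINT b. g (x $ 1) a * g (x $ 2) b)"
    using lborel_pair.integral_fst'[OF int] by simp
  also have "\<dots> = (LBINT a. g (x $ 1) a) * (LBINT b. g (x $ 2) b)"
    by simp
  also have "\<dots> = complex_of_real (2 * pi * gaussian 1 x)"
    using g[of "x $ 1"] g[of "x $ 2"] unfolding has_bochner_integral_iff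
    by (simp add: gaussian_def norm_2_sq field_simps add_divide_distrib flip: of_real_mult exp_of_real exp_add)
  finally show ?thesis using I by (simp add: has_bochner_integral_iff)
qed

lemma fourier_gaussian:
  assumes c: "c > 0"
  shows "has_bochner_integral lborel (\<lambda>\<xi>. iexp (x \<bullet> \<xi>) * complex_of_real (gaussian c \<xi>))
           (complex_of_real (2 * pi / c\<^sup>2 * gaussian (1 / c) x))"
proof -
  let ?f = "\<lambda>\<xi>::real^2. iexp ((x /\<^sub>R c) \<bullet> \<xi>) * complex_of_real (gaussian 1 \<xi>)"
  have eq: "?f (0 + c *\<^sub>R \<xi>) = iexp (x \<bullet> \<xi>) * complex_of_real (gaussian c \<xi>)" for \<xi>
    using c by (simp add: gaussian_def field_simps)
  have 1: "integrable lborel ?f" "(LBINT \<xi>. ?f \<xi>) = (complex_of_real (2 * pi * gaussian 1 (x /\<^sub>R c)))"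
    using fourier_gaussian_std[of "x /\<^sub>R c"] by (auto simp: has_bochner_integral_iff)
  have 2: "integrable lborel (\<lambda>\<xi>. ?f (0 + c *\<^sub>R \<xi>))"
    using c 1 by (intro lborel_integrable_scaleR) auto
  have 3: "complex_of_real (2 * pi * gaussian 1 (x /\<^sub>R c)) = c\<^sup>2 *\<^sub>R (LBINT \<xi>. ?f (0 + c *\<^sub>R \<xi>))"
    using lborel_integral_scaleR[of c ?f 0] 1 c by simp
  have 4: "gaussian 1 (x /\<^sub>R c) = gaussian (1/c) x"
    using c by (simp add: gaussian_def field_simps)
  show ?thesis
    using 2 3 c unfolding eq 4 has_bochner_integral_iff by (simp add: scaleR_conv_of_real nonzero_eq_divide_eq mult.commute)
qed

lemma integrable_gaussian: "c > 0 \<Longrightarrow> integrable lborel (gaussian c)"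
  using fourier_gaussian[of c 0] integrable_Re[of lborel "\<lambda>x. complex_of_real (gaussian c x)"]
  by (auto simp: has_bochner_integral_iff)

lemma integral_gaussian: "c > 0 \<Longrightarrow> (LBINT x. gaussian c x) = 2 * pi / c\<^sup>2"
  using fourier_gaussian[of c 0] by (simp add: has_bochner_integral_iff gaussian_def del: of_real_mult of_real_divide)

text \<open>The heat kernel at time c^2/2. Up to the factor 2 pi it is the \<open>fourier\<close>
  transform of \<open>gaussian c\<close>, so a wide frequency cut-off (small \<open>c\<close>)
  corresponds to a narrow kernel.\<close>

definition heat :: "real \<Rightarrow> real^2 \<Rightarrow> real" where
  "heat c x = gaussian (1 / c) x / (2 * pi * c\<^sup>2)"

lemma heat_nonneg: "0 \<le> heat c x" by (simp add: heat_def gaussian_pos)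

lemma measurable_heat[measurable]: "heat c \<in> borel_measurable borel"
  unfolding heat_def by measurable

lemma heat_minus_commute: "heat c (x - y) = heat c (y - x)"
  by (simp add: heat_def gaussian_minus_commute)

lemma heat_bound: "c > 0 \<Longrightarrow> heat c x \<le> 1 / (2 * pi * c\<^sup>2)"
  unfolding heat_def by (intro divide_right_mono gaussian_le_1) auto

lemma integrable_heat: "c > 0 \<Longrightarrow> integrable lborel (heat c)"
  unfolding heat_def by (intro integrable_divide integrable_gaussian) auto

lemma integral_heat: "c > 0 \<Longrightarrow> (LBINT x. heat c x) = 1"
  unfolding heat_def by (simp add: integral_gaussian power_one_over field_simps)

lemma heat_scale: "c > 0 \<Longrightarrow> c\<^sup>2 * heat c (c *\<^sub>R w) = heat 1 w"
  by (simp add: heat_def gaussian_def)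

lemma lborel_integral_shift:
  fixes f :: "'a::euclidean_space \<Rightarrow> 'b::{banach, second_countable_topology}"
  shows "(LBINT x. f (t + x)) = (LBINT x. f x)" "(LBINT x. f (t - x)) = (LBINT x. f x)"
  using lborel_integral_scaleR[of 1 f t] lborel_integral_scaleR[of "-1" f t] by simp_all

lemma lborel_integrable_shift:
  fixes f :: "'a::euclidean_space \<Rightarrow> 'b::{banach, second_countable_topology}"
  assumes "integrable lborel f"
  shows "integrable lborel (\<lambda>x. f (t + x))" "integrable lborel (\<lambda>x. f (t - x))" "integrable lborel (\<lambda>x. f (- x))"
  using lborel_integrable_scaleR[of 1 f t] lborel_integrable_scaleR[of "-1" f t] lborel_integrable_scaleR[of "-1" f 0] assms by simp_all

text \<open>The substitution z = c w freezes the kernel and leaves the parameter in the argument of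
  \<open>\<psi>\<close> only, where continuity and dominated convergence apply.\<close>

lemma heat_approx_identity:
  fixes \<psi> :: "real^2 \<Rightarrow> 'b::{banach, second_countable_topology}"
  assumes cont: "continuous_on UNIV \<psi>" and bdd: "\<And>x. norm (\<psi> x) \<le> K"
  shows "(\<lambda>n. LBINT z. heat (1 / real (Suc n)) z *\<^sub>R \<psi> (y - z)) \<longlonglongrightarrow> \<psi> y"
proof -
  have [measurable]: "\<psi> \<in> borel_measurable borel" using cont by (rule borel_measurable_continuous_onI)
  have eq: "(LBINT z. heat c z *\<^sub>R \<psi> (y - z)) = (LBINT w. heat 1 w *\<^sub>R \<psi> (y - c *\<^sub>R w))" if "c > 0" for c
  proof -
    have "(LBINT z. heat c z *\<^sub>R \<psi> (y - z)) = c\<^sup>2 *\<^sub>R (LBINT w. heat c (c *\<^sub>R w) *\<^sub>R \<psi> (y - c *\<^sub>R w))"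
      using that lborel_integral_scaleR[of c "\<lambda>z. heat c z *\<^sub>R \<psi> (y - z)" 0] by simp
    also have "\<dots> = (LBINT w. (c\<^sup>2 * heat c (c *\<^sub>R w)) *\<^sub>R \<psi> (y - c *\<^sub>R w))"
      by (subst integral_scaleR_right[symmetric]) (simp_all)
    finally show ?thesis by (simp only: heat_scale[OF that])
  qed
  have "(\<lambda>n. LBINT w. heat 1 w *\<^sub>R \<psi> (y - (1 / real (Suc n)) *\<^sub>R w)) \<longlonglongrightarrow> (LBINT w. heat 1 w *\<^sub>R \<psi> y)"
  proof (rule integral_dominated_convergence[where w="\<lambda>w. heat 1 w * K"])
    show "integrable lborel (\<lambda>w. heat 1 w * K)" by (intro integrable_mult_left integrable_heat) auto
    show "AE x in lborel. (\<lambda>i. heat 1 x *\<^sub>R \<psi> (y - (1 / real (Suc i)) *\<^sub>R x)) \<longlonglongrightarrow> heat 1 x *\<^sub>R \<psi> y"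
    proof (intro AE_I2 tendsto_intros)
      fix x
      have "(\<lambda>i. y - (1 / real (Suc i)) *\<^sub>R x) \<longlonglongrightarrow> y - 0 *\<^sub>R x"
        by (intro tendsto_intros LIMSEQ_Suc lim_1_over_n)
      then show "(\<lambda>i. \<psi> (y - (1 / real (Suc i)) *\<^sub>R x)) \<longlonglongrightarrow> \<psi> y"
        using cont by (auto simp: continuous_on_eq_continuous_at isCont_def intro: isCont_tendsto_compose)
    qed
    show "AE x in lborel. norm (heat 1 x *\<^sub>R \<psi> (y - (1 / real (Suc i)) *\<^sub>R x)) \<le> heat 1 x * K" for i
      by (auto simp: heat_nonneg intro!: mult_left_mono bdd)
  qed measurable
  also have "(LBINT w. heat 1 w *\<^sub>R \<psi> y) = \<psi> y"
    using integrable_heat[of 1] integral_heat[of 1] by simp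
  finally show ?thesis by (subst eq) auto
qed

section \<open>The Fourier transform of integrable functions\<close>

lemma integrable_kernel_product:
  fixes u v :: "real^2 \<Rightarrow> complex" and k :: "real^2 \<Rightarrow> real^2 \<Rightarrow> complex"
  assumes u: "integrable lborel u" and v: "integrable lborel v"
    and k[measurable]: "(\<lambda>(x, y). k x y) \<in> borel_measurable (borel \<Otimes>\<^sub>M borel)" and K: "\<And>x y. norm (k x y) \<le> K"
  shows "integrable (lborel \<Otimes>\<^sub>M lborel) (\<lambda>(x, y). k x y * u x * v y)"
proof -
  have [measurable]: "u \<in> borel_measurable borel" "v \<in> borel_measurable borel" using u v by auto
  have K0: "0 \<le> K" using K[of 0 0] norm_ge_zero order_trans by blast
  have "integrable (lborel \<Otimes>\<^sub>M lborel) (\<lambda>p. K * (norm (u (fst p)) * norm (v (snd p))))"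
    using u v by (intro integrable_mult_right lborel_pair.Fubini_integrable)
      (auto simp: abs_mult)
  then show ?thesis
    by (rule Bochner_Integration.integrable_bound)
      (use K0 in \<open>auto simp: norm_mult mult.assoc abs_mult intro!: AE_I2 mult_right_mono K\<close>)
qed

lemma norm_iexp[simp]: "cmod (exp (- (\<i> * complex_of_real a))) = 1" "cmod (exp (\<i> * complex_of_real a)) = 1"
   using norm_exp_i_times[of a] norm_exp_i_times[of "-a"] by (simp_all)

lemma measurable_fourier[measurable]:
  assumes [measurable]: "u \<in> borel_measurable borel"
  shows "fourier u \<in> borel_measurable borel"
  unfolding fourier_def[abs_def] by measurable

lemma norm_fourier_le: "norm (fourier u \<xi>) \<le> (LBINT x. norm (u x)) / (2 * pi)"
proof -
  have "norm (LBINT x. exp (- \<i> * complex_of_real (x \<bullet> \<xi>)) * u x) \<le> (LBINT x. norm (exp (- \<i> * complex_of_real (x \<bullet> \<xi>)) * u x))"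
    by (rule integral_norm_bound)
  then show ?thesis
    by (simp add: fourier_def norm_divide norm_mult divide_right_mono)
qed

lemma integrable_iexp_mult:
  assumes "integrable lborel u"
  shows "integrable lborel (\<lambda>x. exp (- \<i> * complex_of_real (x \<bullet> \<xi>)) * u x)"
  using assms by (auto simp: norm_mult intro!: Bochner_Integration.integrable_bound[OF assms])

lemma fourier_add:
  assumes "integrable lborel u" "integrable lborel v"
  shows "fourier (\<lambda>x. u x + v x) \<xi> = fourier u \<xi> + fourier v \<xi>"
  using integrable_iexp_mult[OF assms(1)] integrable_iexp_mult[OF assms(2)]
  by (simp add: fourier_def distrib_left add_divide_distrib)

lemma fourier_diff:
  assumes "integrable lborel u" "integrable lborel v"
  shows "fourier (\<lambda>x. u x - v x) \<xi> = fourier u \<xi> - fourier v \<xi>"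
  using integrable_iexp_mult[OF assms(1)] integrable_iexp_mult[OF assms(2)]
  by (simp add: fourier_def right_diff_distrib diff_divide_distrib)

lemma fourier_multiplication_formula:
  assumes u: "integrable lborel u" and v: "integrable lborel v"
  shows "(LBINT \<xi>. fourier u \<xi> * v \<xi>) = (LBINT x. u x * fourier v x)"
proof -
  let ?k = "\<lambda>x \<xi>. exp (- \<i> * complex_of_real (x \<bullet> \<xi>)) * u x * v \<xi>"
  have "integrable (lborel \<Otimes>\<^sub>M lborel) (\<lambda>(x, \<xi>). ?k x \<xi>)"
    by (rule integrable_kernel_product[OF u v, where K=1]) (auto)
  note Fub = lborel_pair.Fubini_integral[OF this]
  have A: "fourier u \<xi> * v \<xi> = (LBINT x. ?k x \<xi>) / complex_of_real (2 * pi)" for \<xi>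
    unfolding fourier_def by simp
  have B: "u x * fourier v x = (LBINT \<xi>. ?k x \<xi>) / complex_of_real (2 * pi)" for x
  proof -
    have "(LBINT \<xi>. ?k x \<xi>) = (LBINT \<xi>. u x * (exp (- \<i> * complex_of_real (\<xi> \<bullet> x)) * v \<xi>))"
      by (intro Bochner_Integration.integral_cong refl) (simp add: inner_commute)
    then show ?thesis unfolding fourier_def by simp
  qed
  show ?thesis unfolding A B using Fub by simp
qed

lemma fourier_modulated_gaussian:
  assumes "c > 0"
  shows "fourier (\<lambda>\<xi>. iexp (y \<bullet> \<xi>) * complex_of_real (gaussian c \<xi>)) x = complex_of_real (2 * pi * heat c (y - x))"
proof -
  have "fourier (\<lambda>\<xi>. iexp (y \<bullet> \<xi>) * complex_of_real (gaussian c \<xi>)) x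
     = (LBINT \<xi>. iexp ((y - x) \<bullet> \<xi>) * complex_of_real (gaussian c \<xi>)) / complex_of_real (2 * pi)"
    unfolding fourier_def
    by (intro arg_cong2[where f="(/)"] Bochner_Integration.integral_cong refl)
      (simp add: inner_diff_left inner_diff_right inner_commute exp_diff exp_minus right_diff_distrib field_simps)
  then show ?thesis
    using fourier_gaussian[OF assms, of "y - x"] unfolding has_bochner_integral_iff
    by (simp add: heat_def power2_eq_square)
qed

lemma integrable_modulated_gaussian:
  assumes "c > 0"
  shows "integrable lborel (\<lambda>\<xi>. iexp (y \<bullet> \<xi>) * complex_of_real (gaussian c \<xi>))"
  using fourier_gaussian[OF assms, of y] by (simp add: has_bochner_integral_iff)

text \<open>The multiplication formula tested on a modulated Gaussian. It expresses the heat
  regularisation of \<open>u\<close> through its transform alone, which is the source of inversion,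
  injectivity and the L^2 bound.\<close>

lemma heat_convolution_fourier:
  assumes u: "integrable lborel u" and c: "c > 0"
  shows "(LBINT \<xi>. iexp (y \<bullet> \<xi>) * complex_of_real (gaussian c \<xi>) * fourier u \<xi>)
    = 2 * pi * (LBINT x. complex_of_real (heat c (y - x)) * u x)"
  using fourier_multiplication_formula[OF u integrable_modulated_gaussian[OF c, of y]]
  unfolding fourier_modulated_gaussian[OF c]
  by (subst integral_mult_right_zero[symmetric]) (simp add: mult_ac)

lemma gaussian_tendsto_1: "(\<lambda>n. gaussian (1 / real (Suc n)) \<xi>) \<longlonglongrightarrow> 1"
proof -
  have "(\<lambda>n. exp (- (1 / real (Suc n) * norm \<xi>)\<^sup>2 / 2)) \<longlonglongrightarrow> exp (- (0 * norm \<xi>)\<^sup>2 / 2)"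
    by (intro tendsto_intros LIMSEQ_Suc lim_1_over_n) auto
  then show ?thesis by (simp add: gaussian_def)
qed

text \<open>As the Gaussian cut-off widens, one side of \<open>heat_convolution_fourier\<close>
  converges by domination by \<open>fourier u\<close>, the other because the heat kernel is an
  approximate identity.\<close>

lemma fourier_inversion:
  assumes u: "integrable lborel u" "continuous_on UNIV u" "\<And>x. norm (u x) \<le> K"
    and fu: "integrable lborel (fourier u)"
  shows "fourier (fourier u) (- y) = u y"
proof -
  let ?c = "\<lambda>n. 1 / real (Suc n)"
  have [measurable]: "u \<in> borel_measurable borel" using u(1) by auto
  have "(\<lambda>n. LBINT \<xi>. iexp (y \<bullet> \<xi>) * complex_of_real (gaussian (?c n) \<xi>) * fourier u \<xi>)
     \<longlonglongrightarrow> (LBINT \<xi>. iexp (y \<bullet> \<xi>) * complex_of_real 1 * fourier u \<xi>)"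
  proof (rule integral_dominated_convergence[where w="\<lambda>\<xi>. norm (fourier u \<xi>)"])
    show "integrable lborel (\<lambda>\<xi>. norm (fourier u \<xi>))" using fu by auto
    show "AE \<xi> in lborel. (\<lambda>n. iexp (y \<bullet> \<xi>) * complex_of_real (gaussian (?c n) \<xi>) * fourier u \<xi>)
       \<longlonglongrightarrow> iexp (y \<bullet> \<xi>) * complex_of_real 1 * fourier u \<xi>"
      by (intro AE_I2 tendsto_intros gaussian_tendsto_1)
    show "AE \<xi> in lborel. norm (iexp (y \<bullet> \<xi>) * complex_of_real (gaussian (?c n) \<xi>) * fourier u \<xi>)
       \<le> norm (fourier u \<xi>)" for n
      by (auto simp: norm_mult gaussian_pos gaussian_le_1 intro!: mult_left_le_one_le)
  qed measurable
  moreover have "(\<lambda>n. LBINT \<xi>. iexp (y \<bullet> \<xi>) * complex_of_real (gaussian (?c n) \<xi>) * fourier u \<xi>)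
     \<longlonglongrightarrow> 2 * pi * u y"
  proof -
    have "(LBINT \<xi>. iexp (y \<bullet> \<xi>) * complex_of_real (gaussian (?c n) \<xi>) * fourier u \<xi>)
       = 2 * pi * (LBINT z. heat (?c n) z *\<^sub>R u (y - z))" for n
    proof -
      have "(LBINT x. complex_of_real (heat (?c n) (y - x)) * u x) = (LBINT z. complex_of_real (heat (?c n) (y - (y - z))) * u (y - z))"
        by (rule lborel_integral_shift(2)[symmetric])
      then show ?thesis using heat_convolution_fourier[OF u(1), of "?c n" y] by (simp add: scaleR_conv_of_real)
    qed
    then show ?thesis
      using tendsto_mult_left[OF heat_approx_identity[OF u(2,3)], of "2 * complex_of_real pi"] by simp
  qed
  ultimately have "(LBINT \<xi>. iexp (y \<bullet> \<xi>) * fourier u \<xi>) = 2 * pi * u y"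
    using LIMSEQ_unique by fastforce
  then show ?thesis by (simp add: fourier_def[of "fourier u"] inner_commute)
qed

text \<open>Closed sets form an intersection-stable generator of the Borel sets, and their
  indicators are bounded limits of continuous functions. Dynkin's argument then annihilates the
  integral of \<open>u\<close> over every Borel set.\<close>

lemma AE_eq_0_if_continuous_tests:
  fixes u :: "'a::euclidean_space \<Rightarrow> 'b::{banach, second_countable_topology}"
  assumes u: "integrable lborel u"
    and test: "\<And>\<psi>::'a \<Rightarrow> real. continuous_on UNIV \<psi> \<Longrightarrow> (\<And>x. \<bar>\<psi> x\<bar> \<le> 1) \<Longrightarrow> (LBINT x. \<psi> x *\<^sub>R u x) = 0"
  shows "AE x in lborel. u x = 0"
proof (rule sigma_finite_measure.density_zero[OF sigma_finite_lborel u])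
  fix A :: "'a set"
  assume "A \<in> sets lborel"
  then have A: "A \<in> sigma_sets UNIV (Collect closed)"
    by (simp add: borel_eq_closed)
  have UNIV: "(LBINT x. u x) = 0" using test[of "\<lambda>_. 1"] by simp
  have int: "set_integrable lborel A u" if "A \<in> sigma_sets UNIV (Collect closed)" for A
    using that u unfolding set_integrable_def by (intro integrable_mult_indicator) (simp_all add: borel_eq_closed)
  have "Int_stable (Collect closed :: 'a set set)" "Collect closed \<subseteq> Pow (UNIV :: 'a set)"
    by (auto simp: Int_stable_def)
  from this A show "set_lebesgue_integral lborel A u = 0"
  proof (induction A rule: sigma_sets_induct_disjoint)
    case (basic K)
    then have K: "closed K" by simp
    show ?case
    proof (cases "K = {}")
      case False
      \<comment> \<open>Continuous approximations of the indicator of \<open>K\<close>. The empty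
        set is treated apart because \<open>infdist\<close> to it is 0 by convention.\<close>
      define \<psi> where "\<psi> n x = max 0 (1 - real n * infdist x K)" for n x
      have "(\<lambda>n. LBINT x. \<psi> n x *\<^sub>R u x) \<longlonglongrightarrow> (LBINT x. indicator K x *\<^sub>R u x)"
      proof (rule integral_dominated_convergence[where w="\<lambda>x. norm (u x)"])
        show "integrable lborel (\<lambda>x. norm (u x))" using u by auto
        show "(\<lambda>x. indicat_real K x *\<^sub>R u x) \<in> borel_measurable lborel"
          using borel_measurable_integrable[OF u] borel_closed[OF K] by measurable
        show "(\<lambda>x. \<psi> n x *\<^sub>R u x) \<in> borel_measurable lborel" for n
        proof -
          have "continuous_on UNIV (\<psi> n)" unfolding \<psi>_def[abs_def] by (intro continuous_intros)
          then show ?thesis using borel_measurable_integrable[OF u]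
            by (intro borel_measurable_scaleR) (auto intro: borel_measurable_continuous_onI)
        qed
        show "AE x in lborel. norm (\<psi> n x *\<^sub>R u x) \<le> norm (u x)" for n
          by (intro AE_I2) (auto simp: \<psi>_def infdist_nonneg intro!: mult_left_le_one_le)
        show "AE x in lborel. (\<lambda>n. \<psi> n x *\<^sub>R u x) \<longlonglongrightarrow> indicat_real K x *\<^sub>R u x"
        proof (intro AE_I2 tendsto_intros)
          fix x
          show "(\<lambda>n. \<psi> n x) \<longlonglongrightarrow> indicat_real K x"
          proof (cases "x \<in> K")
            case True then show ?thesis by (simp add: \<psi>_def)
          next
            case xK: False
            then have d: "infdist x K > 0"
              using K False by (meson infdist_pos_not_in_closed)
            obtain N where N: "1 / infdist x K < real N" using reals_Archimedean2 by blast
            have "\<psi> n x = 0" if "n \<ge> N" for n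
            proof -
              have "1 / infdist x K < real n" using N that by simp
              then show ?thesis using d by (simp add: \<psi>_def field_simps max_def)
            qed
            then have "eventually (\<lambda>n. \<psi> n x = 0) sequentially" by (auto simp: eventually_sequentially)
            then show ?thesis using xK by (simp add: tendsto_eventually)
          qed
        qed
      qed
      moreover have "(LBINT x. \<psi> n x *\<^sub>R u x) = 0" for n
        by (rule test) (auto simp: \<psi>_def infdist_nonneg intro!: continuous_intros)
      ultimately show ?thesis by (simp add: set_lebesgue_integral_def LIMSEQ_const_iff)
    qed (simp add: set_lebesgue_integral_def)
  next
    case (compl A)
    have "(LBINT x. indicat_real (UNIV - A) x *\<^sub>R u x) = (LBINT x. u x - indicat_real A x *\<^sub>R u x)"
      by (intro Bochner_Integration.integral_cong) (auto simp: indicator_def)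
    also have "\<dots> = 0" using compl u int[OF compl(1)] UNIV
      by (simp add: set_lebesgue_integral_def set_integrable_def)
    finally show ?case by (simp add: set_lebesgue_integral_def)
  next
    case (union A)
    have *: "A i \<in> sigma_sets UNIV (Collect closed)" for i using union by auto
    show ?case
      using union(3) * int[of "\<Union>i. A i"] union(1)
      by (subst lebesgue_integral_countable_add)
        (auto simp: borel_eq_closed disjoint_family_on_def intro: sigma_sets.Union)
  qed (auto simp: set_lebesgue_integral_def)
qed

text \<open>By Fubini and evenness of the kernel, pairing \<open>u\<close> with the heat
  regularisation of a test function equals pairing the test function with the heat regularisation of
  \<open>u\<close>. The latter is zero by \<open>heat_convolution_fourier\<close>, and the
  regularised tests converge boundedly.\<close>

lemma fourier_eq_0_imp_AE_eq_0:
  assumes u: "integrable lborel u" and 0: "\<And>\<xi>. fourier u \<xi> = 0"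
  shows "AE x in lborel. u x = 0"
proof (rule AE_eq_0_if_continuous_tests[OF u])
  fix \<psi> :: "real^2 \<Rightarrow> real"
  assume cont: "continuous_on UNIV \<psi>" and b: "\<And>x. \<bar>\<psi> x\<bar> \<le> 1"
  have [measurable]: "u \<in> borel_measurable borel" "\<psi> \<in> borel_measurable borel"
    using u cont by (auto intro: borel_measurable_continuous_onI)
  let ?c = "\<lambda>n. 1 / real (Suc n)"
  define S where "S n x = (LBINT z. heat (?c n) z *\<^sub>R \<psi> (x - z))" for n x
  have [measurable]: "S n \<in> borel_measurable borel" for n unfolding S_def[abs_def] by measurable
  have hint: "integrable lborel (\<lambda>z. heat (?c n) z *\<^sub>R \<psi> (x - z))" for n x
    by (rule Bochner_Integration.integrable_bound[OF integrable_heat[of "?c n"]])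
      (auto intro!: AE_I2 mult_left_le simp: b abs_mult heat_nonneg)
  have Sb: "\<bar>S n x\<bar> \<le> 1" for n x
  proof -
    have "\<bar>S n x\<bar> \<le> (LBINT z. norm (heat (?c n) z *\<^sub>R \<psi> (x - z)))"
      unfolding S_def real_norm_def[symmetric] by (rule integral_norm_bound)
    also have "\<dots> \<le> (LBINT z. heat (?c n) z)"
      using hint by (intro integral_mono integrable_heat integrable_norm)
       (auto intro!: mult_left_le simp: b abs_mult heat_nonneg)
    finally show ?thesis using integral_heat[of "?c n"] by simp
  qed
  have "(LBINT x. S n x *\<^sub>R u x) = 0" for n
  proof -
    have hu: "(LBINT x. complex_of_real (heat (?c n) (y - x)) * u x) = 0" for y
      using heat_convolution_fourier[OF u, of "?c n" y] 0 by simp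
    let ?F = "\<lambda>x y. complex_of_real (heat (?c n) (x - y) * \<psi> y) * u x"
    have I: "integrable (lborel \<Otimes>\<^sub>M lborel) (\<lambda>(x,y). ?F x y)"
    proof (rule Bochner_Integration.integrable_bound)
      show "integrable (lborel \<Otimes>\<^sub>M lborel) (\<lambda>(x,y). heat (?c n) (x - y) * norm (u x))"
      proof (rule lborel_pair.Fubini_integrable)
        have "(LBINT y. heat (?c n) (x - y)) = 1" for x
          using lborel_integral_shift(2)[of "heat (?c n)" x] integral_heat[of "?c n"] by simp
        then show "integrable lborel (\<lambda>x. LBINT y. norm (case (x, y) of (x, y) \<Rightarrow> heat (?c n) (x - y) * norm (u x)))"
          using u by (simp add: abs_mult heat_nonneg)
        show "AE x in lborel. integrable lborel (\<lambda>y. case (x, y) of (x, y) \<Rightarrow> heat (?c n) (x - y) * norm (u x))"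
          by (auto intro!: lborel_integrable_shift integrable_heat)
      qed measurable
      show "AE p in lborel \<Otimes>\<^sub>M lborel. norm (case p of (x, y) \<Rightarrow> ?F x y) \<le> norm (case p of (x,y) \<Rightarrow> heat (?c n) (x - y) * norm (u x))"
        by (intro AE_I2) (auto simp: norm_mult abs_mult heat_nonneg b intro!: mult_right_mono mult_left_le)
    qed measurable
    have "(LBINT x. S n x *\<^sub>R u x) = (LBINT x. LBINT y. ?F x y)"
    proof (intro Bochner_Integration.integral_cong refl)
      fix x
      have "S n x = (LBINT y. heat (?c n) (x - y) * \<psi> (x - (x - y)))"
        unfolding S_def using lborel_integral_shift(2)[of "\<lambda>z. heat (?c n) z *\<^sub>R \<psi> (x - z)" x] by simp
      then show "S n x *\<^sub>R u x = (LBINT y. ?F x y)"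
        by (simp add: scaleR_conv_of_real flip: integral_complex_of_real)
    qed
    also have "\<dots> = (LBINT y. LBINT x. ?F x y)"
      by (rule lborel_pair.Fubini_integral[OF I, symmetric])
    also have "\<dots> = (LBINT y. complex_of_real (\<psi> y) * (LBINT x. complex_of_real (heat (?c n) (y - x)) * u x))"
      by (intro Bochner_Integration.integral_cong refl, subst integral_mult_right_zero[symmetric])
        (simp add: mult_ac heat_minus_commute)
    also have "\<dots> = 0" by (simp only: hu) simp
    finally show ?thesis .
  qed
  moreover have "(\<lambda>n. LBINT x. S n x *\<^sub>R u x) \<longlonglongrightarrow> (LBINT x. \<psi> x *\<^sub>R u x)"
  proof (rule integral_dominated_convergence[where w="\<lambda>x. norm (u x)"])
    show "AE x in lborel. (\<lambda>n. S n x *\<^sub>R u x) \<longlonglongrightarrow> \<psi> x *\<^sub>R u x"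
      unfolding S_def by (intro AE_I2 tendsto_intros heat_approx_identity[where K=1]) (use cont b in auto)
  qed (use u Sb in \<open>auto intro!: mult_left_le_one_le\<close>)
  ultimately show "(LBINT x. \<psi> x *\<^sub>R u x) = 0" by (simp add: LIMSEQ_const_iff)
qed

text \<open>
  With a Gaussian regularisation the left-hand side becomes a double integral of \<open>u x * cnj (u y)\<close>
  against the heat kernel, to which Schur's test applies.
\<close>

lemma fourier_L2_bound:
  assumes u: "integrable lborel u"
  shows "(\<integral>\<^sup>+\<xi>. ennreal ((norm (fourier u \<xi>))\<^sup>2) \<partial>lborel) \<le> (\<integral>\<^sup>+x. ennreal ((norm (u x))\<^sup>2) \<partial>lborel)"
proof -
  have [measurable]: "u \<in> borel_measurable borel" using u by auto
  define K where "K = (LBINT x. norm (u x)) / (2 * pi)"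
  have K: "norm (fourier u \<xi>) \<le> K" for \<xi> unfolding K_def by (rule norm_fourier_le)
  have K0: "K \<ge> 0" using K[of 0] norm_ge_zero order_trans by blast
  have main: "(\<integral>\<^sup>+\<xi>. ennreal (gaussian c \<xi> * (norm (fourier u \<xi>))\<^sup>2) \<partial>lborel) \<le> (\<integral>\<^sup>+x. ennreal ((norm (u x))\<^sup>2) \<partial>lborel)"
    if c: "c > 0" for c
  proof -
    let ?U = "\<lambda>x. ennreal ((norm (u x))\<^sup>2 / 2)" and ?H = "\<lambda>x y. ennreal (heat c (x - y))"
    \<comment> \<open>Chosen so that \<open>fourier u\<close> times \<open>v\<close> is the
      regularised square of the modulus, while the transform of \<open>v\<close> is the conjugate of
      the heat regularisation of \<open>u\<close>.\<close>
    define v where "v \<xi> = cnj (fourier u \<xi>) * complex_of_real (gaussian c \<xi>)" for \<xi>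
    have [measurable]: "cnj \<in> borel_measurable borel"
      by (intro borel_measurable_continuous_onI continuous_intros)
    have [measurable]: "v \<in> borel_measurable borel" unfolding v_def by measurable
    have vi: "integrable lborel v"
      by (rule Bochner_Integration.integrable_bound[OF integrable_mult_right[OF integrable_gaussian[OF c], of K]])
        (auto simp: v_def norm_mult gaussian_pos K K0 abs_mult intro!: mult_right_mono AE_I2)
    have fv: "fourier v x = cnj (LBINT y. complex_of_real (heat c (x - y)) * u y)" for x
    proof -
      have "cnj (fourier v x) = (LBINT \<xi>. iexp (x \<bullet> \<xi>) * complex_of_real (gaussian c \<xi>) * fourier u \<xi>) / (2 * pi)"
        unfolding fourier_def[of v] v_def complex_cnj_divide Bochner_Integration.integral_cnj[symmetric]
        by (intro arg_cong2[where f="(/)"] Bochner_Integration.integral_cong refl)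
          (simp_all add: exp_cnj inner_commute mult_ac)
      also have "\<dots> = (LBINT y. complex_of_real (heat c (x - y)) * u y)"
        using heat_convolution_fourier[OF u c, of x] by simp
      finally show ?thesis by (metis complex_cnj_cnj)
    qed
    have fi: "integrable lborel (\<lambda>\<xi>. gaussian c \<xi> * (norm (fourier u \<xi>))\<^sup>2)"
      by (rule Bochner_Integration.integrable_bound[OF integrable_mult_right[OF integrable_gaussian[OF c], of "K\<^sup>2"]])
        (auto simp: gaussian_pos abs_mult mult.commute[of "K\<^sup>2"] intro!: mult_left_mono power_mono K)
    have eq: "complex_of_real (LBINT \<xi>. gaussian c \<xi> * (norm (fourier u \<xi>))\<^sup>2) = (LBINT x. u x * fourier v x)"
    proof -
      have "complex_of_real (LBINT \<xi>. gaussian c \<xi> * (norm (fourier u \<xi>))\<^sup>2) = (LBINT \<xi>. fourier u \<xi> * v \<xi>)"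
        unfolding integral_complex_of_real[symmetric]
        by (intro Bochner_Integration.integral_cong refl)
          (simp add: v_def mult_ac flip: complex_norm_square complex_mult_cnj)
      then show ?thesis using fourier_multiplication_formula[OF u vi] by simp
    qed
    have "(\<integral>\<^sup>+\<xi>. ennreal (gaussian c \<xi> * (norm (fourier u \<xi>))\<^sup>2) \<partial>lborel) = ennreal (LBINT \<xi>. gaussian c \<xi> * (norm (fourier u \<xi>))\<^sup>2)"
      using fi by (rule nn_integral_eq_integral) (auto simp: gaussian_pos)
    also have "\<dots> = ennreal (norm (complex_of_real (LBINT \<xi>. gaussian c \<xi> * (norm (fourier u \<xi>))\<^sup>2)))"
      by (simp add: gaussian_pos)
    also have "\<dots> = ennreal (norm (LBINT x. u x * fourier v x))" by (simp only: eq)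
    also have "\<dots> \<le> (\<integral>\<^sup>+x. ennreal (norm (u x * fourier v x)) \<partial>lborel)"
      by (cases "integrable lborel (\<lambda>x. u x * fourier v x)")
        (auto intro: integral_norm_bound_ennreal simp: not_integrable_integral_eq)
    also have "\<dots> \<le> (\<integral>\<^sup>+x. \<integral>\<^sup>+y. ?H x y * ennreal (norm (u x) * norm (u y)) \<partial>lborel \<partial>lborel)"
    proof (intro nn_integral_mono)
      fix x
      have hi: "integrable lborel (\<lambda>y. complex_of_real (heat c (x - y)) * u y)"
        by (rule Bochner_Integration.integrable_bound[OF integrable_mult_right[OF integrable_norm[OF u], of "1 / (2 * pi * c\<^sup>2)"]])
          (use heat_bound[OF c] c in \<open>auto simp: norm_mult heat_nonneg intro!: AE_I2 mult_right_mono simp del: times_divide_eq_left\<close>)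
      have "ennreal (norm (u x * fourier v x)) = ennreal (norm (u x)) * ennreal (norm (LBINT y. complex_of_real (heat c (x - y)) * u y))"
        by (simp add: norm_mult ennreal_mult fv)
      also have "\<dots> \<le> ennreal (norm (u x)) * (\<integral>\<^sup>+y. ennreal (norm (complex_of_real (heat c (x - y)) * u y)) \<partial>lborel)"
        by (intro mult_left_mono integral_norm_bound_ennreal hi) auto
      also have "\<dots> = (\<integral>\<^sup>+y. ?H x y * ennreal (norm (u x) * norm (u y)) \<partial>lborel)"
        by (subst nn_integral_cmult[symmetric]) (auto simp: norm_mult heat_nonneg ennreal_mult mult_ac)
      finally show "ennreal (norm (u x * fourier v x)) \<le> (\<integral>\<^sup>+y. ?H x y * ennreal (norm (u x) * norm (u y)) \<partial>lborel)" .
    qed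
    \<comment> \<open>The inequality between geometric and arithmetic mean separates the two
      factors; in each summand the kernel is then integrated out to 1.\<close>
    also have "\<dots> \<le> (\<integral>\<^sup>+x. \<integral>\<^sup>+y. ?H x y * ?U x + ?H x y * ?U y \<partial>lborel \<partial>lborel)"
    proof (intro nn_integral_mono)
      fix x y
      have "norm (u x) * norm (u y) \<le> (norm (u x))\<^sup>2 / 2 + (norm (u y))\<^sup>2 / 2"
        using sum_squares_bound[of "norm (u x)" "norm (u y)"] by (simp add: power2_eq_square)
      then have "ennreal (norm (u x) * norm (u y)) \<le> ?U x + ?U y"
        by (simp flip: ennreal_plus) 
      then show "?H x y * ennreal (norm (u x) * norm (u y)) \<le> ?H x y * ?U x + ?H x y * ?U y"
        by (simp add: mult_left_mono flip: distrib_left)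
    qed
    also have "\<dots> = (\<integral>\<^sup>+x. \<integral>\<^sup>+y. ?H x y * ?U x \<partial>lborel \<partial>lborel)
       + (\<integral>\<^sup>+x. \<integral>\<^sup>+y. ?H x y * ?U y \<partial>lborel \<partial>lborel)"
      by (subst nn_integral_add[symmetric]) (auto simp: nn_integral_add)
    also have "(\<integral>\<^sup>+x. \<integral>\<^sup>+y. ?H x y * ?U y \<partial>lborel \<partial>lborel)
      = (\<integral>\<^sup>+y. \<integral>\<^sup>+x. ennreal (heat c (y - x)) * ?U y \<partial>lborel \<partial>lborel)"
      by (subst lborel_pair.Fubini') (auto simp: heat_minus_commute)
    also have hh: "(\<integral>\<^sup>+x. \<integral>\<^sup>+y. ?H x y * ?U x \<partial>lborel \<partial>lborel) = (\<integral>\<^sup>+x. ?U x \<partial>lborel)"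
    proof (intro nn_integral_cong)
      fix x
      have "(\<integral>\<^sup>+y. ?H x y \<partial>lborel) = ennreal (LBINT y. heat c (x - y))"
        using c by (intro nn_integral_eq_integral lborel_integrable_shift integrable_heat) (auto simp: heat_nonneg)
      also have "\<dots> = 1" using lborel_integral_shift(2)[of "heat c" x] integral_heat[OF c] by simp
      finally show "(\<integral>\<^sup>+y. ?H x y * ?U x \<partial>lborel) = ?U x"
        by (subst nn_integral_multc) auto
    qed
    also have "(\<integral>\<^sup>+x. ?U x \<partial>lborel) + (\<integral>\<^sup>+x. ?U x \<partial>lborel) = (\<integral>\<^sup>+x. ennreal ((norm (u x))\<^sup>2) \<partial>lborel)"
      by (subst nn_integral_add[symmetric]) (auto simp flip: ennreal_plus)
    finally show ?thesis .
  qed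
  have "(\<integral>\<^sup>+\<xi>. ennreal ((norm (fourier u \<xi>))\<^sup>2) \<partial>lborel)
      = (\<integral>\<^sup>+\<xi>. liminf (\<lambda>n. ennreal (gaussian (1 / real (Suc n)) \<xi> * (norm (fourier u \<xi>))\<^sup>2)) \<partial>lborel)"
  proof (intro nn_integral_cong)
    fix \<xi>
    have "(\<lambda>n. ennreal (gaussian (1 / real (Suc n)) \<xi> * (norm (fourier u \<xi>))\<^sup>2)) \<longlonglongrightarrow> ennreal (1 * (norm (fourier u \<xi>))\<^sup>2)"
      by (intro tendsto_intros gaussian_tendsto_1)
    then show "ennreal ((norm (fourier u \<xi>))\<^sup>2) = liminf (\<lambda>n. ennreal (gaussian (1 / real (Suc n)) \<xi> * (norm (fourier u \<xi>))\<^sup>2))"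
      by (simp add: lim_imp_Liminf)
  qed
  \<comment> \<open>Fatou's lemma removes the cut-off, as the bound \<open>main\<close> is
    independent of its width.\<close>
  also have "\<dots> \<le> liminf (\<lambda>n. \<integral>\<^sup>+\<xi>. ennreal (gaussian (1 / real (Suc n)) \<xi> * (norm (fourier u \<xi>))\<^sup>2) \<partial>lborel)"
    by (rule nn_integral_liminf) measurable
  also have "\<dots> \<le> liminf (\<lambda>n. \<integral>\<^sup>+x. ennreal ((norm (u x))\<^sup>2) \<partial>lborel)"
    by (intro Liminf_mono always_eventually allI main) auto
  finally show ?thesis by (simp add: Liminf_const)
qed

section \<open>The Hausdorff--Young inequality\<close>

text \<open>The p-th power of the norm. Leaving out the root avoids the case distinction at infinity
  in \<open>Lp_norm\<close>; bounds are carried as real constants for this power.\<close>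

definition Lp_int :: "real \<Rightarrow> (real^2 \<Rightarrow> complex) \<Rightarrow> ennreal" where
  "Lp_int p f = (\<integral>\<^sup>+x. ennreal (norm (f x) powr p) \<partial>lborel)"

lemma Lp_int_mono:
  assumes "0 \<le> p" "\<And>x. norm (f x) \<le> norm (g x)"
  shows "Lp_int p f \<le> Lp_int p g"
  unfolding Lp_int_def using assms by (intro nn_integral_mono ennreal_leI powr_mono2) auto

lemma nn_integral_powr_atMost:
  fixes r b :: real
  assumes r: "r > -1" and b: "b \<ge> 0"
  shows "(\<integral>\<^sup>+x. ennreal (x powr r) * indicator {0..b} x \<partial>lborel) = ennreal (b powr (r + 1) / (r + 1))"
proof -
  have "(\<integral>\<^sup>+x. ennreal (indicator {0..b} x * (x powr r)) \<partial>lborel) = ennreal (b powr (r + 1) / (r + 1))"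
  proof (rule nn_integral_has_integral_lborel)
    show "((\<lambda>x. indicator {0..b} x * (x powr r)) has_integral b powr (r + 1) / (r + 1)) UNIV"
    proof -
      have "(\<lambda>x. indicator {0..b} x * (x powr r)) = (\<lambda>x. if x \<in> {0..b} then x powr r else 0)"
        by (auto simp: fun_eq_iff)
      then show ?thesis
        using has_integral_powr_from_0[OF r b] by (simp only: has_integral_restrict_UNIV)
    qed
  qed auto
  then show ?thesis by (simp add: ennreal_mult mult.commute ennreal_indicator)
qed

text \<open>Young's inequality for \<open>f\<close> and \<open>g\<close> divided by their norms.
  \<open>A\<close> and \<open>B\<close> may be any upper bounds of the two integrals; only the
  division requires treating a zero bound apart.\<close>

lemma nn_integral_Holder:
  fixes f g :: "'a \<Rightarrow> real"
  assumes rs: "r > 1" "s > 1" "1 / r + 1 / s = 1"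
    and [measurable]: "f \<in> borel_measurable M" "g \<in> borel_measurable M"
    and nn: "\<And>x. 0 \<le> f x" "\<And>x. 0 \<le> g x" and AB: "0 \<le> A" "0 \<le> B"
    and A: "(\<integral>\<^sup>+x. ennreal (f x powr r) \<partial>M) \<le> ennreal A" and B: "(\<integral>\<^sup>+x. ennreal (g x powr s) \<partial>M) \<le> ennreal B"
  shows "(\<integral>\<^sup>+x. ennreal (f x * g x) \<partial>M) \<le> ennreal (A powr (1 / r) * B powr (1 / s))"
proof (cases "A = 0 \<or> B = 0")
  case True
  then have "(AE x in M. f x = 0) \<or> (AE x in M. g x = 0)"
  proof
    assume "A = 0"
    then have "(\<integral>\<^sup>+x. ennreal (f x powr r) \<partial>M) = 0" using A by simp
    then show ?thesis using nn by (subst (asm) nn_integral_0_iff_AE) auto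
  next
    assume "B = 0"
    then have "(\<integral>\<^sup>+x. ennreal (g x powr s) \<partial>M) = 0" using B by simp
    then show ?thesis using nn by (subst (asm) nn_integral_0_iff_AE) auto
  qed
  then have "AE x in M. ennreal (f x * g x) = 0" by auto
  then have "(\<integral>\<^sup>+x. ennreal (f x * g x) \<partial>M) = (\<integral>\<^sup>+x. 0 \<partial>M)" by (rule nn_integral_cong_AE)
  then show ?thesis by simp
next
  case False
  then have pos: "A > 0" "B > 0" using AB by auto
  define a b where "a = A powr (1 / r)" and "b = B powr (1 / s)"
  have ab: "a > 0" "b > 0" "a powr r = A" "b powr s = B"
    using pos rs by (auto simp: a_def b_def powr_powr)
  have "f x * g x \<le> a * b * (f x powr r / (A * r) + g x powr s / (B * s))" for x
  proof -
    have "(f x / a) * (g x / b) \<le> (f x / a) powr r / r + (g x / b) powr s / s"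
      using rs ab nn by (intro Youngs_inequality) auto
    also have "\<dots> = f x powr r / (A * r) + g x powr s / (B * s)"
      using ab nn by (simp add: powr_divide)
    finally show ?thesis using ab by (simp add: field_simps)
  qed
  then have "(\<integral>\<^sup>+x. ennreal (f x * g x) \<partial>M) \<le> (\<integral>\<^sup>+x. ennreal (a * b / (A * r)) * ennreal (f x powr r) + ennreal (a * b / (B * s)) * ennreal (g x powr s) \<partial>M)"
    using ab pos rs by (intro nn_integral_mono)
      (simp add: ennreal_mult[symmetric] ennreal_plus[symmetric] algebra_simps del: ennreal_plus)
  also have "\<dots> = ennreal (a * b / (A * r)) * (\<integral>\<^sup>+x. ennreal (f x powr r) \<partial>M) + ennreal (a * b / (B * s)) * (\<integral>\<^sup>+x. ennreal (g x powr s) \<partial>M)"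
    by (simp add: nn_integral_add nn_integral_cmult)
  also have "\<dots> \<le> ennreal (a * b / (A * r)) * ennreal A + ennreal (a * b / (B * s)) * ennreal B"
    by (intro add_mono mult_left_mono A B) auto
  also have "\<dots> = ennreal (a * b * (1 / r + 1 / s))"
    using ab pos rs unfolding distrib_left
    by (simp add: ennreal_mult[symmetric] ennreal_plus[symmetric] del: ennreal_plus)
  finally show ?thesis using rs by (simp add: a_def b_def)
qed

lemma integrable_split:
  fixes u :: "real^2 \<Rightarrow> complex"
  assumes u: "integrable lborel u" and [measurable]: "Measurable.pred borel P"
  shows "integrable lborel (\<lambda>x. if P x then u x else 0)"
  using borel_measurable_integrable[OF u]
  by (intro Bochner_Integration.integrable_bound[OF u] AE_I2) auto

text \<open>
  The Marcinkiewicz splitting of \<open>u\<close> at the height where \<open>\<bar>u\<bar>\<^bsup>p-1\<^esup> = A / t\<close>: the transform of the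
  large part stays below \<open>t / 2\<close>, so only the small part contributes to the level set.
\<close>

lemma fourier_distribution_bound:
  fixes u :: "real^2 \<Rightarrow> complex"
  assumes p: "1 < p" and u: "integrable lborel u" and A: "A > 0" and Lp: "Lp_int p u \<le> ennreal A" and t: "t > 0"
  shows "(\<integral>\<^sup>+\<xi>. indicator {\<xi>. t \<le> norm (fourier u \<xi>)} \<xi> \<partial>lborel)
     \<le> ennreal (4 / t\<^sup>2) * (\<integral>\<^sup>+x. ennreal ((norm (u x))\<^sup>2) * indicator {x. norm (u x) powr (p - 1) * t \<le> A} x \<partial>lborel)"
proof -
  have [measurable]: "u \<in> borel_measurable borel" using u by auto
  let ?P = "\<lambda>x. norm (u x) powr (p - 1) * t \<le> A"
  define u1 u2 where "u1 x = (if \<not> ?P x then u x else 0)" and "u2 x = (if ?P x then u x else 0)" for x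
  have i1: "integrable lborel u1" and i2: "integrable lborel u2"
    unfolding u1_def u2_def by (intro integrable_split u; measurable)+
  have split: "fourier u \<xi> = fourier u1 \<xi> + fourier u2 \<xi>" for \<xi>
    by (subst fourier_add[OF i1 i2, symmetric]) (auto simp: u1_def u2_def intro!: arg_cong[where f="\<lambda>u. fourier u \<xi>"])
  have "ennreal (LBINT x. norm (u1 x)) = (\<integral>\<^sup>+x. ennreal (norm (u1 x)) \<partial>lborel)"
    using i1 by (intro nn_integral_eq_integral[symmetric]) auto
  also have "\<dots> \<le> (\<integral>\<^sup>+x. ennreal (t / A) * ennreal (norm (u x) powr p) \<partial>lborel)"
  proof (intro nn_integral_mono)
    fix x
    have "norm (u1 x) \<le> t / A * norm (u x) powr p"
    proof (cases "?P x")
      case False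
      then have ne: "norm (u x) > 0" using A t p by (cases "u x = 0") auto
      have "norm (u x) * A \<le> norm (u x) * (norm (u x) powr (p - 1) * t)"
        using False by (intro mult_left_mono) auto
      also have "\<dots> = norm (u x) powr p * t"
        using ne powr_add[of "norm (u x)" 1 "p - 1"] by simp
      finally show ?thesis using False A by (simp add: u1_def field_simps)
    qed (use A t in \<open>simp add: u1_def\<close>)
    then show "ennreal (norm (u1 x)) \<le> ennreal (t / A) * ennreal (norm (u x) powr p)"
      using A t by (simp add: ennreal_mult[symmetric] ennreal_leI)
  qed
  also have "\<dots> = ennreal (t / A) * Lp_int p u"
    unfolding Lp_int_def by (rule nn_integral_cmult) measurable
  also have "\<dots> \<le> ennreal (t / A) * ennreal A" by (intro mult_left_mono Lp) auto
  also have "\<dots> = ennreal t" using A t by (simp add: ennreal_mult[symmetric])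
  finally have L1: "(LBINT x. norm (u1 x)) \<le> t" using t by simp
  have f1: "norm (fourier u1 \<xi>) \<le> t / 2" for \<xi>
  proof -
    have "norm (fourier u1 \<xi>) \<le> t / (2 * pi)"
      using norm_fourier_le[of u1 \<xi>] divide_right_mono[OF L1, of "2 * pi"] by simp
    also have "\<dots> \<le> t / 2" using t pi_ge_two by (intro divide_left_mono) auto
    finally show ?thesis .
  qed
  have "(\<integral>\<^sup>+\<xi>. indicator {\<xi>. t \<le> norm (fourier u \<xi>)} \<xi> \<partial>lborel) \<le> (\<integral>\<^sup>+\<xi>. ennreal (4 / t\<^sup>2) * ennreal ((norm (fourier u2 \<xi>))\<^sup>2) \<partial>lborel)"
  proof (intro nn_integral_mono)
    fix \<xi>
    show "indicator {\<xi>. t \<le> norm (fourier u \<xi>)} \<xi> \<le> ennreal (4 / t\<^sup>2) * ennreal ((norm (fourier u2 \<xi>))\<^sup>2)"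
    proof (cases "t \<le> norm (fourier u \<xi>)")
      case True
      \<comment> \<open>The large part accounts for at most t/2 by \<open>f1\<close>, so the small
        part reaches t/2 on the level set; squaring is Chebyshev's inequality in L^2.\<close>
      then have "t / 2 \<le> norm (fourier u2 \<xi>)"
        using f1[of \<xi>] norm_triangle_ineq[of "fourier u1 \<xi>" "fourier u2 \<xi>"] by (simp add: split)
      then have "(t / 2)\<^sup>2 \<le> (norm (fourier u2 \<xi>))\<^sup>2" using t by (intro power_mono) auto
      then have "1 \<le> 4 / t\<^sup>2 * (norm (fourier u2 \<xi>))\<^sup>2" using t by (simp add: field_simps)
      then show ?thesis using True by (simp add: ennreal_mult[symmetric])
    qed simp
  qed
  also have "\<dots> = ennreal (4 / t\<^sup>2) * (\<integral>\<^sup>+\<xi>. ennreal ((norm (fourier u2 \<xi>))\<^sup>2) \<partial>lborel)"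
    using borel_measurable_integrable[OF i2] by (intro nn_integral_cmult) auto
  also have "\<dots> \<le> ennreal (4 / t\<^sup>2) * (\<integral>\<^sup>+x. ennreal ((norm (u2 x))\<^sup>2) \<partial>lborel)"
    by (intro mult_left_mono fourier_L2_bound i2) auto
  also have "(\<integral>\<^sup>+x. ennreal ((norm (u2 x))\<^sup>2) \<partial>lborel) = (\<integral>\<^sup>+x. ennreal ((norm (u x))\<^sup>2) * indicator {x. ?P x} x \<partial>lborel)"
    by (intro nn_integral_cong) (auto simp: u2_def)
  finally show ?thesis .
qed

text \<open>Layer-cake formula for the q-th power integral, the bound on the level sets, and an
  exchange of the integrations in height and space. The factor 1/(q - 2) diverges as p approaches 2,
  where the L^2 bound takes over.\<close>

lemma Hausdorff_Young_open:
  fixes u :: "real^2 \<Rightarrow> complex"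
  assumes p: "1 < p" "p < 2" and q: "q = p / (p - 1)"
    and u: "integrable lborel u" and A: "A > 0" and Lp: "Lp_int p u \<le> ennreal A"
  shows "Lp_int q (fourier u) \<le> ennreal (4 * q / (q - 2) * A powr (q - 1))"
proof -
  let ?S = "\<lambda>t. (\<integral>\<^sup>+x. ennreal ((norm (u x))\<^sup>2) * indicator {x. norm (u x) powr (p - 1) * t \<le> A} x \<partial>lborel)"
  let ?I = "\<lambda>t \<xi>. ennreal q * (ennreal (t powr (q - 1)) * (if 0 \<le> t \<and> t \<le> norm (fourier u \<xi>) then 1 else 0))"
  let ?J = "\<lambda>t x. ennreal (4 * q * t powr (q - 3) * (norm (u x))\<^sup>2) * (if 0 < t \<and> norm (u x) powr (p - 1) * t \<le> A then 1 else 0)"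
  have [measurable]: "u \<in> borel_measurable borel" using u by auto
  have q2: "q > 2" using p by (simp add: q field_simps)
  have pq: "(p - 1) * (q - 1) = 1" "2 - (p - 1) * (q - 2) = p" using p by (simp_all add: q field_simps)
  have "Lp_int q (fourier u) = (\<integral>\<^sup>+\<xi>. \<integral>\<^sup>+t. ennreal q * (ennreal (t powr (q - 1)) * indicator {0..norm (fourier u \<xi>)} t) \<partial>lborel \<partial>lborel)"
    unfolding Lp_int_def using q2
    by (intro nn_integral_cong, subst nn_integral_cmult) (auto simp: nn_integral_powr_atMost ennreal_mult[symmetric])
  also have "\<dots> = (\<integral>\<^sup>+\<xi>. \<integral>\<^sup>+t. ?I t \<xi> \<partial>lborel \<partial>lborel)"
    by (intro nn_integral_cong) (auto simp: indicator_def)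
  also have "\<dots> = (\<integral>\<^sup>+t. \<integral>\<^sup>+\<xi>. ?I t \<xi> \<partial>lborel \<partial>lborel)"
    by (rule lborel_pair.Fubini') measurable
  also have "\<dots> \<le> (\<integral>\<^sup>+t. \<integral>\<^sup>+x. ?J t x \<partial>lborel \<partial>lborel)"
  proof (rule nn_integral_mono)
    fix t :: real
    show "(\<integral>\<^sup>+\<xi>. ?I t \<xi> \<partial>lborel)
       \<le> (\<integral>\<^sup>+x. ?J t x \<partial>lborel)"
    proof (cases "t > 0")
      case True
      have "(\<integral>\<^sup>+\<xi>. ?I t \<xi> \<partial>lborel)
         = (\<integral>\<^sup>+\<xi>. ennreal (q * t powr (q - 1)) * indicator {\<xi>. t \<le> norm (fourier u \<xi>)} \<xi> \<partial>lborel)"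
        using True q2 by (intro nn_integral_cong) (auto simp: ennreal_mult)
      also have "\<dots> = ennreal (q * t powr (q - 1)) * (\<integral>\<^sup>+\<xi>. indicator {\<xi>. t \<le> norm (fourier u \<xi>)} \<xi> \<partial>lborel)"
        by (rule nn_integral_cmult) measurable
      also have "\<dots> \<le> ennreal (q * t powr (q - 1)) * (ennreal (4 / t\<^sup>2) * ?S t)"
        by (intro mult_left_mono fourier_distribution_bound[OF p(1) u A Lp True]) auto
      also have "\<dots> = ennreal (4 * q * t powr (q - 3)) * ?S t"
      proof -
        have "t powr (q - 1) = t powr (q - 3) * t\<^sup>2"
          using True powr_add[of t "q - 3" 2] by (simp add: powr_numeral)
        then have "q * t powr (q - 1) * (4 / t\<^sup>2) = 4 * q * t powr (q - 3)" using True by (simp add: field_simps)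
        then show ?thesis using q2 by (simp add: mult.assoc[symmetric] ennreal_mult[symmetric])
      qed
      also have "\<dots> = (\<integral>\<^sup>+x. ennreal (4 * q * t powr (q - 3)) * (ennreal ((norm (u x))\<^sup>2) * indicator {x. norm (u x) powr (p - 1) * t \<le> A} x) \<partial>lborel)"
        by (rule nn_integral_cmult[symmetric]) measurable
      also have "\<dots> = (\<integral>\<^sup>+x. ?J t x \<partial>lborel)"
        using True q2 by (intro nn_integral_cong) (auto simp: ennreal_mult indicator_def)
      finally show ?thesis .
    next
      case False
      \<comment> \<open>For negative \<open>t\<close> the condition fails; at \<open>t = 0\<close>
        the power is 0.\<close>
      then have "ennreal (t powr (q - 1)) * (if 0 \<le> t \<and> t \<le> norm (fourier u \<xi>) then 1 else 0) = 0" for \<xi>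
        by (cases "t = 0") auto
      then have z: "(\<integral>\<^sup>+\<xi>. ?I t \<xi> \<partial>lborel)
          = (\<integral>\<^sup>+(\<xi>::real^2). 0 \<partial>lborel)"
        by (intro nn_integral_cong) (metis mult_zero_right)
      show ?thesis unfolding z by simp
    qed
  qed
  also have "\<dots> = (\<integral>\<^sup>+x. \<integral>\<^sup>+t. ?J t x \<partial>lborel \<partial>lborel)"
    by (rule lborel_pair.Fubini') measurable
  also have "\<dots> \<le> (\<integral>\<^sup>+x. ennreal (4 * q / (q - 2) * A powr (q - 2)) * ennreal (norm (u x) powr p) \<partial>lborel)"
  proof (intro nn_integral_mono)
    fix x
    show "(\<integral>\<^sup>+t. ?J t x \<partial>lborel)
      \<le> ennreal (4 * q / (q - 2) * A powr (q - 2)) * ennreal (norm (u x) powr p)"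
    proof (cases "u x = 0")
      case False
      define b where "b = norm (u x)"
      define s where "s = A / b powr (p - 1)"
      have b: "b > 0" using False by (simp add: b_def)
      have s: "s \<ge> 0" using A by (simp add: s_def)
      have sp: "s powr (q - 2) = A powr (q - 2) / b powr ((p - 1) * (q - 2))"
        using A b by (simp add: s_def powr_divide powr_powr)
      have "(\<integral>\<^sup>+t. ennreal (4 * q * t powr (q - 3) * b\<^sup>2) * (if 0 < t \<and> b powr (p - 1) * t \<le> A then 1 else 0) \<partial>lborel)
         \<le> (\<integral>\<^sup>+t. ennreal (4 * q * b\<^sup>2) * (ennreal (t powr (q - 3)) * indicator {0..s} t) \<partial>lborel)"
        using b q2 by (intro nn_integral_mono) (auto simp: s_def field_simps ennreal_mult)
      also have "\<dots> = ennreal (4 * q * b\<^sup>2) * ennreal (s powr (q - 2) / (q - 2))"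
        using q2 s by (subst nn_integral_cmult) (auto simp: nn_integral_powr_atMost)
      also have "\<dots> = ennreal (4 * q / (q - 2) * A powr (q - 2)) * ennreal (b powr p)"
      proof -
        have "b\<^sup>2 / b powr ((p - 1) * (q - 2)) = b powr p"
          using b pq powr_diff[of b 2 "(p - 1) * (q - 2)"] by (simp add: powr_numeral)
        then have "b\<^sup>2 = b powr p * b powr ((p - 1) * (q - 2))" using b by (simp add: field_simps)
        then show ?thesis using q2 b by (simp add: ennreal_mult[symmetric] sp field_simps)
      qed
      finally show ?thesis by (simp add: b_def)
    qed simp
  qed
  also have "\<dots> = ennreal (4 * q / (q - 2) * A powr (q - 2)) * Lp_int p u"
    unfolding Lp_int_def by (rule nn_integral_cmult) measurable
  also have "\<dots> \<le> ennreal (4 * q / (q - 2) * A powr (q - 2)) * ennreal A"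
    by (intro mult_left_mono Lp) auto
  also have "\<dots> = ennreal (4 * q / (q - 2) * A powr (q - 1))"
    using A q2 powr_add[of A "q - 2" 1] by (simp add: ennreal_mult[symmetric])
  finally show ?thesis .
qed

text \<open>Since q/p = q - 1, the power \<open>A powr (q - 1)\<close> is the q-th power of the
  bound on the p-norm: this is the homogeneous form of the inequality, with \<open>C\<close> the
  q-th power of the operator bound.\<close>

lemma Hausdorff_Young_integrable:
  assumes p: "1 < p" "p \<le> 2" and q: "q = p / (p - 1)"
  shows "\<exists>C>0. \<forall>u A. integrable lborel u \<and> 0 \<le> A \<and> Lp_int p u \<le> ennreal A
     \<longrightarrow> Lp_int q (fourier u) \<le> ennreal (C * A powr (q - 1))"
proof -
  define C where "C = (if p = 2 then 1 else 4 * q / (q - 2))"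
  have qp: "q > 1" "p < 2 \<Longrightarrow> q > 2" using p by (simp_all add: q field_simps)
  have "C > 0" using p qp by (auto simp: C_def)
  moreover have "Lp_int q (fourier u) \<le> ennreal (C * A powr (q - 1))"
    if u: "integrable lborel u" and A: "0 \<le> A" "Lp_int p u \<le> ennreal A" for u A
  proof (cases "p = 2")
    case True
    then show ?thesis using fourier_L2_bound[OF u] A by (simp add: q C_def Lp_int_def powr_numeral)
  next
    case False
    show ?thesis
    proof (cases "A = 0")
      \<comment> \<open>The splitting height in \<open>Hausdorff_Young_open\<close> needs
        \<open>A > 0\<close>. For \<open>A = 0\<close> the function is null, so its transform
        vanishes identically.\<close>
      case True
      have [measurable]: "u \<in> borel_measurable borel" using u by auto
      from True A have "(\<integral>\<^sup>+x. ennreal (norm (u x) powr p) \<partial>lborel) = 0" by (simp add: Lp_int_def)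
      then have "AE x in lborel. u x = 0" by (subst (asm) nn_integral_0_iff_AE) auto
      then have "(LBINT x. exp (- \<i> * complex_of_real (x \<bullet> \<xi>)) * u x) = 0" for \<xi>
        by (intro integral_eq_zero_AE) auto
      then have "fourier u \<xi> = 0" for \<xi>
        unfolding fourier_def by simp
      then show ?thesis by (simp add: Lp_int_def)
    next
      case False
      then show ?thesis using Hausdorff_Young_open[of p q u A] \<open>p \<noteq> 2\<close> p q u A by (simp add: C_def)
    qed
  qed
  ultimately show ?thesis by blast
qed

section \<open>From integrable functions to all of L^p\<close>

lemma Lp_int_Fatou:
  assumes [measurable]: "\<And>k. f k \<in> borel_measurable borel" and q: "q > 0"
    and lim: "AE x in lborel. (\<lambda>k. f k x) \<longlonglongrightarrow> g x" and b: "\<And>k. k \<ge> m \<Longrightarrow> Lp_int q (f k) \<le> B"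
  shows "Lp_int q g \<le> B"
proof -
  have "Lp_int q g = (\<integral>\<^sup>+x. liminf (\<lambda>k. ennreal (norm (f k x) powr q)) \<partial>lborel)"
    unfolding Lp_int_def
  proof (rule nn_integral_cong_AE)
    show "AE x in lborel. ennreal (norm (g x) powr q) = liminf (\<lambda>k. ennreal (norm (f k x) powr q))"
      using lim
    proof eventually_elim
      case (elim x)
      have "(\<lambda>k. norm (f k x) powr q) \<longlonglongrightarrow> norm (g x) powr q"
        using q by (intro tendsto_powr' tendsto_norm elim tendsto_const) auto
      then have "(\<lambda>k. ennreal (norm (f k x) powr q)) \<longlonglongrightarrow> ennreal (norm (g x) powr q)"
        by (rule tendsto_ennrealI)
      then show ?case by (rule lim_imp_Liminf[OF sequentially_bot, symmetric])
    qed
  qed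
  also have "\<dots> \<le> liminf (\<lambda>k. Lp_int q (f k))"
    unfolding Lp_int_def by (rule nn_integral_liminf) measurable
  also have "\<dots> \<le> liminf (\<lambda>k::nat. B)"
    using b by (intro Liminf_mono) (auto simp: eventually_sequentially)
  finally show ?thesis by (simp add: Liminf_const)
qed

lemma Lp_int_mult:
  assumes rs: "r > 1" "s > 1" "1 / r + 1 / s = 1"
    and [measurable]: "f \<in> borel_measurable borel" "g \<in> borel_measurable borel" and AB: "0 \<le> A" "0 \<le> B"
    and A: "Lp_int r f \<le> ennreal A" and B: "Lp_int s g \<le> ennreal B"
  shows "integrable lborel (\<lambda>x. f x * g x)" "norm (LBINT x. f x * g x) \<le> A powr (1 / r) * B powr (1 / s)"
proof -
  have *: "(\<integral>\<^sup>+x. ennreal (norm (f x * g x)) \<partial>lborel) \<le> ennreal (A powr (1 / r) * B powr (1 / s))"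
    using nn_integral_Holder[OF rs, of "\<lambda>x. norm (f x)" lborel "\<lambda>x. norm (g x)" A B] A B AB
    by (simp add: Lp_int_def norm_mult)
  then show i: "integrable lborel (\<lambda>x. f x * g x)"
    using le_less_trans[OF * ennreal_less_top] by (intro integrableI_bounded) auto
  have "ennreal (norm (LBINT x. f x * g x)) \<le> ennreal (A powr (1 / r) * B powr (1 / s))"
    using integral_norm_bound_ennreal[OF i] * by (rule order_trans)
  then show "norm (LBINT x. f x * g x) \<le> A powr (1 / r) * B powr (1 / s)"
    by (subst (asm) ennreal_le_iff) auto
qed

text \<open>On a ball of finite measure the pointwise bound |g| \<le> 1 + |g|^p suffices.\<close>

lemma integrable_truncated_Lp:
  assumes [measurable]: "g \<in> borel_measurable borel" and p: "1 \<le> p" and fin: "Lp_int p g < \<infinity>"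
  shows "integrable lborel (\<lambda>x. if norm x \<le> real n then g x else 0)"
proof (rule integrableI_bounded)
  have [measurable]: "cball (0::real^2) (real n) \<in> sets borel" by simp
  have "(\<integral>\<^sup>+x. ennreal (norm (if norm x \<le> real n then g x else 0)) \<partial>lborel)
     \<le> (\<integral>\<^sup>+x. indicator (cball 0 (real n)) x + ennreal (norm (g x) powr p) \<partial>lborel)"
  proof (intro nn_integral_mono)
    fix x :: "real^2"
    show "ennreal (norm (if norm x \<le> real n then g x else 0)) \<le> indicator (cball 0 (real n)) x + ennreal (norm (g x) powr p)"
    proof (cases "norm x \<le> real n")
      case True
      have "norm (g x) \<le> 1 + norm (g x) powr p"
      proof (cases "norm (g x) \<le> 1")
        case False
        then have "norm (g x) powr 1 \<le> norm (g x) powr p" using p by (intro powr_mono) auto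
        then show ?thesis using False by simp
      qed (simp add: add_increasing2)
      then show ?thesis using True by (simp add: ennreal_plus[symmetric] ennreal_1[symmetric] del: ennreal_plus ennreal_1)
    qed simp
  qed
  also have "\<dots> = emeasure lborel (cball (0::real^2) (real n)) + Lp_int p g"
    unfolding Lp_int_def by (subst nn_integral_add) auto
  also have "\<dots> < \<infinity>"
    using fin emeasure_bounded_finite[of "cball (0::real^2) (real n)"] by auto
  finally show "(\<integral>\<^sup>+x. ennreal (norm (if norm x \<le> real n then g x else 0)) \<partial>lborel) < \<infinity>" .
qed measurable

lemma Lp_int_truncation_tendsto:
  assumes [measurable]: "g \<in> borel_measurable borel" and p: "1 \<le> p" and fin: "Lp_int p g < \<infinity>"
  shows "(\<lambda>n. Lp_int p (\<lambda>x. g x - (if norm x \<le> real n then g x else 0))) \<longlonglongrightarrow> 0"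
proof -
  have "(\<lambda>n. Lp_int p (\<lambda>x. g x - (if norm x \<le> real n then g x else 0))) \<longlonglongrightarrow> (\<integral>\<^sup>+(x::real^2). 0 \<partial>lborel)"
    unfolding Lp_int_def
  proof (rule nn_integral_dominated_convergence[where w="\<lambda>x. ennreal (norm (g x) powr p)"])
    show "AE x in lborel. (\<lambda>n. ennreal (norm (g x - (if norm x \<le> real n then g x else 0)) powr p)) \<longlonglongrightarrow> 0"
    proof (rule AE_I2)
      fix x :: "real^2"
      obtain N where N: "norm x \<le> real N" using real_arch_simple by blast
      have "norm x \<le> real n" if "n \<ge> N" for n
        using N that by (meson of_nat_le_iff order_trans)
      then have "eventually (\<lambda>n. ennreal (norm (g x - (if norm x \<le> real n then g x else 0)) powr p) = 0) sequentially"
        unfolding eventually_sequentially by (intro exI[of _ N]) auto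
      then show "(\<lambda>n. ennreal (norm (g x - (if norm x \<le> real n then g x else 0)) powr p)) \<longlonglongrightarrow> 0"
        by (rule tendsto_eventually)
    qed
  qed (use fin in \<open>auto simp: Lp_int_def\<close>)
  then show ?thesis by simp
qed

text \<open>The weights 2^(qk) still leave a summable series of integrals 2^(-qk). Hence the
  weighted series is finite almost everywhere, and there the increments are dominated by a multiple
  of 2^(-k).\<close>

lemma AE_convergent_if_fast_Cauchy:
  fixes F :: "nat \<Rightarrow> real^2 \<Rightarrow> complex"
  assumes [measurable]: "\<And>k. F k \<in> borel_measurable borel" and q: "q > 0"
    and D: "\<And>k. Lp_int q (\<lambda>x. F (Suc k) x - F k x) \<le> ennreal ((4 powr (- q)) ^ k)"
  shows "AE x in lborel. convergent (\<lambda>k. F k x)"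
proof -
  let ?a = "\<lambda>k x. ennreal ((2 powr q) ^ k) * ennreal (norm (F (Suc k) x - F k x) powr q)"
  have m: "2 powr (- q) < 1" using q powr_less_mono[of "-q" 0 2] by simp
  have e: "(2 powr q) ^ k * (4 powr (- q)) ^ k = (2 powr (- q)) ^ k" for k
  proof -
    have "(4::real) powr (- q) = 2 powr (- q) * 2 powr (- q)"
      using powr_mult[of 2 2 "-q"] by simp
    then have "2 powr q * 4 powr (- q) = 2 powr (- q)"
      by (simp add: powr_minus)
    then show ?thesis by (metis power_mult_distrib)
  qed
  have "(\<integral>\<^sup>+x. (\<Sum>k. ?a k x) \<partial>lborel) = (\<Sum>k. (\<integral>\<^sup>+x. ?a k x \<partial>lborel))"
    by (rule nn_integral_suminf) measurable
  also have "\<dots> = (\<Sum>k. ennreal ((2 powr q) ^ k) * Lp_int q (\<lambda>x. F (Suc k) x - F k x))"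
    unfolding Lp_int_def by (subst nn_integral_cmult) auto
  also have "\<dots> \<le> (\<Sum>k. ennreal ((2 powr q) ^ k) * ennreal ((4 powr (- q)) ^ k))"
    by (intro suminf_le mult_left_mono D summableI) auto
  also have "\<dots> = (\<Sum>k. ennreal ((2 powr (- q)) ^ k))"
    by (simp add: ennreal_mult[symmetric] e del: ennreal_power)
  also have "\<dots> = ennreal (\<Sum>k. (2 powr (- q)) ^ k)"
    using m by (intro suminf_ennreal2 summable_geometric) auto
  finally have "(\<integral>\<^sup>+x. (\<Sum>k. ?a k x) \<partial>lborel) \<noteq> \<infinity>" by (auto simp: top_unique)
  then have "AE x in lborel. (\<Sum>k. ?a k x) \<noteq> \<infinity>"
    by (intro nn_integral_PInf_AE) auto
  then show ?thesis
  proof eventually_elim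
    case (elim x)
    then obtain S where S: "(\<Sum>k. ?a k x) = ennreal S" "S \<ge> 0" by (cases "(\<Sum>k. ?a k x)") auto
    have b: "norm (F (Suc k) x - F k x) \<le> S powr (1 / q) * (1 / 2) ^ k" for k
    proof -
      let ?d = "norm (F (Suc k) x - F k x)"
      have "?a k x \<le> (\<Sum>k. ?a k x)" using sum_le_suminf[of "\<lambda>k. ?a k x" "{k}"] by auto
      then have "(2 powr q) ^ k * ?d powr q \<le> S"
        using S by (simp add: ennreal_mult[symmetric] del: ennreal_power)
      moreover have "(2 powr q) ^ k = (2 ^ k) powr q"
        by (simp add: powr_realpow[symmetric] powr_powr mult.commute)
      ultimately have "(2 ^ k * ?d) powr q \<le> S" by (simp add: powr_mult)
      then have "((2 ^ k * ?d) powr q) powr (1 / q) \<le> S powr (1 / q)"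
        using q by (intro powr_mono2) auto
      then have "2 ^ k * ?d \<le> S powr (1 / q)" using q by (simp add: powr_powr)
      then show ?thesis by (simp add: field_simps power_one_over)
    qed
    have "summable (\<lambda>k. F (Suc k) x - F k x)"
      by (rule summable_comparison_test'[where g="\<lambda>k. S powr (1 / q) * (1 / 2) ^ k" and N=0])
        (auto intro!: summable_mult summable_geometric b)
    then have "(\<lambda>n. \<Sum>k<n. F (Suc k) x - F k x) \<longlonglongrightarrow> (\<Sum>k. F (Suc k) x - F k x)"
      by (rule summable_LIMSEQ)
    then have "(\<lambda>n. (F n x - F 0 x) + F 0 x) \<longlonglongrightarrow> (\<Sum>k. F (Suc k) x - F k x) + F 0 x"
      unfolding sum_lessThan_telescope[of "\<lambda>k. F k x"] by (intro tendsto_intros)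
    then show ?case by (auto simp: convergent_def)
  qed
qed

text \<open>
  \<open>G\<close> is the limit of the transforms of truncations of \<open>g\<close>, chosen so sparsely that these transforms
  converge almost everywhere.
\<close>

lemma fourier_Lp_extension:
  assumes p: "1 < p" "p \<le> 2" and q: "q = p / (p - 1)"
  shows "\<exists>C>0. \<forall>g A. g \<in> borel_measurable borel \<and> 0 \<le> A \<and> Lp_int p g \<le> ennreal A \<longrightarrow>
    (\<exists>G\<in>borel_measurable borel. Lp_int q G \<le> ennreal (C * A powr (q - 1)) \<and>
      (\<forall>\<psi>. integrable lborel \<psi> \<and> Lp_int p \<psi> < \<infinity> \<longrightarrow> (LBINT \<xi>. G \<xi> * \<psi> \<xi>) = (LBINT x. g x * fourier \<psi> x)))"
proof -
  obtain C where C: "C > 0" and HY: "\<And>u A. integrable lborel u \<Longrightarrow> 0 \<le> A \<Longrightarrow> Lp_int p u \<le> ennreal A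
     \<Longrightarrow> Lp_int q (fourier u) \<le> ennreal (C * A powr (q - 1))"
    using Hausdorff_Young_integrable[OF p q] by blast
  have q1: "q > 1" and pq: "1 / q + 1 / p = 1" "1 / p + 1 / q = 1" and pq1: "(p - 1) * (q - 1) = 1"
    using p by (simp_all add: q field_simps)
  have "\<exists>G\<in>borel_measurable borel. Lp_int q G \<le> ennreal (C * A powr (q - 1)) \<and>
      (\<forall>\<psi>. integrable lborel \<psi> \<and> Lp_int p \<psi> < \<infinity> \<longrightarrow> (LBINT \<xi>. G \<xi> * \<psi> \<xi>) = (LBINT x. g x * fourier \<psi> x))"
    if g[measurable]: "g \<in> borel_measurable borel" and A: "0 \<le> A" "Lp_int p g \<le> ennreal A" for g A
  proof -
    define T where "T n x = (if norm x \<le> real n then g x else 0)" for n and x :: "real^2"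
    have [measurable]: "T n \<in> borel_measurable borel" for n unfolding T_def by measurable
    have fin: "Lp_int p g < \<infinity>" using A by (auto intro: le_less_trans)
    have Ti: "integrable lborel (T n)" for n
      unfolding T_def using p by (intro integrable_truncated_Lp[where p=p] g fin) auto
    \<comment> \<open>Chosen so that Hausdorff--Young turns an error \<open>e k\<close> into the
      rate required by \<open>AE_convergent_if_fast_Cauchy\<close>; the exponent works because
      (p-1)(q-1) = 1.\<close>
    define e where "e k = ((4 powr (- q)) ^ k / C) powr (p - 1)" for k :: nat
    have e: "e k > 0" "C * e k powr (q - 1) = (4 powr (- q)) ^ k" for k
      using C pq1 by (auto simp: e_def powr_powr)
    have "\<exists>n. Lp_int p (\<lambda>x. g x - T n x) \<le> ennreal (e k)" for k
    proof -
      have "(\<lambda>n. Lp_int p (\<lambda>x. g x - T n x)) \<longlonglongrightarrow> 0"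
        unfolding T_def using p by (intro Lp_int_truncation_tendsto g fin) auto
      moreover have "ennreal (e k) > 0" using e by simp
      ultimately have "eventually (\<lambda>n. Lp_int p (\<lambda>x. g x - T n x) < ennreal (e k)) sequentially"
        by (rule order_tendstoD(2))
      then show ?thesis by (auto simp: eventually_sequentially intro: less_imp_le)
    qed
    then obtain N' where N': "\<And>k. Lp_int p (\<lambda>x. g x - T (N' k) x) \<le> ennreal (e k)" by metis
    \<comment> \<open>Partial sums make the radii increasing and keep them above \<open>N'\<close>;
      a larger radius only shrinks the remaining tail.\<close>
    define N where "N k = (\<Sum>i\<le>k. N' i)" for k
    have NN': "N' k \<le> N k" for k unfolding N_def by (intro member_le_sum) auto
    have Nmono: "j \<le> k \<Longrightarrow> N j \<le> N k" for j k unfolding N_def by (intro sum_mono2) auto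
    have gN: "Lp_int p (\<lambda>x. g x - T (N k) x) \<le> ennreal (e k)" for k
    proof -
      have "norm (g x - T (N k) x) \<le> norm (g x - T (N' k) x)" for x
        using NN'[of k] by (auto simp: T_def)
      then have "Lp_int p (\<lambda>x. g x - T (N k) x) \<le> Lp_int p (\<lambda>x. g x - T (N' k) x)"
        using p by (intro Lp_int_mono) auto
      then show ?thesis using N'[of k] by (rule order_trans)
    qed
    have NN: "Lp_int p (\<lambda>x. T (N k) x - T (N j) x) \<le> ennreal (e j)" if "j \<le> k" for j k
    proof -
      have "norm (T (N k) x - T (N j) x) \<le> norm (g x - T (N j) x)" for x
        using Nmono[OF that] by (auto simp: T_def)
      then have "Lp_int p (\<lambda>x. T (N k) x - T (N j) x) \<le> Lp_int p (\<lambda>x. g x - T (N j) x)"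
        using p by (intro Lp_int_mono) auto
      then show ?thesis using gN[of j] by (rule order_trans)
    qed
    define F where "F k = fourier (T (N k))" for k
    have [measurable]: "F k \<in> borel_measurable borel" for k unfolding F_def by measurable
    have FF: "Lp_int q (\<lambda>\<xi>. F k \<xi> - F j \<xi>) \<le> ennreal ((4 powr (- q)) ^ j)" if "j \<le> k" for j k
      using HY[OF Bochner_Integration.integrable_diff[OF Ti Ti] less_imp_le[OF e(1)] NN[OF that]]
      unfolding e F_def fourier_diff[OF Ti Ti, symmetric] .
    have Fb: "Lp_int q (F k) \<le> ennreal (C * A powr (q - 1))" for k
    proof -
      have "Lp_int p (T (N k)) \<le> Lp_int p g" using p by (intro Lp_int_mono) (auto simp: T_def)
      with A show ?thesis unfolding F_def by (intro HY Ti) auto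
    qed
    \<comment> \<open>The value of \<open>lim\<close> at points of divergence is unspecified, but
      these form a null set by \<open>lim\<close> below, and measurability holds regardless.\<close>
    define G where "G \<xi> = lim (\<lambda>k. F k \<xi>)" for \<xi>
    have [measurable]: "G \<in> borel_measurable borel" unfolding G_def by measurable
    have lim: "AE \<xi> in lborel. (\<lambda>k. F k \<xi>) \<longlonglongrightarrow> G \<xi>"
      using AE_convergent_if_fast_Cauchy[of F q] FF q1
      by (auto simp: G_def convergent_LIMSEQ_iff)
    have G: "Lp_int q G \<le> ennreal (C * A powr (q - 1))"
      using q1 by (intro Lp_int_Fatou[OF _ _ lim, where m=0] Fb) auto
    have GF: "Lp_int q (\<lambda>\<xi>. G \<xi> - F j \<xi>) \<le> ennreal ((4 powr (- q)) ^ j)" for j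
    \<comment> \<open>The difference to \<open>F j\<close> is controlled only for indices k \<ge> j,
      hence the offset \<open>m = j\<close>.\<close>
    proof (rule Lp_int_Fatou[where f="\<lambda>k \<xi>. F k \<xi> - F j \<xi>" and m=j])
      show "AE \<xi> in lborel. (\<lambda>k. F k \<xi> - F j \<xi>) \<longlonglongrightarrow> G \<xi> - F j \<xi>"
        using lim by eventually_elim (intro tendsto_intros)
    qed (use q1 FF in auto)
    have "(LBINT \<xi>. G \<xi> * \<psi> \<xi>) = (LBINT x. g x * fourier \<psi> x)"
      if \<psi>: "integrable lborel \<psi>" "Lp_int p \<psi> < \<infinity>" for \<psi>
    proof -
      have [measurable]: "\<psi> \<in> borel_measurable borel" using \<psi> by auto
      obtain B where B: "B \<ge> 0" "Lp_int p \<psi> \<le> ennreal B"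
        using \<psi>(2) by (cases "Lp_int p \<psi>") auto
      note H\<psi> = HY[OF \<psi>(1) B]
      let ?B' = "C * B powr (q - 1)"
      have B': "?B' \<ge> 0" using C by simp
      have m4: "4 powr (- q) < 1" using q1 powr_less_mono[of "-q" 0 4] by simp
      \<comment> \<open>The multiplication formula for the truncations is passed to the limit on
        both sides by Hoelder's inequality: L^q convergence of \<open>F k\<close> against
        \<open>\<psi>\<close> in L^p, then L^p convergence of the truncations against
        \<open>fourier \<psi>\<close> in L^q.\<close>
      have "(\<lambda>k. (LBINT \<xi>. F k \<xi> * \<psi> \<xi>)) \<longlonglongrightarrow> (LBINT \<xi>. G \<xi> * \<psi> \<xi>)"
      proof (rule LIM_zero_cancel, rule Lim_null_comparison)
        show "(\<lambda>k. ((4 powr (- q)) ^ k) powr (1 / q) * B powr (1 / p)) \<longlonglongrightarrow> 0"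
          using q1 m4 by (intro tendsto_mult_left_zero tendsto_zero_powrI[where b="1/q"] LIMSEQ_power_zero tendsto_const) auto
        have "norm ((LBINT \<xi>. F k \<xi> * \<psi> \<xi>) - (LBINT \<xi>. G \<xi> * \<psi> \<xi>)) \<le> ((4 powr (- q)) ^ k) powr (1 / q) * B powr (1 / p)" for k
        proof -
          have 1: "integrable lborel (\<lambda>\<xi>. F k \<xi> * \<psi> \<xi>)"
            using Fb[of k] B C by (intro Lp_int_mult(1)[OF q1 p(1) pq(1)]) auto
          have 2: "integrable lborel (\<lambda>\<xi>. G \<xi> * \<psi> \<xi>)"
            using G B C by (intro Lp_int_mult(1)[OF q1 p(1) pq(1)]) auto
          have "norm (LBINT \<xi>. (G \<xi> - F k \<xi>) * \<psi> \<xi>) \<le> ((4 powr (- q)) ^ k) powr (1 / q) * B powr (1 / p)"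
            using GF[of k] B by (intro Lp_int_mult(2)[OF q1 p(1) pq(1)]) auto
          then show ?thesis using 1 2 by (simp add: left_diff_distrib norm_minus_commute)
        qed
        then show "eventually (\<lambda>k. norm ((LBINT \<xi>. F k \<xi> * \<psi> \<xi>) - (LBINT \<xi>. G \<xi> * \<psi> \<xi>)) \<le> ((4 powr (- q)) ^ k) powr (1 / q) * B powr (1 / p)) sequentially"
          by simp
      qed
      moreover have "(\<lambda>k. (LBINT x. T (N k) x * fourier \<psi> x)) \<longlonglongrightarrow> (LBINT x. g x * fourier \<psi> x)"
      proof (rule LIM_zero_cancel, rule Lim_null_comparison)
        have "(4 powr (- q)) ^ k = (4 powr (- q)) powr (real k)" for k by (simp add: powr_realpow)
        have "e \<longlonglongrightarrow> 0" unfolding e_def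
          using p m4 by (intro tendsto_zero_powrI[where b="p - 1"] tendsto_divide_zero LIMSEQ_power_zero tendsto_const) (auto simp: C less_imp_le)
        then show "(\<lambda>k. e k powr (1 / p) * ?B' powr (1 / q)) \<longlonglongrightarrow> 0"
          using p e by (intro tendsto_mult_left_zero tendsto_zero_powrI[where b="1/p"] tendsto_const) (auto simp: less_imp_le)
        have "norm ((LBINT x. T (N k) x * fourier \<psi> x) - (LBINT x. g x * fourier \<psi> x)) \<le> e k powr (1 / p) * ?B' powr (1 / q)" for k
        proof -
          have "Lp_int p (T (N k)) \<le> Lp_int p g" using p by (intro Lp_int_mono) (auto simp: T_def)
          then have "Lp_int p (T (N k)) \<le> ennreal A" using A(2) by (rule order_trans)
          then have 1: "integrable lborel (\<lambda>x. T (N k) x * fourier \<psi> x)"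
            using A H\<psi> B' by (intro Lp_int_mult(1)[OF p(1) q1 pq(2)]) auto
          have 2: "integrable lborel (\<lambda>x. g x * fourier \<psi> x)"
            using A H\<psi> B' by (intro Lp_int_mult(1)[OF p(1) q1 pq(2)]) auto
          have "norm (LBINT x. (g x - T (N k) x) * fourier \<psi> x) \<le> e k powr (1 / p) * ?B' powr (1 / q)"
            using gN[of k] H\<psi> B' e(1)[of k] by (intro Lp_int_mult(2)[OF p(1) q1 pq(2)]) auto
          then show ?thesis using 1 2 by (simp add: left_diff_distrib norm_minus_commute)
        qed
        then show "eventually (\<lambda>k. norm ((LBINT x. T (N k) x * fourier \<psi> x) - (LBINT x. g x * fourier \<psi> x)) \<le> e k powr (1 / p) * ?B' powr (1 / q)) sequentially"
          by simp
      qed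
      moreover have "(LBINT \<xi>. F k \<xi> * \<psi> \<xi>) = (LBINT x. T (N k) x * fourier \<psi> x)" for k
        unfolding F_def by (rule fourier_multiplication_formula[OF Ti \<psi>(1)])
      ultimately show ?thesis using LIMSEQ_unique by simp
    qed
    with G show ?thesis by (intro bexI[of _ G]) auto
  qed
  with C show ?thesis by blast
qed

section \<open>Schwartz functions and tempered distributions\<close>

lemma has_bochner_integral_inverse_one_plus_square:
  "has_bochner_integral lborel (\<lambda>x::real. 1 / (1 + x\<^sup>2)) pi"
proof -
  have e: "einterval (- \<infinity>) \<infinity> = UNIV" by (auto simp: einterval_def)
  have lt: "(- \<infinity> :: ereal) < \<infinity>" by simp
  have pos: "1 + x\<^sup>2 \<noteq> 0" for x :: real by (metis add_nonneg_eq_0_iff one_neq_zero zero_le_one zero_le_power2)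
  have D: "DERIV arctan x :> 1 / (1 + x\<^sup>2)" for x :: real
    using DERIV_arctan[of x] by (simp add: divide_inverse)
  have c: "isCont (\<lambda>x. 1 / (1 + x\<^sup>2)) x" for x :: real
    by (intro continuous_intros pos)
  have B: "((arctan \<circ> real_of_ereal) \<longlongrightarrow> pi / 2) (at_left \<infinity>)"
    using tendsto_arctan_at_top by (simp add: ereal_tendsto_simps)
  have A: "((arctan \<circ> real_of_ereal) \<longlongrightarrow> - (pi / 2)) (at_right (- \<infinity>))"
    using tendsto_arctan_at_bot by (simp add: ereal_tendsto_simps)
  have "set_integrable lborel (einterval (- \<infinity>) \<infinity>) (\<lambda>x. 1 / (1 + x\<^sup>2))"
    and "(LBINT x=-\<infinity>..\<infinity>. 1 / (1 + x\<^sup>2)) = pi / 2 - (- (pi / 2))"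
    by (rule interval_integral_FTC_nonneg[OF lt D c _ A B]; simp)+
  then show ?thesis
    by (simp add: e set_integrable_def interval_lebesgue_integral_def set_lebesgue_integral_def has_bochner_integral_iff)
qed

text \<open>The product form reduces integrability to one variable, and each factor 1 + x_i^2 in the
  denominator is the Fourier symbol of the identity minus a second partial derivative.\<close>

definition weight :: "real^2 \<Rightarrow> real" where
  "weight x = 1 / ((1 + (x $ 1)\<^sup>2) * (1 + (x $ 2)\<^sup>2))"

lemma weight_pos: "0 < weight x"
  by (simp add: weight_def add_pos_nonneg)

lemma measurable_weight[measurable]: "weight \<in> borel_measurable borel"
  unfolding weight_def[abs_def] by measurable

lemma integrable_weight: "integrable lborel weight"
proof -
  let ?T = "\<lambda>p. fst p *\<^sub>R axis 1 1 + snd p *\<^sub>R axis 2 1 :: real^2"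
  define g where "g x = 1 / (1 + x\<^sup>2)" for x :: real
  have [measurable]: "g \<in> borel_measurable borel" unfolding g_def by measurable
  have g: "integrable lborel g"
    using has_bochner_integral_inverse_one_plus_square by (simp add: has_bochner_integral_iff g_def[abs_def])
  have "integrable (lborel \<Otimes>\<^sub>M lborel) (\<lambda>p. g (fst p) * g (snd p))"
    using g by (intro lborel_pair.Fubini_integrable) (auto simp: abs_mult)
  then have "integrable (distr (lborel \<Otimes>\<^sub>M lborel) borel ?T) weight"
    by (subst integrable_distr_eq) (auto simp: weight_def g_def axis_nth_12)
  then show ?thesis by (simp only: lborel_real2_std)
qed

lemma one_plus_norm_power4_ge: "1 / (1 + norm x) ^ 4 \<le> weight x"
proof -
  have c: "1 + (x $ i)\<^sup>2 \<le> (1 + norm x)\<^sup>2" for i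
  proof -
    have "(x $ i)\<^sup>2 \<le> (norm x)\<^sup>2"
      using component_le_norm_cart[of x i] by (metis abs_ge_zero power2_abs power_mono)
    then show ?thesis by (simp add: power2_sum add_increasing2)
  qed
  have "(1 + (x $ 1)\<^sup>2) * (1 + (x $ 2)\<^sup>2) \<le> (1 + norm x)\<^sup>2 * (1 + norm x)\<^sup>2"
    by (intro mult_mono c) auto
  also have "\<dots> = (1 + norm x) ^ 4" by (simp flip: power_add)
  finally show ?thesis
    unfolding weight_def by (intro divide_left_mono) (auto simp: add_pos_nonneg intro!: mult_pos_pos zero_less_power)
qed

lemma integrable_weight_bound:
  fixes u :: "real^2 \<Rightarrow> 'b::{banach, second_countable_topology}"
  assumes "u \<in> borel_measurable borel" "\<And>x. norm (u x) \<le> K * weight x"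
  shows "integrable lborel u"
  using assms(1) order_trans[OF assms(2) abs_ge_self]
  by (intro Bochner_Integration.integrable_bound[OF integrable_mult_right[OF integrable_weight, of K]] AE_I2) auto

section \<open>Schwartz functions and their Fourier transforms\<close>

lemma schwartz_decay:
  assumes "schwartz \<phi>"
  obtains K where "K > 0" "\<And>x. (1 + norm x) ^ k * norm (\<phi> x) \<le> K"
proof -
  have "bounded (range (\<lambda>x. (1 + norm x) ^ k *\<^sub>R foldr partial [] \<phi> x))"
    using assms unfolding schwartz_def by blast
  then obtain K where "K > 0" "\<And>x. norm ((1 + norm x) ^ k *\<^sub>R \<phi> x) \<le> K"
    by (auto simp: bounded_pos)
  with that[of K] show ?thesis by (auto simp: abs_of_nonneg)
qed

lemma schwartz_partial: "schwartz \<phi> \<Longrightarrow> schwartz (partial i \<phi>)"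
  unfolding schwartz_def
proof (intro allI)
  fix "is"
  assume *: "\<forall>is. (\<forall>x. foldr partial is \<phi> differentiable at x) \<and>
          (\<forall>k. bounded (range (\<lambda>x. (1 + norm x) ^ k *\<^sub>R foldr partial is \<phi> x)))"
  show "(\<forall>x. foldr partial is (partial i \<phi>) differentiable at x) \<and>
          (\<forall>k. bounded (range (\<lambda>x. (1 + norm x) ^ k *\<^sub>R foldr partial is (partial i \<phi>) x)))"
    \<comment> \<open>\<open>foldr\<close> applies the last entry of the list first, so the new
      derivative is appended at the end.\<close>
    using *[rule_format, of "is @ [i]"] by simp
qed

lemma schwartz_differentiable: "schwartz \<phi> \<Longrightarrow> \<phi> differentiable at x"
  unfolding schwartz_def by (metis foldr_Nil id_apply)

lemma schwartz_continuous: "schwartz \<phi> \<Longrightarrow> continuous_on UNIV \<phi>"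
  using schwartz_differentiable differentiable_imp_continuous_within
  by (metis continuous_at_imp_continuous_on)

lemma schwartz_measurable: "schwartz \<phi> \<Longrightarrow> \<phi> \<in> borel_measurable borel"
  by (intro borel_measurable_continuous_onI schwartz_continuous)

lemma schwartz_bounded:
  assumes "schwartz \<phi>"
  obtains K where "K > 0" "\<And>x. norm (\<phi> x) \<le> K"
  using schwartz_decay[OF assms, of 0] by auto

lemma schwartz_integrable:
  assumes "schwartz \<phi>"
  shows "integrable lborel \<phi>"
proof -
  obtain K where K: "K > 0" "\<And>x. (1 + norm x) ^ 4 * norm (\<phi> x) \<le> K" using schwartz_decay[OF assms] by blast
  show ?thesis
  proof (rule integrable_weight_bound[OF schwartz_measurable[OF assms]])
    fix x :: "real^2"
    have p: "(1 + norm x) ^ 4 > 0" by (intro zero_less_power) (simp add: add_pos_nonneg)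
    then have "norm (\<phi> x) \<le> K * (1 / (1 + norm x) ^ 4)" using K(2)[of x] by (simp add: field_simps)
    also have "\<dots> \<le> K * weight x" using K(1) by (intro mult_left_mono one_plus_norm_power4_ge) auto
    finally show "norm (\<phi> x) \<le> K * weight x" .
  qed
qed

lemma Lp_int_finite:
  assumes u: "integrable lborel u" and K: "\<And>x. norm (u x) \<le> K" and p: "1 \<le> p"
  shows "Lp_int p u < \<infinity>"
proof -
  have K0: "K \<ge> 0" using K[of 0] norm_ge_zero order_trans by blast
  have "Lp_int p u \<le> (\<integral>\<^sup>+x. ennreal (K powr (p - 1) * norm (u x)) \<partial>lborel)"
    unfolding Lp_int_def
  proof (intro nn_integral_mono ennreal_leI)
    fix x
    have "norm (u x) powr p = norm (u x) powr (p - 1) * norm (u x)"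
      using powr_add[of "norm (u x)" "p - 1" 1] by (cases "u x = 0") auto
    also have "\<dots> \<le> K powr (p - 1) * norm (u x)"
      using p by (intro mult_right_mono powr_mono2 K) auto
    finally show "norm (u x) powr p \<le> K powr (p - 1) * norm (u x)" .
  qed
  also have "\<dots> < \<infinity>"
    using u by (subst nn_integral_eq_integral) auto
  finally show ?thesis .
qed

lemma partial_has_derivative:
  assumes "\<phi> differentiable at x"
  shows "\<exists>D. (\<phi> has_derivative D) (at x) \<and> D (axis i 1) = partial i \<phi> x"
  using assms frechet_derivative_works unfolding partial_def by blast

lemma partial_line:
  assumes "\<And>x. \<phi> differentiable at x"
  shows "((\<lambda>s. \<phi> (x + s *\<^sub>R axis i 1)) has_derivative (\<lambda>r. r *\<^sub>R partial i \<phi> (x + s *\<^sub>R axis i 1))) (at s within S)"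
proof -
  obtain D where D: "(\<phi> has_derivative D) (at (x + s *\<^sub>R axis i 1))" "D (axis i 1) = partial i \<phi> (x + s *\<^sub>R axis i 1)"
    using partial_has_derivative[OF assms] by blast
  have "((\<lambda>s. x + s *\<^sub>R axis i 1) has_derivative (\<lambda>r. r *\<^sub>R axis i 1)) (at s within S)"
    by (auto intro!: derivative_eq_intros)
  from has_derivative_compose[OF this D(1)] show ?thesis
    using D has_derivative_bounded_linear[OF D(1)] by (simp add: linear_simps)
qed

text \<open>Computed without integration by parts: a translation by h multiplies the transform by
  exp(i h \<xi>_i), so both sides are limits of the transforms of the same difference
  quotients.\<close>

lemma fourier_partial:
  assumes \<phi>: "schwartz \<phi>"
  shows "fourier (partial i \<phi>) \<xi> = \<i> * complex_of_real (\<xi> $ i) * fourier \<phi> \<xi>"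
proof -
  have [measurable]: "\<phi> \<in> borel_measurable borel" "partial i \<phi> \<in> borel_measurable borel"
    using schwartz_measurable schwartz_partial \<phi> by auto
  define h where "h n = 1 / real (Suc n)" for n
  define e where "e = (axis i 1 :: real^2)"
  have h: "0 < h n" "h n \<le> 1" for n by (auto simp: h_def)
  have h0: "h \<longlonglongrightarrow> 0" unfolding h_def by (intro LIMSEQ_Suc lim_1_over_n)
  have e: "norm e = 1" by (simp add: e_def)
  define Q where "Q n x = (\<phi> (x + h n *\<^sub>R e) - \<phi> x) /\<^sub>R h n" for n x
  let ?E = "\<lambda>x. exp (- \<i> * complex_of_real (x \<bullet> \<xi>))"
  obtain K where K: "K > 0" "\<And>x. (1 + norm x) ^ 4 * norm (partial i \<phi> x) \<le> K"
    using schwartz_decay[OF schwartz_partial[OF \<phi>]] by blast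
  \<comment> \<open>The dominating function comes from the mean value inequality on the segment from
    x to x + h e. The factor 16 is 2^4, since 1 + |x| \<le> 2 (1 + |x + s e|) for 0 \<le> s \<le>
    1.\<close>
  have Qb: "norm (Q n x) \<le> 16 * K * weight x" for n x
  proof -
    have p: "(1 + norm x) ^ 4 > 0" by (intro zero_less_power) (simp add: add_pos_nonneg)
    have b: "norm (partial i \<phi> (x + s *\<^sub>R e)) \<le> 16 * K * (1 / (1 + norm x) ^ 4)" if "s \<in> {0..h n}" for s
    proof -
      let ?y = "x + s *\<^sub>R e"
      have "norm x \<le> norm ?y + norm (s *\<^sub>R e)" using norm_triangle_ineq4[of ?y "s *\<^sub>R e"] by simp
      also have "\<dots> \<le> norm ?y + 1" using that h(2)[of n] e by simp
      finally have "1 + norm x \<le> 2 + norm ?y" by simp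
      also have "\<dots> \<le> 2 * (1 + norm ?y)" by simp
      finally have "1 + norm x \<le> 2 * (1 + norm ?y)" .
      then have "(1 + norm x) ^ 4 \<le> (2 * (1 + norm ?y)) ^ 4" by (intro power_mono) auto
      also have "\<dots> = 16 * (1 + norm ?y) ^ 4" unfolding power_mult_distrib by simp
      finally have "(1 + norm x) ^ 4 * norm (partial i \<phi> ?y) \<le> 16 * (1 + norm ?y) ^ 4 * norm (partial i \<phi> ?y)"
        by (intro mult_right_mono) auto
      also have "\<dots> \<le> 16 * K" using K(2)[of ?y] by simp
      finally show ?thesis using p by (simp add: field_simps)
    qed
    have "norm (\<phi> (x + h n *\<^sub>R e) - \<phi> (x + 0 *\<^sub>R e)) \<le> (16 * K * (1 / (1 + norm x) ^ 4)) * norm (h n - 0)"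
    proof (rule differentiable_bound[where S="{0..h n}" and f="\<lambda>s. \<phi> (x + s *\<^sub>R e)"])
      show "((\<lambda>s. \<phi> (x + s *\<^sub>R e)) has_derivative (\<lambda>r. r *\<^sub>R partial i \<phi> (x + s *\<^sub>R e))) (at s within {0..h n})" for s
        unfolding e_def by (intro partial_line schwartz_differentiable \<phi>)
      show "onorm (\<lambda>r. r *\<^sub>R partial i \<phi> (x + s *\<^sub>R e)) \<le> 16 * K * (1 / (1 + norm x) ^ 4)" if "s \<in> {0..h n}" for s
      proof (rule onorm_le)
        fix r :: real
        show "norm (r *\<^sub>R partial i \<phi> (x + s *\<^sub>R e)) \<le> 16 * K * (1 / (1 + norm x) ^ 4) * norm r"
          using mult_right_mono[OF b[OF that], of "norm r"] by (simp add: mult.commute)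
      qed
    qed (use h in \<open>auto simp: less_imp_le\<close>)
    then have "norm (Q n x) \<le> 16 * K * (1 / (1 + norm x) ^ 4)"
    proof -
      have "norm (Q n x) = norm (\<phi> (x + h n *\<^sub>R e) - \<phi> x) / h n"
        using h(1)[of n] by (simp add: Q_def divide_inverse mult.commute)
      then show ?thesis
        using \<open>norm (\<phi> (x + h n *\<^sub>R e) - \<phi> (x + 0 *\<^sub>R e)) \<le> _\<close> h(1)[of n] by (simp add: pos_divide_le_eq)
    qed
    also have "\<dots> \<le> 16 * K * weight x" using K by (intro mult_left_mono one_plus_norm_power4_ge) auto
    finally show ?thesis .
  qed
  have Ql: "(\<lambda>n. Q n x) \<longlonglongrightarrow> partial i \<phi> x" for x
  proof -
    obtain D where D: "(\<phi> has_derivative D) (at x)" "D e = partial i \<phi> x"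
      using partial_has_derivative[OF schwartz_differentiable[OF \<phi>]] unfolding e_def by blast
    have lin: "D (h n *\<^sub>R e) = h n *\<^sub>R partial i \<phi> x" for n
      using D has_derivative_bounded_linear[OF D(1)] by (simp add: linear_simps)
    have "filterlim (\<lambda>n. h n *\<^sub>R e) (at 0) sequentially"
      unfolding filterlim_at
      using tendsto_scaleR[OF h0 tendsto_const[of e]] h e by (auto simp: less_imp_neq[THEN not_sym] dest: less_imp_neq)
    then have "(\<lambda>n. norm (\<phi> (x + h n *\<^sub>R e) - \<phi> x - D (h n *\<^sub>R e)) / norm (h n *\<^sub>R e)) \<longlonglongrightarrow> 0"
      by (rule filterlim_compose[OF conjunct2[OF D(1)[unfolded has_derivative_at]]])
    moreover have "norm (\<phi> (x + h n *\<^sub>R e) - \<phi> x - D (h n *\<^sub>R e)) / norm (h n *\<^sub>R e) = norm (Q n x - partial i \<phi> x)" for n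
    proof -
      have "Q n x - partial i \<phi> x = (\<phi> (x + h n *\<^sub>R e) - \<phi> x - h n *\<^sub>R partial i \<phi> x) /\<^sub>R h n"
        using h(1)[of n] by (simp add: Q_def scaleR_diff_right)
      then show ?thesis using h(1)[of n] by (simp only: lin) (simp add: e divide_inverse mult.commute)
    qed
    ultimately show ?thesis by (simp add: LIM_zero_iff tendsto_norm_zero_iff)
  qed
  have "(\<lambda>n. LBINT x. ?E x * Q n x) \<longlonglongrightarrow> (LBINT x. ?E x * partial i \<phi> x)"
  proof (rule integral_dominated_convergence[where w="\<lambda>x. 16 * K * weight x"])
    show "integrable lborel (\<lambda>x. 16 * K * weight x)" by (intro integrable_mult_right integrable_weight)
    show "(\<lambda>x. ?E x * Q n x) \<in> borel_measurable lborel" for n unfolding Q_def by measurable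
    show "AE x in lborel. (\<lambda>n. ?E x * Q n x) \<longlonglongrightarrow> ?E x * partial i \<phi> x"
      by (intro AE_I2 tendsto_intros Ql)
    show "AE x in lborel. norm (?E x * Q n x) \<le> 16 * K * weight x" for n
      using Qb by (simp add: norm_mult)
  qed measurable
  moreover have "(\<lambda>n. LBINT x. ?E x * Q n x) \<longlonglongrightarrow> \<i> * complex_of_real (\<xi> $ i) * (LBINT x. ?E x * \<phi> x)"
  proof -
    \<comment> \<open>Translation invariance moves the shift from \<open>\<phi>\<close> into the
      exponential; the resulting factor is the difference quotient of s \<mapsto> exp(i s \<xi>_i)
      at 0.\<close>
    have eq: "(LBINT x. ?E x * Q n x) = ((iexp (h n * \<xi> $ i) - 1) /\<^sub>R h n) * (LBINT x. ?E x * \<phi> x)" for n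
    proof -
      have i1: "integrable lborel (\<lambda>x. ?E x * \<phi> x)" by (rule integrable_iexp_mult[OF schwartz_integrable[OF \<phi>]])
      have sh: "integrable lborel (\<lambda>x. \<phi> (h n *\<^sub>R e + x))"
        by (rule lborel_integrable_shift(1)[OF schwartz_integrable[OF \<phi>]])
      have i2: "integrable lborel (\<lambda>x. ?E x * \<phi> (x + h n *\<^sub>R e))"
        using integrable_iexp_mult[OF sh] by (simp add: add.commute)
      have ei: "(h n *\<^sub>R e) \<bullet> \<xi> = h n * \<xi> $ i" by (simp add: e_def inner_axis')
      have "(LBINT x. ?E x * \<phi> (x + h n *\<^sub>R e)) = (LBINT x. iexp (h n * \<xi> $ i) * (?E (h n *\<^sub>R e + x) * \<phi> (h n *\<^sub>R e + x)))"
      proof (intro Bochner_Integration.integral_cong refl)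
        fix x
        have "?E x = iexp (h n * \<xi> $ i) * ?E (h n *\<^sub>R e + x)"
          unfolding exp_add[symmetric] inner_add_left ei by (simp add: distrib_left)
        then show "?E x * \<phi> (x + h n *\<^sub>R e) = iexp (h n * \<xi> $ i) * (?E (h n *\<^sub>R e + x) * \<phi> (h n *\<^sub>R e + x))"
          by (simp only: mult.assoc add.commute)
      qed
      also have "\<dots> = iexp (h n * \<xi> $ i) * (LBINT x. ?E x * \<phi> x)"
        using lborel_integral_shift(1)[of "\<lambda>x. ?E x * \<phi> x" "h n *\<^sub>R e"] by (subst integral_mult_right_zero) simp
      finally have 1: "(LBINT x. ?E x * \<phi> (x + h n *\<^sub>R e)) = iexp (h n * \<xi> $ i) * (LBINT x. ?E x * \<phi> x)" .
      have "(LBINT x. ?E x * Q n x) = (LBINT x. (?E x * \<phi> (x + h n *\<^sub>R e) - ?E x * \<phi> x) /\<^sub>R h n)"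
        by (intro Bochner_Integration.integral_cong refl) (simp add: Q_def right_diff_distrib)
      also have "\<dots> = ((LBINT x. ?E x * \<phi> (x + h n *\<^sub>R e)) - (LBINT x. ?E x * \<phi> x)) /\<^sub>R h n"
        by (subst integral_scaleR_right, subst Bochner_Integration.integral_diff[OF i2 i1]) simp
      finally show ?thesis unfolding 1 by (simp add: left_diff_distrib)
    qed
    have "((\<lambda>s. iexp (s * \<xi> $ i)) has_vector_derivative \<i> * complex_of_real (\<xi> $ i) * iexp (0 * \<xi> $ i)) (at 0)"
      by (auto intro!: derivative_eq_intros has_vector_derivative_real_field simp: field_simps)
    note hd = this[unfolded has_vector_derivative_def has_derivative_at]
    have "filterlim h (at 0) sequentially"
      using h0 h by (auto simp: filterlim_at less_imp_neq[THEN not_sym])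
    then have "(\<lambda>n. norm (iexp ((0 + h n) * \<xi> $ i) - iexp (0 * \<xi> $ i) - h n *\<^sub>R (\<i> * complex_of_real (\<xi> $ i) * iexp (0 * \<xi> $ i))) / norm (h n)) \<longlonglongrightarrow> 0"
      by (rule filterlim_compose[OF conjunct2[OF hd]])
    moreover have "norm (iexp ((0 + h n) * \<xi> $ i) - iexp (0 * \<xi> $ i) - h n *\<^sub>R (\<i> * complex_of_real (\<xi> $ i) * iexp (0 * \<xi> $ i))) / norm (h n)
      = norm ((iexp (h n * \<xi> $ i) - 1) /\<^sub>R h n - \<i> * complex_of_real (\<xi> $ i))" for n
    proof -
      have "(iexp (h n * \<xi> $ i) - 1) /\<^sub>R h n - \<i> * complex_of_real (\<xi> $ i)
        = (iexp (h n * \<xi> $ i) - 1 - h n *\<^sub>R (\<i> * complex_of_real (\<xi> $ i))) /\<^sub>R h n"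
        using h(1)[of n] by (simp only: scaleR_diff_right) simp
      then show ?thesis using h(1)[of n] by (simp add: divide_inverse mult.commute)
    qed
    ultimately have "(\<lambda>n. (iexp (h n * \<xi> $ i) - 1) /\<^sub>R h n) \<longlonglongrightarrow> \<i> * complex_of_real (\<xi> $ i)"
      by (simp only: LIM_zero_iff tendsto_norm_zero_iff)
    then show ?thesis unfolding eq by (intro tendsto_intros)
  qed
  ultimately have "(LBINT x. ?E x * partial i \<phi> x) = \<i> * complex_of_real (\<xi> $ i) * (LBINT x. ?E x * \<phi> x)"
    by (rule LIMSEQ_unique)
  then show ?thesis by (simp add: fourier_def)
qed

text \<open>Multiplying by the reciprocal of \<open>weight\<close> on the frequency side means
  applying (1 - second derivative) in each variable, and the transform of the resulting integrable
  function is bounded.\<close>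

lemma fourier_schwartz_decay:
  assumes \<phi>: "schwartz \<phi>"
  obtains K where "\<And>\<xi>. norm (fourier \<phi> \<xi>) \<le> K * weight \<xi>"
proof -
  define M where "M u = (LBINT x. norm (u x)) / (2 * pi)" for u :: "real^2 \<Rightarrow> complex"
  have M: "norm (fourier u \<xi>) \<le> M u" for u \<xi> unfolding M_def by (rule norm_fourier_le)
  let ?a = "partial 1 (partial 1 \<phi>)" and ?b = "partial 2 (partial 2 \<phi>)" and ?c = "partial 1 (partial 1 (partial 2 (partial 2 \<phi>)))"
  have d: "fourier (partial i (partial i \<psi>)) \<xi> = - complex_of_real ((\<xi> $ i)\<^sup>2) * fourier \<psi> \<xi>" if "schwartz \<psi>" for i \<psi> \<xi>
  proof -
    have "\<i> * z * (\<i> * z * w) = - (z * z * w)" for z w :: complex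
      by (metis (no_types) i_squared mult.assoc mult.left_commute mult_minus1)
    then show ?thesis using that by (simp add: fourier_partial schwartz_partial power2_eq_square)
  qed
  have "norm (fourier \<phi> \<xi>) \<le> (M \<phi> + M ?a + M ?b + M ?c) * weight \<xi>" for \<xi>
  proof -
    have "complex_of_real ((1 + (\<xi> $ 1)\<^sup>2) * (1 + (\<xi> $ 2)\<^sup>2)) * fourier \<phi> \<xi>
       = fourier \<phi> \<xi> - fourier ?a \<xi> - fourier ?b \<xi> + fourier ?c \<xi>"
      using \<phi> by (simp add: d schwartz_partial algebra_simps)
    then have "norm (complex_of_real ((1 + (\<xi> $ 1)\<^sup>2) * (1 + (\<xi> $ 2)\<^sup>2)) * fourier \<phi> \<xi>) \<le> M \<phi> + M ?a + M ?b + M ?c"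
      using M[of \<phi> \<xi>] M[of ?a \<xi>] M[of ?b \<xi>] M[of ?c \<xi>]
      by (metis (no_types, lifting) add_mono norm_triangle_mono norm_triangle_le_diff)
    then have "((1 + (\<xi> $ 1)\<^sup>2) * (1 + (\<xi> $ 2)\<^sup>2)) * norm (fourier \<phi> \<xi>) \<le> M \<phi> + M ?a + M ?b + M ?c"
      by (simp only: norm_mult norm_of_real) (simp add: abs_mult)
    moreover have "(1 + (\<xi> $ 1)\<^sup>2) * (1 + (\<xi> $ 2)\<^sup>2) > 0" by (intro mult_pos_pos) (auto simp: add_pos_nonneg)
    ultimately show ?thesis by (simp add: weight_def field_simps)
  qed
  then show ?thesis by (rule that)
qed

lemma fourier_schwartz_integrable:
  assumes "schwartz \<phi>"
  shows "integrable lborel (fourier \<phi>)"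
proof -
  obtain K where "\<And>\<xi>. norm (fourier \<phi> \<xi>) \<le> K * weight \<xi>" using fourier_schwartz_decay[OF assms] by blast
  then show ?thesis by (rule integrable_weight_bound[OF measurable_fourier[OF schwartz_measurable[OF assms]]])
qed

lemma fourier_schwartz_inversion: "schwartz \<phi> \<Longrightarrow> fourier (fourier \<phi>) (- x) = \<phi> x"
  using schwartz_bounded[of \<phi>]
  by (metis fourier_inversion schwartz_integrable schwartz_continuous fourier_schwartz_integrable)

lemma fourier_reflect: "fourier (\<lambda>x. u (- x)) \<xi> = fourier u (- \<xi>)"
  using lborel_integral_shift(2)[of "\<lambda>x. exp (- \<i> * complex_of_real (x \<bullet> (- \<xi>))) * u x" 0]
  by (simp add: fourier_def)

text \<open>Polynomials times one fixed modulated Gaussian, given by closure rules so that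
  smoothness and decay follow by induction. They serve only to certify that modulated Gaussians are
  Schwartz functions, hence admissible tests for \<open>has_fourier_transform\<close>.\<close>

inductive_set poly_gaussian :: "real^2 \<Rightarrow> (real^2 \<Rightarrow> complex) set" for b where
  base: "(\<lambda>x. exp (- \<i> * complex_of_real (x \<bullet> b)) * complex_of_real (gaussian 1 x)) \<in> poly_gaussian b"
| coord: "f \<in> poly_gaussian b \<Longrightarrow> (\<lambda>x. complex_of_real (x $ i) * f x) \<in> poly_gaussian b"
| cmult: "f \<in> poly_gaussian b \<Longrightarrow> (\<lambda>x. c * f x) \<in> poly_gaussian b"
| add: "f \<in> poly_gaussian b \<Longrightarrow> g \<in> poly_gaussian b \<Longrightarrow> (\<lambda>x. f x + g x) \<in> poly_gaussian b"

lemma partialI: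
  assumes "\<And>x. (f has_derivative D x) (at x)"
  shows "partial i f = (\<lambda>x. D x (axis i 1))"
proof
  fix x
  show "partial i f x = D x (axis i 1)"
    unfolding partial_def by (rule fun_cong[OF frechet_derivative_at[OF assms], symmetric])
qed

lemma poly_gaussian_derivative:
  assumes "f \<in> poly_gaussian b"
  shows "\<exists>D. (\<forall>x. (f has_derivative D x) (at x)) \<and> (\<forall>i. (\<lambda>x. D x (axis i 1)) \<in> poly_gaussian b)"
  using assms
proof induction
  case base
  let ?g = "\<lambda>x. exp (- \<i> * complex_of_real (x \<bullet> b)) * complex_of_real (gaussian 1 x)"
  let ?e = "\<lambda>x. - \<i> * complex_of_real (x \<bullet> b) - complex_of_real (x \<bullet> x / 2)"
  have g: "?g = (\<lambda>x. exp (?e x))"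
  proof
    fix x
    have "gaussian 1 x = exp (- (x \<bullet> x / 2))" by (simp add: gaussian_def power2_norm_eq_inner)
    then show "?g x = exp (?e x)"
      by (simp only: exp_of_real[symmetric] exp_add[symmetric] of_real_minus diff_conv_add_uminus)
  qed
  let ?D = "\<lambda>x h. ?g x * (- \<i> * complex_of_real (h \<bullet> b) - complex_of_real (x \<bullet> h))"
  have "(?g has_derivative ?D x) (at x)" for x
  proof -
    have "(?e has_derivative (\<lambda>h. - \<i> * complex_of_real (h \<bullet> b) - complex_of_real (x \<bullet> h))) (at x)"
      by (auto intro!: derivative_eq_intros simp: fun_eq_iff inner_commute)
    from has_derivative_compose[OF this DERIV_exp[unfolded has_field_derivative_def]]
    show ?thesis unfolding g fun_cong[OF g, of x] .
  qed
  moreover have "(\<lambda>x. ?D x (axis i 1)) \<in> poly_gaussian b" for i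
  proof -
    have "(\<lambda>x. ?D x (axis i 1)) = (\<lambda>x. (- \<i> * complex_of_real (b $ i)) * ?g x + (-1) * (complex_of_real (x $ i) * ?g x))"
    proof
      fix x
      have "G * (- \<i> * c - d) = - \<i> * c * G + - 1 * (d * G)" for G c d :: complex
        by (simp add: algebra_simps)
      then show "?D x (axis i 1) = (- \<i> * complex_of_real (b $ i)) * ?g x + (-1) * (complex_of_real (x $ i) * ?g x)"
        by (simp only: inner_axis inner_axis' inner_real_def mult_1 mult_1_right)
    qed
    then show ?thesis by (simp only:) (intro poly_gaussian.intros)
  qed
  ultimately show ?case by (intro exI[of _ ?D]) blast
next
  case (coord f j)
  then obtain D where D: "\<And>x. (f has_derivative D x) (at x)" "\<And>i. (\<lambda>x. D x (axis i 1)) \<in> poly_gaussian b" by blast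
  let ?D = "\<lambda>x h. complex_of_real (h $ j) * f x + complex_of_real (x $ j) * D x h"
  have "((\<lambda>x. complex_of_real (x $ j) * f x) has_derivative ?D x) (at x)" for x
    by (auto intro!: derivative_eq_intros D bounded_linear_imp_has_derivative bounded_linear_vec_nth simp: fun_eq_iff)
  moreover have "(\<lambda>x. ?D x (axis i 1)) \<in> poly_gaussian b" for i
    by (intro poly_gaussian.add poly_gaussian.cmult poly_gaussian.coord D coord)
  ultimately show ?case by (intro exI[of _ ?D]) blast
next
  case (cmult f c)
  then obtain D where D: "\<And>x. (f has_derivative D x) (at x)" "\<And>i. (\<lambda>x. D x (axis i 1)) \<in> poly_gaussian b" by blast
  then show ?case
    by (intro exI[of _ "\<lambda>x h. c * D x h"]) (auto intro: poly_gaussian.cmult derivative_eq_intros)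
next
  case (add f g)
  then obtain D where D: "\<And>x. (f has_derivative D x) (at x)" "\<And>i. (\<lambda>x. D x (axis i 1)) \<in> poly_gaussian b" by blast
  obtain E where E: "\<And>x. (g has_derivative E x) (at x)" "\<And>i. (\<lambda>x. E x (axis i 1)) \<in> poly_gaussian b" using add by blast
  show ?case
    using D E by (intro exI[of _ "\<lambda>x h. D x h + E x h"]) (auto intro: poly_gaussian.add has_derivative_add)
qed

lemma poly_gaussian_partial:
  "f \<in> poly_gaussian b \<Longrightarrow> partial i f \<in> poly_gaussian b"
  using poly_gaussian_derivative[of f b] partialI[of f] by metis

lemma poly_gaussian_differentiable:
  "f \<in> poly_gaussian b \<Longrightarrow> f differentiable at x"
  using poly_gaussian_derivative[of f b] unfolding differentiable_def by blast

text \<open>In the base case y^k \<le> k! exp y with y = 1 + r, and completing the square gives 1 +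
  r - r^2/2 \<le> 3/2. The exponent \<open>k\<close> is kept general in the induction because a
  coordinate factor costs one power of 1 + |x|.\<close>

lemma poly_gaussian_decay:
  assumes "f \<in> poly_gaussian b"
  shows "\<exists>K. \<forall>x. (1 + norm x) ^ k * norm (f x) \<le> K"
  using assms
proof (induction arbitrary: k)
  case base
  have "(1 + norm x) ^ k * norm (exp (- \<i> * complex_of_real (x \<bullet> b)) * complex_of_real (gaussian 1 x)) \<le> fact k * exp (3 / 2)" for x
  proof -
    have "(1 + norm x) ^ k / fact k \<le> exp (1 + norm x)"
    proof -
      have s: "(\<lambda>n. (1 + norm x) ^ n /\<^sub>R fact n) sums exp (1 + norm x)" by (rule exp_converges)
      have "(\<Sum>n\<in>{k}. (1 + norm x) ^ n /\<^sub>R fact n) \<le> (\<Sum>n. (1 + norm x) ^ n /\<^sub>R fact n)"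
        using s by (intro sum_le_suminf) (auto simp: sums_iff)
      then show ?thesis using s by (simp add: sums_iff divide_inverse mult.commute)
    qed
    then have 1: "(1 + norm x) ^ k \<le> fact k * exp (1 + norm x)" by (simp add: field_simps)
    have "1 + norm x - (norm x)\<^sup>2 / 2 \<le> 3 / 2"
      using zero_le_power2[of "norm x - 1"] by (simp add: power2_eq_square algebra_simps)
    then have 2: "exp (1 + norm x) * gaussian 1 x \<le> exp (3 / 2)"
      by (simp add: gaussian_def exp_add[symmetric] del: exp_le_cancel_iff) simp
    have "(1 + norm x) ^ k * gaussian 1 x \<le> fact k * exp (1 + norm x) * gaussian 1 x"
      by (intro mult_right_mono 1) (simp add: gaussian_pos)
    also have "\<dots> \<le> fact k * exp (3 / 2)" using 2 by (simp add: mult.assoc)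
    finally show ?thesis by (simp add: norm_mult gaussian_pos)
  qed
  then show ?case by blast
next
  case (coord f i)
  obtain K where K: "\<And>x. (1 + norm x) ^ Suc k * norm (f x) \<le> K" using coord.IH[of "Suc k"] by blast
  have "(1 + norm x) ^ k * norm (complex_of_real (x $ i) * f x) \<le> K" for x
  proof -
    have "\<bar>x $ i\<bar> \<le> 1 + norm x" using component_le_norm_cart[of x i] by simp
    then have "(1 + norm x) ^ k * (\<bar>x $ i\<bar> * norm (f x)) \<le> (1 + norm x) ^ k * ((1 + norm x) * norm (f x))"
      by (intro mult_left_mono mult_right_mono) auto
    also have "\<dots> \<le> K" using K[of x] by (simp add: mult_ac)
    finally show ?thesis by (simp add: norm_mult)
  qed
  then show ?case by blast
next
  case (cmult f c)
  obtain K where K: "\<And>x. (1 + norm x) ^ k * norm (f x) \<le> K" using cmult.IH[of k] by blast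
  have "(1 + norm x) ^ k * norm (c * f x) \<le> norm c * K" for x
    using mult_left_mono[OF K[of x], of "norm c"] by (simp add: norm_mult mult_ac)
  then show ?case by blast
next
  case (add f g)
  obtain K where K: "\<And>x. (1 + norm x) ^ k * norm (f x) \<le> K" using add.IH(1)[of k] by blast
  obtain L where L: "\<And>x. (1 + norm x) ^ k * norm (g x) \<le> L" using add.IH(2)[of k] by blast
  have "(1 + norm x) ^ k * norm (f x + g x) \<le> K + L" for x
  proof -
    have "(1 + norm x) ^ k * norm (f x + g x) \<le> (1 + norm x) ^ k * (norm (f x) + norm (g x))"
      by (intro mult_left_mono norm_triangle_ineq) auto
    then show ?thesis using K[of x] L[of x] by (simp add: distrib_left)
  qed
  then show ?case by blast
qed

lemma poly_gaussian_schwartz: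
  assumes "f \<in> poly_gaussian b"
  shows "schwartz f"
proof -
  have *: "foldr partial is f \<in> poly_gaussian b" for "is"
    using assms by (induction "is") (auto intro: poly_gaussian_partial)
  show ?thesis unfolding schwartz_def
  proof (intro allI conjI)
    fix "is" x k
    show "foldr partial is f differentiable at x" by (rule poly_gaussian_differentiable[OF *])
    obtain K where "\<And>x. (1 + norm x) ^ k * norm (foldr partial is f x) \<le> K"
      using poly_gaussian_decay[OF *] by blast
    then show "bounded (range (\<lambda>x. (1 + norm x) ^ k *\<^sub>R foldr partial is f x))"
      by (intro boundedI[of _ K]) (auto simp: abs_of_nonneg)
  qed
qed

lemma schwartz_modulated_gaussian:
  "schwartz (\<lambda>x. exp (- \<i> * complex_of_real (x \<bullet> b)) * complex_of_real (gaussian 1 x))"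
  by (rule poly_gaussian_schwartz[OF poly_gaussian.base])

section \<open>Tempered functions and uniqueness of the distributional transform\<close>

lemma tempered_measurable: "tempered u \<Longrightarrow> u \<in> borel_measurable borel"
  by (simp add: tempered_def)

lemma tempered_schwartz_integrable:
  assumes u: "tempered u" and \<phi>: "schwartz \<phi>"
  shows "integrable lborel (\<lambda>x. u x * \<phi> x)"
proof -
  obtain N where N: "integrable lborel (\<lambda>x. u x / complex_of_real ((1 + norm x) ^ N))"
    using u by (auto simp: tempered_def)
  obtain K where K: "K > 0" "\<And>x. (1 + norm x) ^ N * norm (\<phi> x) \<le> K" using schwartz_decay[OF \<phi>] by blast
  have [measurable]: "u \<in> borel_measurable borel" "\<phi> \<in> borel_measurable borel"
    using tempered_measurable[OF u] schwartz_measurable[OF \<phi>] .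
  show ?thesis
  proof (rule Bochner_Integration.integrable_bound[OF integrable_mult_right[OF integrable_norm[OF N], of K]])
    show "AE x in lborel. norm (u x * \<phi> x) \<le> norm (K * norm (u x / complex_of_real ((1 + norm x) ^ N)))"
    proof (rule AE_I2)
      fix x :: "real^2"
      have p: "(1 + norm x) ^ N > 0" by (intro zero_less_power) (simp add: add_pos_nonneg)
      have "norm (u x * \<phi> x) = norm (u x) / (1 + norm x) ^ N * ((1 + norm x) ^ N * norm (\<phi> x))"
        using less_imp_neq[OF p] by (simp add: norm_mult del: power_eq_0_iff)
      also have "\<dots> \<le> norm (u x) / (1 + norm x) ^ N * K"
        using p by (intro mult_left_mono K) auto
      also have "\<dots> = norm (K * norm (u x / complex_of_real ((1 + norm x) ^ N)))"
      proof -
        have "norm (complex_of_real ((1 + norm x) ^ N)) = (1 + norm x) ^ N"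
          using p by (simp only: norm_of_real abs_of_pos)
        then show ?thesis using K(1) by (simp only: norm_divide) (simp add: abs_mult mult.commute)
      qed
      finally show "norm (u x * \<phi> x) \<le> norm (K * norm (u x / complex_of_real ((1 + norm x) ^ N)))" .
    qed
  qed measurable
qed

lemma temperedI:
  assumes [measurable]: "u \<in> borel_measurable borel"
    and fin: "(\<integral>\<^sup>+x. ennreal (norm (u x) * weight x) \<partial>lborel) < \<infinity>"
  shows "tempered u"
  unfolding tempered_def
proof (intro conjI exI[of _ 4])
  show "integrable lborel (\<lambda>x. u x / complex_of_real ((1 + norm x) ^ 4))"
  proof (rule integrableI_bounded)
    have "(\<integral>\<^sup>+x. ennreal (norm (u x / complex_of_real ((1 + norm x) ^ 4))) \<partial>lborel) \<le> (\<integral>\<^sup>+x. ennreal (norm (u x) * weight x) \<partial>lborel)"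
    proof (intro nn_integral_mono ennreal_leI)
      fix x
      have "norm (u x / complex_of_real ((1 + norm x) ^ 4)) = norm (u x) * (1 / (1 + norm x) ^ 4)"
        by (simp only: norm_divide norm_of_real) simp
      also have "\<dots> \<le> norm (u x) * weight x" by (intro mult_left_mono one_plus_norm_power4_ge) auto
      finally show "norm (u x / complex_of_real ((1 + norm x) ^ 4)) \<le> norm (u x) * weight x" .
    qed
    then show "(\<integral>\<^sup>+x. ennreal (norm (u x / complex_of_real ((1 + norm x) ^ 4))) \<partial>lborel) < \<infinity>"
      using fin by (rule le_less_trans)
  qed measurable
qed (use assms in simp)

lemma weight_le_1: "weight x \<le> 1"
proof -
  have "1 * 1 \<le> (1 + (x $ 1)\<^sup>2) * (1 + (x $ 2)\<^sup>2)" by (intro mult_mono) auto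
  then show ?thesis unfolding weight_def by (intro divide_le_eq_1_pos[THEN iffD2] mult_pos_pos) (auto simp: add_pos_nonneg)
qed

lemma nn_integral_weight: "(\<integral>\<^sup>+x. ennreal (c * weight x) \<partial>lborel) < \<infinity>"
proof -
  have "(\<integral>\<^sup>+x. ennreal (c * weight x) \<partial>lborel) \<le> (\<integral>\<^sup>+x. ennreal (\<bar>c\<bar> * weight x) \<partial>lborel)"
    using weight_pos by (intro nn_integral_mono ennreal_leI mult_right_mono) (auto intro: less_imp_le)
  also have "\<dots> = ennreal (LBINT x. \<bar>c\<bar> * weight x)"
    by (intro nn_integral_eq_integral integrable_mult_right integrable_weight)
      (auto intro!: AE_I2 mult_nonneg_nonneg less_imp_le[OF weight_pos])
  also have "\<dots> < \<infinity>" by simp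
  finally show ?thesis .
qed

text \<open>From |u| \<le> 1 + |u|^p, with the constant paired with the integrable weight and the
  power with the bound \<open>weight_le_1\<close>.\<close>

lemma tempered_Lp:
  assumes [measurable]: "u \<in> borel_measurable borel" and p: "1 \<le> p" and fin: "Lp_int p u < \<infinity>"
  shows "tempered u"
proof (rule temperedI)
  have "(\<integral>\<^sup>+x. ennreal (norm (u x) * weight x) \<partial>lborel) \<le> (\<integral>\<^sup>+x. ennreal (1 * weight x) + ennreal (norm (u x) powr p) \<partial>lborel)"
  proof (intro nn_integral_mono)
    fix x
    have "norm (u x) * weight x \<le> 1 * weight x + norm (u x) powr p"
    proof (cases "norm (u x) \<le> 1")
      case True
      then show ?thesis using weight_pos[of x] by (intro add_increasing2 mult_right_mono) auto
    next
      case False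
      then have "norm (u x) powr 1 \<le> norm (u x) powr p" using p by (intro powr_mono) auto
      moreover have "norm (u x) * weight x \<le> norm (u x) * 1" by (intro mult_left_mono weight_le_1) auto
      ultimately show ?thesis using False weight_pos[of x] by simp
    qed
    then show "ennreal (norm (u x) * weight x) \<le> ennreal (1 * weight x) + ennreal (norm (u x) powr p)"
      using weight_pos[of x] by (simp add: ennreal_plus[symmetric] del: ennreal_plus)
  qed
  also have "\<dots> = (\<integral>\<^sup>+x. ennreal (1 * weight x) \<partial>lborel) + Lp_int p u"
    unfolding Lp_int_def by (rule nn_integral_add) auto
  also have "\<dots> < \<infinity>" using fin nn_integral_weight[of 1] by simp
  finally show "(\<integral>\<^sup>+x. ennreal (norm (u x) * weight x) \<partial>lborel) < \<infinity>" .
qed measurable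

lemma tempered_bounded:
  assumes [measurable]: "u \<in> borel_measurable borel" and K: "\<And>x. norm (u x) \<le> K"
  shows "tempered u"
proof (rule temperedI)
  have "(\<integral>\<^sup>+x. ennreal (norm (u x) * weight x) \<partial>lborel) \<le> (\<integral>\<^sup>+x. ennreal (K * weight x) \<partial>lborel)"
    using weight_pos by (intro nn_integral_mono ennreal_leI mult_right_mono K) (auto intro: less_imp_le)
  then show "(\<integral>\<^sup>+x. ennreal (norm (u x) * weight x) \<partial>lborel) < \<infinity>" using nn_integral_weight by (rule le_less_trans)
qed measurable

text \<open>Testing against all modulations of one Gaussian says that the Fourier transform of (F -
  G) times the Gaussian vanishes identically. That product is integrable, so injectivity applies,
  and the Gaussian has no zeros.\<close>

lemma has_fourier_transform_unique:
  assumes F: "has_fourier_transform f F" and G: "has_fourier_transform f G"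
  shows "AE \<xi> in lborel. F \<xi> = G \<xi>"
proof -
  have t: "tempered F" "tempered G" using F G by (auto simp: has_fourier_transform_def)
  let ?g = "\<lambda>b x. exp (- \<i> * complex_of_real (x \<bullet> b)) * complex_of_real (gaussian 1 x)"
  let ?u = "\<lambda>\<xi>. (F \<xi> - G \<xi>) * complex_of_real (gaussian 1 \<xi>)"
  note gs = schwartz_modulated_gaussian
  note i1 = tempered_schwartz_integrable[OF t(1) gs] and i2 = tempered_schwartz_integrable[OF t(2) gs]
  have "integrable lborel ?u" using Bochner_Integration.integrable_diff[OF i1[of 0] i2[of 0]] by (simp add: left_diff_distrib)
  moreover have "fourier ?u b = 0" for b
  proof -
    have "(LBINT \<xi>. F \<xi> * ?g b \<xi>) = (LBINT \<xi>. G \<xi> * ?g b \<xi>)"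
      using F G gs[of b] by (simp add: has_fourier_transform_def)
    then have "0 = (LBINT \<xi>. F \<xi> * ?g b \<xi> - G \<xi> * ?g b \<xi>)"
      by (subst Bochner_Integration.integral_diff[OF i1 i2]) simp
    also have "\<dots> = (LBINT \<xi>. exp (- \<i> * complex_of_real (\<xi> \<bullet> b)) * ?u \<xi>)"
      by (intro Bochner_Integration.integral_cong refl) (simp add: algebra_simps)
    finally show ?thesis by (simp add: fourier_def)
  qed
  ultimately have "AE \<xi> in lborel. ?u \<xi> = 0" by (rule fourier_eq_0_imp_AE_eq_0)
  then show ?thesis by eventually_elim (use gaussian_pos(1) in \<open>auto simp: less_imp_neq[THEN not_sym]\<close>)
qed

text \<open>The function supplied by \<open>fourier_Lp_extension\<close> satisfies the defining
  identity for Schwartz tests, so uniqueness identifies it with any given transform. The second half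
  provides the inverse transform, with the same constant.\<close>

lemma Hausdorff_Young_transform:
  assumes p: "1 < p" "p \<le> 2" and q: "q = p / (p - 1)"
  shows "\<exists>C>0. (\<forall>g G A. has_fourier_transform g G \<and> 0 \<le> A \<and> Lp_int p g \<le> ennreal A \<longrightarrow> Lp_int q G \<le> ennreal (C * A powr (q - 1)))
    \<and> (\<forall>G A. G \<in> borel_measurable borel \<and> 0 \<le> A \<and> Lp_int p G \<le> ennreal A \<longrightarrow>
        (\<exists>h. has_fourier_transform h G \<and> Lp_int q h \<le> ennreal (C * A powr (q - 1))))"
proof -
  have q1: "q > 1" using p by (simp add: q field_simps)
  obtain C where C: "C > 0" and ext: "\<And>g A. g \<in> borel_measurable borel \<Longrightarrow> 0 \<le> A \<Longrightarrow> Lp_int p g \<le> ennreal A \<Longrightarrow>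
    \<exists>G\<in>borel_measurable borel. Lp_int q G \<le> ennreal (C * A powr (q - 1)) \<and>
      (\<forall>\<psi>. integrable lborel \<psi> \<and> Lp_int p \<psi> < \<infinity> \<longrightarrow> (LBINT \<xi>. G \<xi> * \<psi> \<xi>) = (LBINT x. g x * fourier \<psi> x))"
    using fourier_Lp_extension[OF p q] by blast
  have "Lp_int q G \<le> ennreal (C * A powr (q - 1))"
    if G: "has_fourier_transform g G" and A: "0 \<le> A" "Lp_int p g \<le> ennreal A" for g G A
  proof -
    have t: "tempered g" "tempered G" using G by (auto simp: has_fourier_transform_def)
    obtain G' where G': "G' \<in> borel_measurable borel" "Lp_int q G' \<le> ennreal (C * A powr (q - 1))"
      "\<And>\<psi>. integrable lborel \<psi> \<Longrightarrow> Lp_int p \<psi> < \<infinity> \<Longrightarrow> (LBINT \<xi>. G' \<xi> * \<psi> \<xi>) = (LBINT x. g x * fourier \<psi> x)"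
      using ext[OF tempered_measurable[OF t(1)] A] by blast
    have "has_fourier_transform g G'"
      unfolding has_fourier_transform_def
    proof (intro conjI allI impI)
      show "tempered G'" using G' q1 by (intro tempered_Lp[of _ q]) (auto intro: le_less_trans)
      fix \<phi> assume \<phi>: "schwartz \<phi>"
      obtain K where K: "\<And>x. norm (\<phi> x) \<le> K" using schwartz_bounded[OF \<phi>] by blast
      show "(LBINT \<xi>. G' \<xi> * \<phi> \<xi>) = (LBINT x. g x * fourier \<phi> x)"
        using p by (intro G'(3) schwartz_integrable \<phi> Lp_int_finite[OF _ K]) auto
    qed fact
    then have "AE \<xi> in lborel. G \<xi> = G' \<xi>" using has_fourier_transform_unique[OF G] by blast
    then have "Lp_int q G = Lp_int q G'" unfolding Lp_int_def by (intro nn_integral_cong_AE) auto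
    then show ?thesis using G' by simp
  qed
  moreover have "\<exists>h. has_fourier_transform h G \<and> Lp_int q h \<le> ennreal (C * A powr (q - 1))"
    if G: "G \<in> borel_measurable borel" and A: "0 \<le> A" "Lp_int p G \<le> ennreal A" for G A
  proof -
    obtain H where H: "H \<in> borel_measurable borel" "Lp_int q H \<le> ennreal (C * A powr (q - 1))"
      "\<And>\<psi>. integrable lborel \<psi> \<Longrightarrow> Lp_int p \<psi> < \<infinity> \<Longrightarrow> (LBINT \<xi>. H \<xi> * \<psi> \<xi>) = (LBINT x. G x * fourier \<psi> x)"
      using ext[OF G A] by blast
    have [measurable]: "H \<in> borel_measurable borel" by fact
    \<comment> \<open>Inversion in the form \<open>fourier (fourier \<phi>) (- x) = \<phi> x\<close>
      shows that the inverse transform is the transform followed by a reflection.\<close>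
    define h where "h x = H (- x)" for x
    have hm[measurable]: "h \<in> borel_measurable borel" unfolding h_def by measurable
    have hq: "Lp_int q h = Lp_int q H"
      using lborel_nn_integral_scaleR[of "-1" "\<lambda>x. ennreal (norm (H x) powr q)" 0] by (simp add: Lp_int_def h_def)
    have "has_fourier_transform h G"
      unfolding has_fourier_transform_def
    proof (intro conjI allI impI)
      show "tempered h" using H q1 hq by (intro tempered_Lp[of _ q]) (auto intro: le_less_trans)
      show "tempered G" using G A p by (intro tempered_Lp[of _ p]) (auto intro: le_less_trans)
      fix \<phi> assume \<phi>: "schwartz \<phi>"
      let ?\<psi> = "\<lambda>x. fourier \<phi> (- x)"
      have \<psi>: "integrable lborel ?\<psi>" by (intro lborel_integrable_shift fourier_schwartz_integrable \<phi>)
      have "(LBINT x. h x * fourier \<phi> x) = (LBINT x. H x * ?\<psi> x)"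
        using lborel_integral_shift(2)[of "\<lambda>x. h x * fourier \<phi> x" 0] by (simp add: h_def)
      also have "\<dots> = (LBINT x. G x * fourier ?\<psi> x)"
        using p by (intro H(3) \<psi> Lp_int_finite[OF _ norm_fourier_le]) auto
      also have "fourier ?\<psi> = \<phi>"
        by (simp add: fun_eq_iff fourier_reflect fourier_schwartz_inversion[OF \<phi>])
      finally show "(LBINT \<xi>. G \<xi> * \<phi> \<xi>) = (LBINT x. h x * fourier \<phi> x)" ..
    qed
    then show ?thesis using H hq by auto
  qed
  ultimately show ?thesis using C by blast
qed

text \<open>The endpoint p = 1 of the forward inequality; the lemma after it is the corresponding
  endpoint for the inverse transform.\<close>

lemma fourier_transform_integrable_bound:
  assumes G: "has_fourier_transform g G" and g: "integrable lborel g"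
  shows "AE \<xi> in lborel. norm (G \<xi>) \<le> (LBINT x. norm (g x)) / (2 * pi)"
proof -
  have "has_fourier_transform g (fourier g)"
    unfolding has_fourier_transform_def
    using G fourier_multiplication_formula[OF g schwartz_integrable] norm_fourier_le borel_measurable_integrable[OF g]
    by (auto simp: has_fourier_transform_def intro!: tempered_bounded measurable_fourier)
  then have "AE \<xi> in lborel. G \<xi> = fourier g \<xi>" using has_fourier_transform_unique[OF G] by blast
  then show ?thesis by eventually_elim (simp add: norm_fourier_le)
qed

lemma inverse_fourier_transform_integrable:
  assumes G: "integrable lborel G"
  shows "\<exists>h\<in>borel_measurable borel. has_fourier_transform h G \<and> (\<forall>x. norm (h x) \<le> (LBINT \<xi>. norm (G \<xi>)) / (2 * pi))"
proof -
  define h where "h x = fourier G (- x)" for x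
  have Gm[measurable]: "G \<in> borel_measurable borel" using G by auto
  have hm[measurable]: "h \<in> borel_measurable borel" unfolding h_def by measurable
  have b: "norm (h x) \<le> (LBINT \<xi>. norm (G \<xi>)) / (2 * pi)" for x unfolding h_def by (rule norm_fourier_le)
  have "has_fourier_transform h G"
    unfolding has_fourier_transform_def
  proof (intro conjI allI impI)
    show "tempered h" by (rule tempered_bounded[OF hm b])
    have "Lp_int 1 G < \<infinity>" using G by (simp add: Lp_int_def integrable_iff_bounded)
    then show "tempered G" by (intro tempered_Lp[of _ 1]) auto
    fix \<phi> assume \<phi>: "schwartz \<phi>"
    let ?\<psi> = "\<lambda>x. fourier \<phi> (- x)"
    have \<psi>: "integrable lborel ?\<psi>" by (intro lborel_integrable_shift fourier_schwartz_integrable \<phi>)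
    have "(LBINT x. h x * fourier \<phi> x) = (LBINT x. fourier G x * ?\<psi> x)"
      using lborel_integral_shift(2)[of "\<lambda>x. h x * fourier \<phi> x" 0] by (simp add: h_def)
    also have "\<dots> = (LBINT x. G x * fourier ?\<psi> x)"
      by (rule fourier_multiplication_formula[OF G \<psi>])
    also have "fourier ?\<psi> = \<phi>"
      by (simp add: fun_eq_iff fourier_reflect fourier_schwartz_inversion[OF \<phi>])
    finally show "(LBINT \<xi>. G \<xi> * \<phi> \<xi>) = (LBINT x. h x * fourier \<phi> x)" ..
  qed
  with b hm show ?thesis by blast
qed

section \<open>The characteristic equation\<close>

lemma exhaust_5:
  fixes x :: 5
  shows "x = 1 \<or> x = 2 \<or> x = 3 \<or> x = 4 \<or> x = 5"
proof (induct x)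
  case (of_int z)
  then have "0 \<le> z" and "z < 5" by simp_all
  then have "z = 0 \<or> z = 1 \<or> z = 2 \<or> z = 3 \<or> z = 4" by arith
  then show ?case by auto
qed

lemma UNIV_5: "(UNIV :: 5 set) = {1, 2, 3, 4, 5}"
  using exhaust_5 by auto

lemma sum_5: "sum f (UNIV :: 5 set) = f 1 + f 2 + f 3 + f 4 + f 5"
  unfolding UNIV_5 by (simp add: ac_simps)

lemma vector_5 [simp]:
  "(vector [a, b, c, d, e] :: 'a::zero^5) $ 1 = a" "(vector [a, b, c, d, e] :: 'a^5) $ 2 = b"
  "(vector [a, b, c, d, e] :: 'a^5) $ 3 = c" "(vector [a, b, c, d, e] :: 'a^5) $ 4 = d"
  "(vector [a, b, c, d, e] :: 'a^5) $ 5 = e"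
  by (simp_all add: vector_def)

text \<open>The first four rows express v1 + v3 and v2 + v4 through v5; inserted into the last row
  they give the equation times v5, which is cancelled if it is non-zero.\<close>

lemma arrow_matrix_characteristic_equation:
  fixes \<nu> k w1 w2 b1 b2 :: complex
  assumes v: "v1 \<noteq> 0 \<or> v2 \<noteq> 0 \<or> v3 \<noteq> 0 \<or> v4 \<noteq> 0 \<or> v5 \<noteq> 0"
    and e: "w1 * v1 + b1 * v5 = \<nu> * v1" "w2 * v2 + b2 * v5 = \<nu> * v2"
      "- w1 * v3 + b1 * v5 = \<nu> * v3" "- w2 * v4 + b2 * v5 = \<nu> * v4"
      "- b1 / 2 * v1 + - b2 / 2 * v2 + - b1 / 2 * v3 + - b2 / 2 * v4 + k * v5 = \<nu> * v5"
    and \<nu>: "\<nu> \<noteq> 0"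
  shows "(\<nu>\<^sup>2 - w1\<^sup>2) * (\<nu>\<^sup>2 - w2\<^sup>2) * (\<nu> - k) = - \<nu> * (b1\<^sup>2 * (\<nu>\<^sup>2 - w2\<^sup>2) + b2\<^sup>2 * (\<nu>\<^sup>2 - w1\<^sup>2))"
proof -
  have 1: "(\<nu> - w1) * v1 = b1 * v5" "(\<nu> - w2) * v2 = b2 * v5" "(\<nu> + w1) * v3 = b1 * v5" "(\<nu> + w2) * v4 = b2 * v5"
    using e by (simp_all add: left_diff_distrib distrib_right flip: e(1-4))
  show ?thesis
  proof (cases "v5 = 0")
    case False
    have s1: "(\<nu>\<^sup>2 - w1\<^sup>2) * (v1 + v3) = 2 * \<nu> * b1 * v5"
    proof -
      have "(\<nu>\<^sup>2 - w1\<^sup>2) * (v1 + v3) = (\<nu> + w1) * ((\<nu> - w1) * v1) + (\<nu> - w1) * ((\<nu> + w1) * v3)"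
        by (simp add: power2_eq_square algebra_simps)
      then show ?thesis unfolding 1 by (simp add: algebra_simps)
    qed
    have s2: "(\<nu>\<^sup>2 - w2\<^sup>2) * (v2 + v4) = 2 * \<nu> * b2 * v5"
    proof -
      have "(\<nu>\<^sup>2 - w2\<^sup>2) * (v2 + v4) = (\<nu> + w2) * ((\<nu> - w2) * v2) + (\<nu> - w2) * ((\<nu> + w2) * v4)"
        by (simp add: power2_eq_square algebra_simps)
      then show ?thesis unfolding 1 by (simp add: algebra_simps)
    qed
    have s5: "2 * (\<nu> - k) * v5 = - b1 * (v1 + v3) - b2 * (v2 + v4)"
    proof -
      have "2 * (\<nu> - k) * v5 = 2 * (\<nu> * v5) - 2 * k * v5" by (simp add: algebra_simps)
      also have "\<dots> = - b1 * (v1 + v3) - b2 * (v2 + v4)" unfolding e(5)[symmetric] by (simp add: algebra_simps)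
      finally show ?thesis .
    qed
    have "2 * ((\<nu>\<^sup>2 - w1\<^sup>2) * (\<nu>\<^sup>2 - w2\<^sup>2) * (\<nu> - k)) * v5 = (\<nu>\<^sup>2 - w1\<^sup>2) * (\<nu>\<^sup>2 - w2\<^sup>2) * (2 * (\<nu> - k) * v5)"
      by (simp add: algebra_simps)
    also have "\<dots> = - b1 * (\<nu>\<^sup>2 - w2\<^sup>2) * ((\<nu>\<^sup>2 - w1\<^sup>2) * (v1 + v3)) - b2 * (\<nu>\<^sup>2 - w1\<^sup>2) * ((\<nu>\<^sup>2 - w2\<^sup>2) * (v2 + v4))"
      unfolding s5 by (simp add: algebra_simps)
    also have "\<dots> = 2 * (- \<nu> * (b1\<^sup>2 * (\<nu>\<^sup>2 - w2\<^sup>2) + b2\<^sup>2 * (\<nu>\<^sup>2 - w1\<^sup>2))) * v5"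
      unfolding s1 s2 by (simp add: power2_eq_square algebra_simps)
    finally show ?thesis
      unfolding mult_right_cancel[OF False] by (rule mult_left_cancel[OF zero_neq_numeral[symmetric], THEN iffD1])
  next
    \<comment> \<open>With v5 = 0 the other entries are eigenvectors of the diagonal part. As \<nu>
      \<noteq> 0, it cannot equal both w and -w, so of v1, v3 and of v2, v4 at most one survives.
      The last row then kills the coupling of whichever sheet carries \<nu>, unless \<nu> lies on
      both, and both sides of the equation are 0.\<close>
    case True
    have 1: "(\<nu> - w1) * v1 = 0" "(\<nu> - w2) * v2 = 0" "(\<nu> + w1) * v3 = 0" "(\<nu> + w2) * v4 = 0"
      using 1 True by simp_all
    have 5: "b1 * (v1 + v3) + b2 * (v2 + v4) = 0"
    proof -
      have "b1 * (v1 + v3) + b2 * (v2 + v4) = - 2 * (- b1 / 2 * v1 + - b2 / 2 * v2 + - b1 / 2 * v3 + - b2 / 2 * v4)"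
        by (simp add: algebra_simps)
      then show ?thesis using e(5) True by simp
    qed
    have P: "\<nu>\<^sup>2 - w1\<^sup>2 = (\<nu> - w1) * (\<nu> + w1)" "\<nu>\<^sup>2 - w2\<^sup>2 = (\<nu> - w2) * (\<nu> + w2)"
      by (simp_all add: power2_eq_square algebra_simps)
    have z1: "v1 = 0 \<or> v3 = 0" "v2 = 0 \<or> v4 = 0" using 1 \<nu> by (auto simp: eq_neg_iff_add_eq_0)
    consider "\<nu>\<^sup>2 - w1\<^sup>2 = 0" "\<nu>\<^sup>2 - w2\<^sup>2 = 0" | "\<nu>\<^sup>2 - w1\<^sup>2 \<noteq> 0" | "\<nu>\<^sup>2 - w2\<^sup>2 \<noteq> 0" by blast
    then show ?thesis
    proof cases
      case 1 then show ?thesis by simp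
    next
      case 2
      then have "v1 = 0" "v3 = 0" using 1 by (auto simp: P)
      then have "\<nu>\<^sup>2 - w2\<^sup>2 = 0" "b2 = 0" using 1 5 v True z1 by (auto simp: P)
      then show ?thesis by simp
    next
      case 3
      then have "v2 = 0" "v4 = 0" using 1 by (auto simp: P)
      then have "\<nu>\<^sup>2 - w1\<^sup>2 = 0" "b1 = 0" using 1 5 v True z1 by (auto simp: P)
      then show ?thesis by simp
    qed
  qed
qed

text \<open>The imaginary unit in the couplings squares to the change of sign on the right. The
  equation is symmetric in the two sheets, hence available for either choice of
  \<open>j\<close>.\<close>

lemma B_matrix_characteristic_equation:
  fixes \<nu> :: complex
  assumes sp: "\<nu> \<in> spectrum (B_matrix \<kappa> \<gamma> vk r \<xi>)" and \<nu>: "\<nu> \<noteq> 0" and j: "j \<noteq> j'"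
  shows "(\<nu>\<^sup>2 - complex_of_real ((omega vk j \<xi>)\<^sup>2)) * (\<nu>\<^sup>2 - complex_of_real ((omega vk j' \<xi>)\<^sup>2)) * (\<nu> - \<i> * complex_of_real (\<kappa> * (norm \<xi>)\<^sup>2))
    = \<nu> * (complex_of_real ((\<gamma> * coupling r j \<xi>)\<^sup>2) * (\<nu>\<^sup>2 - complex_of_real ((omega vk j' \<xi>)\<^sup>2))
         + complex_of_real ((\<gamma> * coupling r j' \<xi>)\<^sup>2) * (\<nu>\<^sup>2 - complex_of_real ((omega vk j \<xi>)\<^sup>2)))"
proof -
  obtain v where v: "v \<noteq> 0" "B_matrix \<kappa> \<gamma> vk r \<xi> *v v = \<nu> *s v" using sp by (auto simp: spectrum_def)
  have row: "(\<Sum>i\<in>UNIV. B_matrix \<kappa> \<gamma> vk r \<xi> $ m $ i * v $ i) = \<nu> * v $ m" for m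
    using arg_cong[OF v(2), of "\<lambda>u. u $ m"] by (simp only: matrix_vector_mult_def vec_lambda_beta vector_smult_component)
  have nz: "v $ 1 \<noteq> 0 \<or> v $ 2 \<noteq> 0 \<or> v $ 3 \<noteq> 0 \<or> v $ 4 \<noteq> 0 \<or> v $ 5 \<noteq> 0"
  proof (rule ccontr)
    assume "\<not> ?thesis"
    then have "v $ i = 0" for i using exhaust_5[of i] by auto
    with v(1) show False by (simp add: vec_eq_iff)
  qed
  define w b where "w i = complex_of_real (omega vk i \<xi>)" and "b i = \<i> * complex_of_real (\<gamma> * coupling r i \<xi>)" for i
  note eqs = row[of 1] row[of 2] row[of 3] row[of 4] row[of 5]
  have "((\<nu>\<^sup>2 - (w 1)\<^sup>2) * (\<nu>\<^sup>2 - (w 2)\<^sup>2) * (\<nu> - \<i> * complex_of_real (\<kappa> * (norm \<xi>)\<^sup>2)) = - \<nu> * ((b 1)\<^sup>2 * (\<nu>\<^sup>2 - (w 2)\<^sup>2) + (b 2)\<^sup>2 * (\<nu>\<^sup>2 - (w 1)\<^sup>2)))"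
    by (rule arrow_matrix_characteristic_equation[OF nz _ _ _ _ _ \<nu>])
      (use eqs in \<open>simp_all add: sum_5 B_matrix_def Let_def w_def b_def\<close>)
  moreover have "(j = 1 \<and> j' = 2) \<or> (j = 2 \<and> j' = 1)" using j exhaust_2 by metis
  moreover have "(b i)\<^sup>2 = - complex_of_real ((\<gamma> * coupling r i \<xi>)\<^sup>2)" "(w i)\<^sup>2 = complex_of_real ((omega vk i \<xi>)\<^sup>2)" for i
    by (simp_all add: b_def w_def power_mult_distrib)
  ultimately show ?thesis by (elim disjE) (simp_all add: algebra_simps)
qed

text \<open>\<open>omega\<close> and \<open>coupling\<close> are homogeneous of degree 1, so with
  \<nu> = \<rho> z a factor \<rho>^5 cancels and only the damping term retains \<rho>. Dividing by z
  and by the factor of the other sheet isolates the sheet under study.\<close>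

lemma scaled_characteristic_equation:
  fixes z :: complex
  assumes sp: "complex_of_real \<rho> * z \<in> spectrum (B_matrix \<kappa> \<gamma> vk r (\<rho> *\<^sub>R \<eta>))" and \<rho>: "\<rho> > 0" and \<eta>: "norm \<eta> = 1"
    and j: "j \<noteq> j'" and vk: "0 \<le> vk j \<eta>" "0 \<le> vk j' \<eta>" and z: "z \<noteq> 0" "z\<^sup>2 \<noteq> complex_of_real (vk j' \<eta>)"
  shows "(z\<^sup>2 - complex_of_real (vk j \<eta>))
      * (1 - \<i> * complex_of_real (\<kappa> * \<rho>) / z - complex_of_real (\<gamma>\<^sup>2 * (r j' \<eta> \<bullet> \<eta>)\<^sup>2) / (z\<^sup>2 - complex_of_real (vk j' \<eta>)))
    = complex_of_real (\<gamma>\<^sup>2 * (r j \<eta> \<bullet> \<eta>)\<^sup>2)"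
proof -
  define P Q g h R where "P = z\<^sup>2 - complex_of_real (vk j \<eta>)" and "Q = z\<^sup>2 - complex_of_real (vk j' \<eta>)"
    and "g = complex_of_real (\<gamma>\<^sup>2 * (r j \<eta> \<bullet> \<eta>)\<^sup>2)" and "h = complex_of_real (\<gamma>\<^sup>2 * (r j' \<eta> \<bullet> \<eta>)\<^sup>2)"
    and "R = complex_of_real \<rho>"
  have R: "R \<noteq> 0" and Q: "Q \<noteq> 0" using \<rho> z by (auto simp: R_def Q_def)
  have dir: "(\<rho> *\<^sub>R \<eta>) /\<^sub>R norm (\<rho> *\<^sub>R \<eta>) = \<eta>" using \<rho> \<eta> by simp
  have om: "complex_of_real ((omega vk i (\<rho> *\<^sub>R \<eta>))\<^sup>2) = R\<^sup>2 * complex_of_real (vk i \<eta>)" if "0 \<le> vk i \<eta>" for i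
    unfolding omega_def dir using \<rho> \<eta> that by (simp add: R_def power_mult_distrib flip: of_real_power)
  have co: "complex_of_real ((\<gamma> * coupling r i (\<rho> *\<^sub>R \<eta>))\<^sup>2) = R\<^sup>2 * complex_of_real (\<gamma>\<^sup>2 * (r i \<eta> \<bullet> \<eta>)\<^sup>2)" for i
    unfolding coupling_def dir by (simp add: R_def power_mult_distrib)
  have "complex_of_real \<rho> * z \<noteq> 0" using z \<rho> by simp
  note E = B_matrix_characteristic_equation[OF sp this j]
  have e1: "(R * z)\<^sup>2 - R\<^sup>2 * complex_of_real (vk j \<eta>) = R\<^sup>2 * P"
    and e2: "(R * z)\<^sup>2 - R\<^sup>2 * complex_of_real (vk j' \<eta>) = R\<^sup>2 * Q"
    by (simp_all add: P_def Q_def power_mult_distrib algebra_simps)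
  have e3: "R * z - \<i> * complex_of_real (\<kappa> * (norm (\<rho> *\<^sub>R \<eta>))\<^sup>2) = R * (z - \<i> * complex_of_real (\<kappa> * \<rho>))"
    using \<rho> \<eta> by (simp add: R_def algebra_simps power2_eq_square)
  have "(R\<^sup>2 * P) * (R\<^sup>2 * Q) * (R * (z - \<i> * complex_of_real (\<kappa> * \<rho>))) = (R * z) * ((R\<^sup>2 * g) * (R\<^sup>2 * Q) + (R\<^sup>2 * h) * (R\<^sup>2 * P))"
    using E unfolding om[OF vk(1)] om[OF vk(2)] co R_def[symmetric] g_def[symmetric] h_def[symmetric] e1 e2 e3 .
  then have "(R ^ 5) * (P * Q * (z - \<i> * complex_of_real (\<kappa> * \<rho>))) = (R ^ 5) * (z * (g * Q + h * P))"
    by (simp add: distrib_left mult_ac eval_nat_numeral)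
  then have "P * Q * (z - \<i> * complex_of_real (\<kappa> * \<rho>)) = z * (g * Q + h * P)" using R by simp
  then have "P * (1 - \<i> * complex_of_real (\<kappa> * \<rho>) / z - h / Q) = g"
    using z(1) Q by (simp add: field_simps)
  then show ?thesis by (simp add: P_def Q_def g_def h_def)
qed

text \<open>
  The imaginary part of \<open>D\<close> contains \<open>Im (z\<^sup>2)\<close> again, but with a sign that allows to absorb it on the
  left-hand side.
\<close>

lemma spectral_imaginary_part:
  fixes z :: complex and G H k w w' :: real
  assumes eq: "(z\<^sup>2 - complex_of_real w) * (1 - \<i> * complex_of_real k / z - complex_of_real H / (z\<^sup>2 - complex_of_real w')) = complex_of_real G"
    and z: "Re z \<noteq> 0" and w': "z\<^sup>2 \<noteq> complex_of_real w'"
    and D: "D = 1 - \<i> * complex_of_real k / z - complex_of_real H / (z\<^sup>2 - complex_of_real w')" "D \<noteq> 0"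
  shows "2 * Im z * ((cmod D)\<^sup>2 + G * H / (cmod (z\<^sup>2 - complex_of_real w'))\<^sup>2) = G * k / (cmod z)\<^sup>2"
proof -
  define Q where "Q = z\<^sup>2 - complex_of_real w'"
  have nz: "cmod z \<noteq> 0" "cmod D \<noteq> 0" "cmod Q \<noteq> 0" using z w' D by (auto simp: Q_def)
  have ImW: "Im (z\<^sup>2) = 2 * Re z * Im z" by (simp add: power2_eq_square)
  have ImQ: "Im Q = 2 * Re z * Im z" using ImW by (simp add: Q_def)
  have "z\<^sup>2 - complex_of_real w = complex_of_real G / D" using eq D by (simp add: nonzero_eq_divide_eq)
  then have "Im (z\<^sup>2) = Im (complex_of_real G / D)" by (metis Im_complex_of_real minus_complex.sel(2) diff_zero)
  also have "\<dots> = - G * Im D / (cmod D)\<^sup>2" by (simp add: Im_divide cmod_power2)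
  finally have 1: "2 * Re z * Im z * (cmod D)\<^sup>2 = - G * Im D" using nz ImW by (simp add: field_simps)
  have "Im (\<i> * complex_of_real k / z) = k * Re z / (cmod z)\<^sup>2" by (simp add: Im_divide cmod_power2)
  moreover have "Im (complex_of_real H / Q) = - H * Im Q / (cmod Q)\<^sup>2" by (simp add: Im_divide cmod_power2)
  ultimately have 2: "Im D = - k * Re z / (cmod z)\<^sup>2 + H * (2 * Re z * Im z) / (cmod Q)\<^sup>2"
    unfolding D(1) Q_def[symmetric] by (simp add: ImQ)
  have "Re z * (2 * Im z * ((cmod D)\<^sup>2 + G * H / (cmod Q)\<^sup>2)) = 2 * Re z * Im z * (cmod D)\<^sup>2 + G * (H * (2 * Re z * Im z) / (cmod Q)\<^sup>2)"
    by (simp add: algebra_simps)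
  also have "\<dots> = Re z * (G * k / (cmod z)\<^sup>2)" unfolding 1 2 by (simp add: algebra_simps)
  finally show ?thesis using z unfolding Q_def by (metis mult_left_cancel)
qed

section \<open>Power series along the circle and orders of vanishing\<close>

lemma has_fps_expansion_real_sums:
  fixes f :: "real \<Rightarrow> real"
  assumes "e > 0" "\<And>t. \<bar>t\<bar> < e \<Longrightarrow> (\<lambda>n. t ^ n * c n) sums f t"
  shows "f has_fps_expansion Abs_fps c"
proof (rule has_fps_expansionI)
  have "eventually (\<lambda>t. t \<in> ball 0 e) (nhds (0::real))" using assms(1) by (intro eventually_nhds_in_open) auto
  then show "\<forall>\<^sub>F u in nhds 0. (\<lambda>n. fps_nth (Abs_fps c) n * u ^ n) sums f u"
    by eventually_elim (use assms(2) in \<open>auto simp: mult.commute\<close>)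
qed

lemma analytic_on_circle_fps:
  fixes f :: "real^2 \<Rightarrow> real"
  assumes "real_analytic_on_circle f" "\<eta> \<in> sphere 0 1"
  shows "\<exists>F. (\<lambda>t. f (circ_arc \<eta> t)) has_fps_expansion F"
proof -
  obtain c e where "e > 0" "\<And>t. \<bar>t\<bar> < e \<Longrightarrow> (\<lambda>n. t ^ n *\<^sub>R c n) sums f (circ_arc \<eta> t)"
    using assms unfolding real_analytic_on_circle_def by blast
  then show ?thesis using has_fps_expansion_real_sums[of e c "\<lambda>t. f (circ_arc \<eta> t)"] by auto
qed

lemma analytic_on_circle_component:
  fixes f :: "real^2 \<Rightarrow> real^2"
  assumes "real_analytic_on_circle f"
  shows "real_analytic_on_circle (\<lambda>\<eta>. f \<eta> $ i)"
  unfolding real_analytic_on_circle_def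
proof
  fix \<eta> :: "real^2" assume "\<eta> \<in> sphere 0 1"
  then obtain c e where ce: "e > 0" "\<And>t. \<bar>t\<bar> < e \<Longrightarrow> (\<lambda>n. t ^ n *\<^sub>R c n) sums f (circ_arc \<eta> t)"
    using assms unfolding real_analytic_on_circle_def by blast
  have "(\<lambda>n. t ^ n *\<^sub>R (c n $ i)) sums (f (circ_arc \<eta> t) $ i)" if "\<bar>t\<bar> < e" for t
    using bounded_linear.sums[OF bounded_linear_vec_nth ce(2)[OF that], of i] by simp
  then show "\<exists>c e. e > 0 \<and> (\<forall>t. \<bar>t\<bar> < e \<longrightarrow> (\<lambda>n. t ^ n *\<^sub>R c n) sums (f (circ_arc \<eta> t) $ i))"
    using ce(1) by (intro exI[of _ "\<lambda>n. c n $ i"] exI[of _ e]) blast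
qed

lemma norm_circ_arc: "norm \<eta> = 1 \<Longrightarrow> norm (circ_arc \<eta> t) = 1"
proof -
  assume "norm \<eta> = 1"
  then have n: "(\<eta>$1)\<^sup>2 + (\<eta>$2)\<^sup>2 = 1" using norm_2_sq[of \<eta>] by simp
  have "(norm (circ_arc \<eta> t))\<^sup>2 = ((cos t)\<^sup>2 + (sin t)\<^sup>2) * ((\<eta>$1)\<^sup>2 + (\<eta>$2)\<^sup>2)"
  proof -
    have "(c * a + s * (- b))\<^sup>2 + (c * b + s * a)\<^sup>2 = (c\<^sup>2 + s\<^sup>2) * (a\<^sup>2 + b\<^sup>2)" for c s a b :: real by algebra
    then show ?thesis unfolding norm_2_sq circ_arc_def by (simp only: vector_add_component vector_scaleR_component rot_nth real_scaleR_def)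
  qed
  then have "(norm (circ_arc \<eta> t))\<^sup>2 = 1" using n by simp
  then show ?thesis using power2_eq_1_iff norm_ge_zero by (metis neg_0_le_iff_le not_one_le_zero)
qed

lemma circ_arc_0[simp]: "circ_arc \<eta> 0 = \<eta>" by (simp add: circ_arc_def)

lemma coupling_circ_arc:
  "norm \<eta> = 1 \<Longrightarrow> coupling r j (circ_arc \<eta> t) = r j (circ_arc \<eta> t) \<bullet> circ_arc \<eta> t"
  by (simp add: coupling_def norm_circ_arc)

lemma coupling_fps:
  assumes "real_analytic_on_circle (r j)" "\<eta> \<in> sphere 0 1"
  shows "\<exists>F. (\<lambda>t. coupling r j (circ_arc \<eta> t)) has_fps_expansion F"
proof -
  obtain F1 where 1: "(\<lambda>t. r j (circ_arc \<eta> t) $ 1) has_fps_expansion F1"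
    using analytic_on_circle_fps[OF analytic_on_circle_component[OF assms(1)] assms(2)] by blast
  obtain F2 where 2: "(\<lambda>t. r j (circ_arc \<eta> t) $ 2) has_fps_expansion F2"
    using analytic_on_circle_fps[OF analytic_on_circle_component[OF assms(1)] assms(2)] by blast
  have c: "(\<lambda>t. circ_arc \<eta> t $ i) has_fps_expansion (fps_cos 1 * fps_const (\<eta> $ i) + fps_sin 1 * fps_const (rot \<eta> $ i))" for i
    unfolding circ_arc_def by (auto intro!: fps_expansion_intros)
  have "(\<lambda>t. coupling r j (circ_arc \<eta> t)) = (\<lambda>t. r j (circ_arc \<eta> t) $ 1 * circ_arc \<eta> t $ 1 + r j (circ_arc \<eta> t) $ 2 * circ_arc \<eta> t $ 2)"
    using assms(2) by (simp add: coupling_circ_arc inner_2)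
  then show ?thesis using has_fps_expansion_add[OF has_fps_expansion_mult[OF 1 c] has_fps_expansion_mult[OF 2 c]] by auto
qed

lemma has_fps_expansion_at_0: "f has_fps_expansion F \<Longrightarrow> f 0 = fps_nth F 0"
  using eventually_nhds_x_imp_x[of "\<lambda>z. eval_fps F z = f z" 0] by (simp add: has_fps_expansion_def eval_fps_at_0)

lemma has_fps_expansion_higher_deriv:
  fixes f :: "real \<Rightarrow> real"
  assumes "f has_fps_expansion F"
  shows "(deriv ^^ n) f 0 = fact n * fps_nth F n"
proof -
  have "(deriv ^^ n) f has_fps_expansion (fps_deriv ^^ n) F"
    by (induction n) (auto intro!: has_fps_expansion_deriv assms)
  then have "(deriv ^^ n) f 0 = fps_nth ((fps_deriv ^^ n) F) 0"
    by (simp add: has_fps_expansion_at_0)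
  then show ?thesis by (simp add: fps_0th_higher_deriv)
qed

text \<open>The order is the subdegree of the power series; after dividing by t^l the quotient is
  continuous with a non-zero value at 0, hence at least half of that value nearby.\<close>

lemma vanishing_order_lower_bound:
  assumes f: "f has_fps_expansion F" and o: "vanishing_order f = enat l"
  shows "\<exists>c>0. \<exists>\<delta>>0. \<forall>t. \<bar>t\<bar> < \<delta> \<longrightarrow> c * \<bar>t\<bar> ^ l \<le> \<bar>f t\<bar>"
proof -
  let ?S = "{n. (deriv ^^ n) f 0 \<noteq> 0}"
  have inf: "Inf (enat ` ?S) = enat l" using o by (simp add: vanishing_order_def)
  then have ne: "enat ` ?S \<noteq> {}" by (metis Inf_enat_def enat.distinct(1) infinity_enat_def)
  have "Inf (enat ` ?S) \<in> enat ` ?S"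
    using ne unfolding Inf_enat_def by (simp del: image_is_empty) (metis LeastI_ex ex_in_conv)
  then have l: "l \<in> ?S" using inf by auto
  have lt: "n \<notin> ?S" if "n < l" for n
  proof
    assume "n \<in> ?S"
    then have "Inf (enat ` ?S) \<le> enat n" by (intro Inf_lower) auto
    with inf that show False by simp
  qed
  have F: "fps_nth F l \<noteq> 0" "\<And>n. n < l \<Longrightarrow> fps_nth F n = 0"
    using l lt by (auto simp: has_fps_expansion_higher_deriv[OF f])
  then have sd: "subdegree F = l" by (intro subdegreeI) auto
  define v where "v t = (if t = 0 then fps_nth F l else f t / t ^ l)" for t
  have "v has_fps_expansion fps_shift l F"
    unfolding v_def using sd by (intro has_fps_expansion_shift f) auto
  then have "isCont v 0" using has_fps_expansion_imp_continuous[of v _ UNIV] by simp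
  moreover have "\<bar>fps_nth F l\<bar> / 2 > 0" using F by simp
  ultimately obtain \<delta> where \<delta>: "\<delta> > 0" "\<And>t. \<bar>t\<bar> < \<delta> \<Longrightarrow> \<bar>v t - v 0\<bar> < \<bar>fps_nth F l\<bar> / 2"
    unfolding continuous_at_eps_delta dist_real_def by (metis diff_zero)
  have "\<bar>fps_nth F l\<bar> / 2 * \<bar>t\<bar> ^ l \<le> \<bar>f t\<bar>" if t: "\<bar>t\<bar> < \<delta>" "t \<noteq> 0" for t
  proof -
    have "\<bar>fps_nth F l\<bar> / 2 \<le> \<bar>v t\<bar>" 
    proof -
      have "v 0 = fps_nth F l" by (simp add: v_def)
      moreover have "\<bar>v 0\<bar> \<le> \<bar>v t\<bar> + \<bar>v t - v 0\<bar>" by linarith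
      ultimately show ?thesis using \<delta>(2)[OF t(1)] by linarith
    qed
    then have "\<bar>fps_nth F l\<bar> / 2 * \<bar>t\<bar> ^ l \<le> \<bar>v t\<bar> * \<bar>t\<bar> ^ l" by (intro mult_right_mono) auto
    also have "\<dots> = \<bar>f t\<bar>" using t by (simp add: v_def power_abs abs_mult[symmetric])
    finally show ?thesis .
  qed
  \<comment> \<open>At \<open>t = 0\<close> the quotient \<open>v\<close> was assigned its limit, so
    the claim is checked directly; for \<open>l = 0\<close> the power \<open>0 ^ 0\<close> is
    1.\<close>
  moreover have "\<bar>fps_nth F l\<bar> / 2 * \<bar>0\<bar> ^ l \<le> \<bar>f 0\<bar>"
  proof (cases "l = 0")
    case True
    then show ?thesis using has_fps_expansion_at_0[OF f] by simp
  qed (simp add: power_0_left)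
  ultimately show ?thesis using \<delta>(1) F(1) by (intro exI[of _ "\<bar>fps_nth F l\<bar> / 2"] conjI exI[of _ \<delta>]) (auto, metis abs_zero)
qed

section \<open>Dissipation of the hyperbolic eigenvalues\<close>

text \<open>Orthonormality passes from the rows of a 2 by 2 matrix to its columns. This yields
  Parseval's identity and the spectral decomposition in \<open>eigensystem_facts\<close>.\<close>

lemma orthonormal_2_dual:
  fixes a b c d :: "'a::idom"
  assumes "a * a + b * b = 1" "c * c + d * d = 1" "a * c + b * d = 0"
  shows "a * a + c * c = 1" "b * b + d * d = 1" "a * b + c * d = 0"
  using assms by algebra+

text \<open>The entries of \<open>A \<eta>\<close> are recovered from the orthonormal eigenvectors,
  which gives the trace. If both eigenvalues agreed, the matrix would be scalar with a single point
  in its spectrum, against the cardinality 2.\<close>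

lemma eigensystem_facts:
  assumes eig: "eigensystem A vk r" and \<eta>: "\<eta> \<in> sphere 0 1"
    and pos: "positive_definite (A \<eta>)" and card: "card (spectrum (A \<eta>)) = 2"
  shows "vk j \<eta> > 0" "vk 1 \<eta> \<noteq> vk 2 \<eta>" "trace (A \<eta>) = complex_of_real (vk 1 \<eta> + vk 2 \<eta>)"
    "(r 1 \<eta> \<bullet> v)\<^sup>2 + (r 2 \<eta> \<bullet> v)\<^sup>2 = (norm v)\<^sup>2"
proof -
  define u where "u j = (\<chi> i. complex_of_real (r j \<eta> $ i))" for j
  have ev: "A \<eta> *v u j = complex_of_real (vk j \<eta>) *s u j" and n: "norm (r j \<eta>) = 1" for j
    using eig \<eta> unfolding eigensystem_def u_def by auto
  have o: "r 1 \<eta> \<bullet> r 2 \<eta> = 0" using eig \<eta> unfolding eigensystem_def by auto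
  have rn: "r j \<eta> $ 1 * r j \<eta> $ 1 + r j \<eta> $ 2 * r j \<eta> $ 2 = 1" for j
    using norm_2_sq[of "r j \<eta>"] n[of j] by (simp add: power2_eq_square)
  have ro: "r 1 \<eta> $ 1 * r 2 \<eta> $ 1 + r 1 \<eta> $ 2 * r 2 \<eta> $ 2 = 0" using o by (simp add: inner_2)
  note dual = orthonormal_2_dual[OF rn[of 1] rn[of 2] ro]
  show "vk j \<eta> > 0"
  proof -
    have "u j \<noteq> 0"
    proof
      assume "u j = 0"
      then have "r j \<eta> $ i = 0" for i by (simp add: u_def vec_eq_iff)
      then show False using rn[of j] by simp
    qed
    then have "0 < u j \<bullet> (A \<eta> *v u j)" using pos by (simp add: positive_definite_def)
    also have "\<dots> = vk j \<eta> * (r j \<eta> $ 1 * r j \<eta> $ 1 + r j \<eta> $ 2 * r j \<eta> $ 2)"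
      unfolding ev by (simp add: inner_vec_def sum_2 u_def inner_complex_def algebra_simps)
    finally show ?thesis by (simp add: rn)
  qed
  define a b c d where "a = complex_of_real (r 1 \<eta> $ 1)" and "b = complex_of_real (r 1 \<eta> $ 2)"
    and "c = complex_of_real (r 2 \<eta> $ 1)" and "d = complex_of_real (r 2 \<eta> $ 2)"
  define k1 k2 where "k1 = complex_of_real (vk 1 \<eta>)" and "k2 = complex_of_real (vk 2 \<eta>)"
  have cd: "a * a + c * c = 1" "b * b + d * d = 1" "a * b + c * d = 0"
    unfolding a_def b_def c_def d_def using dual by (simp_all flip: of_real_mult of_real_add)
  define M where "M = A \<eta>"
  have e: "(\<Sum>i\<in>UNIV. M $ m $ i * u j $ i) = complex_of_real (vk j \<eta>) * u j $ m" for m j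
    using arg_cong[OF ev[of j], of "\<lambda>v. v $ m"] by (simp only: M_def matrix_vector_mult_def vec_lambda_beta vector_smult_component)
  have e1: "M $ 1 $ 1 * a + M $ 1 $ 2 * b = k1 * a" "M $ 2 $ 1 * a + M $ 2 $ 2 * b = k1 * b"
    "M $ 1 $ 1 * c + M $ 1 $ 2 * d = k2 * c" "M $ 2 $ 1 * c + M $ 2 $ 2 * d = k2 * d"
    using e[of 1 1] e[of 2 1] e[of 1 2] e[of 2 2] by (simp_all add: sum_2 u_def a_def b_def c_def d_def k1_def k2_def)
  have M: "M $ 1 $ 1 = k1 * (a * a) + k2 * (c * c)" "M $ 1 $ 2 = k1 * (a * b) + k2 * (c * d)"
    "M $ 2 $ 1 = k1 * (a * b) + k2 * (c * d)" "M $ 2 $ 2 = k1 * (b * b) + k2 * (d * d)"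
    using e1 cd by algebra+
  have "M $ 1 $ 1 + M $ 2 $ 2 = k1 * (a * a + b * b) + k2 * (c * c + d * d)" unfolding M by (simp add: algebra_simps)
  also have "\<dots> = k1 + k2"
    using rn[of 1] rn[of 2] by (simp add: a_def b_def c_def d_def flip: of_real_mult of_real_add)
  finally show "trace (A \<eta>) = complex_of_real (vk 1 \<eta> + vk 2 \<eta>)"
    by (simp add: trace_def sum_2 M_def k1_def k2_def)
  show "vk 1 \<eta> \<noteq> vk 2 \<eta>"
  proof
    assume "vk 1 \<eta> = vk 2 \<eta>"
    then have k: "k2 = k1" by (simp add: k1_def k2_def)
    have M': "M $ 1 $ 1 = k1" "M $ 1 $ 2 = 0" "M $ 2 $ 1 = 0" "M $ 2 $ 2 = k1"
      using M cd unfolding k by (simp_all flip: distrib_left)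
    have Mv: "M *v v = k1 *s v" for v
      by (simp add: vec2_eq_iff matrix_vector_mult_def sum_2 M')
    have "spectrum M \<subseteq> {k1}"
    proof
      fix z assume "z \<in> spectrum M"
      then obtain v where "v \<noteq> 0" "M *v v = z *s v" by (auto simp: spectrum_def)
      then have "k1 * v $ i = z * v $ i" for i using Mv[of v] by (metis vector_smult_component)
      moreover obtain i where "v $ i \<noteq> 0" using \<open>v \<noteq> 0\<close> by (auto simp: vec_eq_iff)
      ultimately show "z \<in> {k1}" by (metis mult_right_cancel singletonI)
    qed
    then have "card (spectrum M) \<le> card {k1}" by (intro card_mono) auto
    then show False using card by (simp add: M_def)
  qed
  have "(r 1 \<eta> \<bullet> v)\<^sup>2 + (r 2 \<eta> \<bullet> v)\<^sup>2
      = (r 1 \<eta> $ 1 * r 1 \<eta> $ 1 + r 2 \<eta> $ 1 * r 2 \<eta> $ 1) * (v $ 1)\<^sup>2 + (r 1 \<eta> $ 2 * r 1 \<eta> $ 2 + r 2 \<eta> $ 2 * r 2 \<eta> $ 2) * (v $ 2)\<^sup>2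
        + 2 * (r 1 \<eta> $ 1 * r 1 \<eta> $ 2 + r 2 \<eta> $ 1 * r 2 \<eta> $ 2) * (v $ 1 * v $ 2)"
    by (simp add: inner_2 power2_eq_square algebra_simps)
  then show "(r 1 \<eta> \<bullet> v)\<^sup>2 + (r 2 \<eta> \<bullet> v)\<^sup>2 = (norm v)\<^sup>2" by (simp add: dual norm_2_sq)
qed

text \<open>At \<nu> = \<omega>_j the characteristic equation reduces to the term with the coupling
  of sheet \<open>j\<close>, multiplied by the non-zero difference of the two eigenvalues of
  \<open>A \<eta>\<close>.\<close>

lemma hyperbolic_coupling_eq_0:
  assumes \<gamma>: "\<gamma> \<noteq> 0" and hyp: "hyperbolic_wrt \<kappa> \<gamma> vk r j \<eta>" and j: "j \<noteq> j'"
    and pos: "vk j \<eta> > 0" "vk j' \<eta> > 0" and ne: "vk j \<eta> \<noteq> vk j' \<eta>"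
  shows "r j \<eta> \<bullet> \<eta> = 0"
proof -
  have \<eta>: "norm \<eta> = 1" using hyp by (auto simp: hyperbolic_wrt_def hyperbolic_def)
  define w where "w = sqrt (vk j \<eta>)"
  have w: "w > 0" using pos by (simp add: w_def)
  have om: "omega vk i \<eta> = sqrt (vk i \<eta>)" for i using \<eta> by (simp add: omega_def)
  have sp: "complex_of_real w \<in> spectrum (B_matrix \<kappa> \<gamma> vk r \<eta>)"
    using hyp[unfolded hyperbolic_wrt_def, THEN conjunct2, rule_format, of 1] by (simp add: om w_def)
  have sq: "(omega vk j \<eta>)\<^sup>2 = vk j \<eta>" "(omega vk j' \<eta>)\<^sup>2 = vk j' \<eta>" "(complex_of_real w)\<^sup>2 = complex_of_real (vk j \<eta>)"
    using pos by (simp_all add: om w_def flip: of_real_power)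
  from B_matrix_characteristic_equation[OF sp _ j] w
  have "complex_of_real w * (complex_of_real ((\<gamma> * coupling r j \<eta>)\<^sup>2) * (complex_of_real (vk j \<eta>) - complex_of_real (vk j' \<eta>))) = 0"
    unfolding sq by simp
  then have "\<gamma> * coupling r j \<eta> = 0" using w ne by auto
  then show ?thesis using \<gamma> \<eta> by (simp add: coupling_def)
qed

text \<open>The main term has modulus at least the mean of |D0| and |x|. The admissible error may
  therefore grow with \<open>x\<close>, which makes the bound usable uniformly in the
  frequency.\<close>

lemma norm_real_plus_imaginary_ge:
  fixes D0 x :: real and e :: complex
  assumes "cmod e \<le> \<bar>D0\<bar> / 4 + \<bar>x\<bar> / 4"
  shows "\<bar>D0\<bar> / 4 \<le> cmod (complex_of_real D0 - \<i> * complex_of_real x + e)"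
proof -
  let ?m = "complex_of_real D0 - \<i> * complex_of_real x"
  have "\<bar>D0\<bar> \<le> cmod ?m" "\<bar>x\<bar> \<le> cmod ?m"
    using abs_Re_le_cmod[of ?m] abs_Im_le_cmod[of ?m] by simp_all
  moreover have "cmod ?m - cmod e \<le> cmod (?m + e)" by (rule norm_diff_ineq)
  ultimately show ?thesis using assms by linarith
qed

text \<open>The order of the quantifiers is the point: \<open>\<delta>\<close> and \<open>c\<close>
  precede \<open>\<rho>\<close>. The branch \<open>\<nu>\<close> is known only through continuity
  and its values on the ray of \<open>\<eta>\<close>, so its position nearby has to be established
  together with the bound on D.\<close>

lemma hyperbolic_eigenvalue_dissipation:
  fixes \<kappa> \<gamma> s :: real and j j' :: 2
  assumes kappa: "\<kappa> > 0" and gamma: "\<gamma> \<noteq> 0" and j: "j \<noteq> j'" and \<eta>: "norm \<eta> = 1"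
    and pos: "\<And>\<zeta>. norm \<zeta> = 1 \<Longrightarrow> 0 < vk j \<zeta> \<and> 0 < vk j' \<zeta>" and ne: "vk j \<eta> \<noteq> vk j' \<eta>"
    and A4: "\<gamma>\<^sup>2 \<noteq> vk j \<eta> - vk j' \<eta>" and b0: "(r j' \<eta> \<bullet> \<eta>)\<^sup>2 = 1" and a0: "r j \<eta> \<bullet> \<eta> = 0"
    and ab: "\<And>\<zeta>. norm \<zeta> = 1 \<Longrightarrow> (r j \<zeta> \<bullet> \<zeta>)\<^sup>2 \<le> 1 \<and> (r j' \<zeta> \<bullet> \<zeta>)\<^sup>2 \<le> 1"
    and cont: "isCont (\<lambda>t. vk j (circ_arc \<eta> t)) 0" "isCont (\<lambda>t. vk j' (circ_arc \<eta> t)) 0"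
      "isCont (\<lambda>t. r j (circ_arc \<eta> t) \<bullet> circ_arc \<eta> t) 0" "isCont (\<lambda>t. r j' (circ_arc \<eta> t) \<bullet> circ_arc \<eta> t) 0"
    and s: "s = 1 \<or> s = -1" and nu: "hyperbolic_eigenvalue \<kappa> \<gamma> vk r j \<eta> s \<Gamma> \<nu>"
  shows "\<exists>\<delta>>0. \<exists>c>0. \<forall>t \<rho>. \<bar>t\<bar> < \<delta> \<and> 0 < \<rho> \<longrightarrow> \<rho> *\<^sub>R circ_arc \<eta> t \<in> \<Gamma> \<and>
     c * (\<rho> / (1 + \<rho>))\<^sup>2 * (r j (circ_arc \<eta> t) \<bullet> circ_arc \<eta> t)\<^sup>2 \<le> Im (\<nu> (\<rho> *\<^sub>R circ_arc \<eta> t))"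
proof -
  define arc where "arc = circ_arc \<eta>"
  define w w' a b where "w t = sqrt (vk j (arc t))" and "w' t = vk j' (arc t)"
    and "a t = r j (arc t) \<bullet> arc t" and "b t = r j' (arc t) \<bullet> arc t" for t
  \<comment> \<open>\<open>\<Omega>\<close> and \<open>D0\<close> are the limits at the hyperbolic
    direction of z^2 - \<open>w'\<close> and of the real part of D, using b^2 = 1 there. Separation
    of the sheets and (A4) make them non-zero.\<close>
  define w0 \<Omega> D0 where "w0 = w 0" and "\<Omega> = vk j \<eta> - vk j' \<eta>" and "D0 = 1 - \<gamma>\<^sup>2 / (vk j \<eta> - vk j' \<eta>)"
  have arc0: "arc 0 = \<eta>" by (simp add: arc_def)
  have arc1: "norm (arc t) = 1" for t using norm_circ_arc[OF \<eta>] by (simp add: arc_def)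
  have w0: "w0 > 0" "w0\<^sup>2 = vk j \<eta>" using pos[OF \<eta>] by (simp_all add: w0_def w_def arc0)
  have w2: "(w t)\<^sup>2 = vk j (arc t)" for t using pos[OF arc1[of t]] by (simp add: w_def)
  have \<Omega>: "\<Omega> \<noteq> 0" and D0: "D0 \<noteq> 0" using ne A4 by (simp_all add: \<Omega>_def D0_def)
  have lim: "(w \<longlongrightarrow> w0) (nhds 0)" "(w' \<longlongrightarrow> vk j' \<eta>) (nhds 0)" "(a \<longlongrightarrow> 0) (nhds 0)" "(b \<longlongrightarrow> b 0) (nhds 0)"
  proof -
    have n: "(f \<longlongrightarrow> f 0) (nhds 0)" if "isCont f 0" for f :: "real \<Rightarrow> real"
      using that by (simp add: isCont_def tendsto_at_iff_tendsto_nhds)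
    show "(w \<longlongrightarrow> w0) (nhds 0)"
      unfolding w_def[abs_def] w0_def arc_def using n[OF cont(1)] by (intro tendsto_real_sqrt) simp
    show "(w' \<longlongrightarrow> vk j' \<eta>) (nhds 0)" unfolding w'_def[abs_def] arc_def using n[OF cont(2)] by simp
    show "(a \<longlongrightarrow> 0) (nhds 0)" unfolding a_def[abs_def] arc_def using n[OF cont(3)] a0 by simp
    show "(b \<longlongrightarrow> b 0) (nhds 0)" unfolding b_def[abs_def] arc_def using n[OF cont(4)] by simp
  qed
  have conic: "open \<Gamma>" "\<eta> \<in> \<Gamma>" "\<And>\<xi> \<rho>. \<xi> \<in> \<Gamma> \<Longrightarrow> \<rho> > 0 \<Longrightarrow> \<rho> *\<^sub>R \<xi> \<in> \<Gamma>" and cnu: "continuous_on \<Gamma> \<nu>"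
    and sp: "\<And>\<xi>. \<xi> \<in> \<Gamma> \<Longrightarrow> \<nu> \<xi> \<in> spectrum (B_matrix \<kappa> \<gamma> vk r \<xi>)"
    and nu0: "\<And>\<rho>. \<rho> > 0 \<Longrightarrow> \<nu> (\<rho> *\<^sub>R \<eta>) = complex_of_real (s * omega vk j (\<rho> *\<^sub>R \<eta>))"
    using nu unfolding hyperbolic_eigenvalue_def conical_nbhd_def by auto
  have carc: "continuous_on UNIV arc"
    unfolding arc_def circ_arc_def by (intro continuous_intros)
  let ?S = "complex_of_real (s * w0)"
  have S2: "?S\<^sup>2 = complex_of_real (vk j \<eta>)" using s w0 by (auto simp flip: of_real_power)
  \<comment> \<open>Here z and t vary independently: the neighbourhoods are fixed before \<rho>
    enters, which is possible as neither expression contains \<rho>.\<close>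
  let ?F = "nhds ?S \<times>\<^sub>F nhds (0::real)"
  have f1: "((\<lambda>p. fst p) \<longlongrightarrow> ?S) ?F" by (rule filterlim_fst)
  have f2: "filterlim (\<lambda>p. snd p) (nhds 0) ?F" by (rule filterlim_snd)
  have Q: "((\<lambda>p. (fst p)\<^sup>2 - complex_of_real (w' (snd p))) \<longlongrightarrow> complex_of_real \<Omega>) ?F"
    unfolding \<Omega>_def of_real_diff S2[symmetric]
    by (intro tendsto_intros f1 filterlim_compose[OF lim(2) f2])
  have G: "((\<lambda>p. complex_of_real (\<gamma>\<^sup>2 * (b (snd p))\<^sup>2) / ((fst p)\<^sup>2 - complex_of_real (w' (snd p)))) \<longlongrightarrow> complex_of_real (\<gamma>\<^sup>2 * (b 0)\<^sup>2) / complex_of_real \<Omega>) ?F"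
    using \<Omega> by (intro tendsto_intros Q filterlim_compose[OF lim(4) f2]) auto
  have b02: "(b 0)\<^sup>2 = 1" using b0 by (simp add: b_def arc0)
  have "eventually (\<lambda>p. dist ((fst p)\<^sup>2 - complex_of_real (w' (snd p))) (complex_of_real \<Omega>) < \<bar>\<Omega>\<bar> / 2 \<and>
      dist (complex_of_real (\<gamma>\<^sup>2 * (b (snd p))\<^sup>2) / ((fst p)\<^sup>2 - complex_of_real (w' (snd p)))) (complex_of_real (\<gamma>\<^sup>2 * (b 0)\<^sup>2) / complex_of_real \<Omega>) < \<bar>D0\<bar> / 4) ?F"
    using \<Omega> D0 by (intro eventually_conj tendstoD[OF Q] tendstoD[OF G]) auto
  then obtain P1 P2 where P: "eventually P1 (nhds ?S)" "eventually P2 (nhds (0::real))"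
    "\<And>z t. P1 z \<Longrightarrow> P2 t \<Longrightarrow> dist (z\<^sup>2 - complex_of_real (w' t)) (complex_of_real \<Omega>) < \<bar>\<Omega>\<bar> / 2 \<and>
      dist (complex_of_real (\<gamma>\<^sup>2 * (b t)\<^sup>2) / (z\<^sup>2 - complex_of_real (w' t))) (complex_of_real (\<gamma>\<^sup>2 * (b 0)\<^sup>2) / complex_of_real \<Omega>) < \<bar>D0\<bar> / 4"
    unfolding eventually_prod_filter by auto
  obtain e0 where e0: "e0 > 0" "\<And>z. dist z ?S < e0 \<Longrightarrow> P1 z"
    using P(1) unfolding eventually_nhds_metric by blast
  \<comment> \<open>Half of \<open>e0\<close> keeps the closed disc inside the neighbourhood. The
    bound \<open>w0 / 5\<close> gives |z| \<ge> 4/5 \<open>w0\<close>, hence |1/\<open>?S\<close> -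
    1/z| \<le> 1/(4 \<open>w0\<close>).\<close>
  define e where "e = min (e0 / 2) (w0 / 5)"
  have e: "e > 0" "e < e0" "e \<le> w0 / 5" using e0 w0 by (auto simp: e_def)
  \<comment> \<open>The two summands will bound the distances from z to the sheet value at angle t
    and from there to \<open>?S\<close>.\<close>
  have lim_g: "((\<lambda>t. 4 * (\<gamma>\<^sup>2 * (a t)\<^sup>2) / (\<bar>D0\<bar> * w0) + \<bar>w t - w0\<bar>) \<longlongrightarrow> 4 * (\<gamma>\<^sup>2 * 0\<^sup>2) / (\<bar>D0\<bar> * w0) + \<bar>w0 - w0\<bar>) (nhds 0)"
    using D0 w0 by (intro tendsto_intros lim) auto
  have "eventually (\<lambda>t. arc t \<in> \<Gamma>) (nhds 0)"
  proof -
    have "(arc \<longlongrightarrow> arc 0) (nhds 0)"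
      using carc by (simp add: continuous_on_eq_continuous_at isCont_def tendsto_at_iff_tendsto_nhds)
    from topological_tendstoD[OF this conic(1)] show ?thesis using conic(2) arc0 by simp
  qed
  moreover have "eventually (\<lambda>t. 4 * (\<gamma>\<^sup>2 * (a t)\<^sup>2) / (\<bar>D0\<bar> * w0) + \<bar>w t - w0\<bar> < e / 2) (nhds 0)"
    using order_tendstoD(2)[OF lim_g, of "e / 2"] e by simp
  ultimately have "eventually (\<lambda>t. P2 t \<and> arc t \<in> \<Gamma> \<and> 4 * (\<gamma>\<^sup>2 * (a t)\<^sup>2) / (\<bar>D0\<bar> * w0) + \<bar>w t - w0\<bar> < e / 2) (nhds 0)"
    using P(2) by eventually_elim auto
  then obtain \<delta> where \<delta>: "\<delta> > 0" "\<And>t. \<bar>t\<bar> < \<delta> \<Longrightarrow> P2 t"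
    "\<And>t. \<bar>t\<bar> < \<delta> \<Longrightarrow> arc t \<in> \<Gamma>" "\<And>t. \<bar>t\<bar> < \<delta> \<Longrightarrow> 4 * (\<gamma>\<^sup>2 * (a t)\<^sup>2) / (\<bar>D0\<bar> * w0) + \<bar>w t - w0\<bar> < e / 2"
    unfolding eventually_nhds_metric by (auto simp: dist_real_def)
  define z where "z \<rho> t = \<nu> (\<rho> *\<^sub>R arc t) / complex_of_real \<rho>" for \<rho> t
  define Dn where "Dn \<rho> t = 1 - \<i> * complex_of_real (\<kappa> * \<rho>) / z \<rho> t - complex_of_real (\<gamma>\<^sup>2 * (b t)\<^sup>2) / ((z \<rho> t)\<^sup>2 - complex_of_real (w' t))" for \<rho> t
  \<comment> \<open>All of this is conditional on z lying within \<open>e\<close> of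
    \<open>?S\<close>; the last conjunct improves the assumption to \<open>e / 2\<close>.\<close>
  have local_bounds: "z \<rho> t \<noteq> 0 \<and> 4 / 5 * w0 \<le> cmod (z \<rho> t) \<and> cmod (z \<rho> t) \<le> 2 * w0 \<and> Re (z \<rho> t) \<noteq> 0 \<and>
      \<bar>\<Omega>\<bar> / 2 \<le> cmod ((z \<rho> t)\<^sup>2 - complex_of_real (w' t)) \<and> \<bar>D0\<bar> / 4 \<le> cmod (Dn \<rho> t) \<and>
      cmod (Dn \<rho> t) \<le> (1 + \<gamma>\<^sup>2 / \<bar>\<Omega>\<bar> + \<bar>D0\<bar>) + \<kappa> * \<rho> / (4 / 5 * w0) \<and>
      ((z \<rho> t)\<^sup>2 - complex_of_real (vk j (arc t))) * Dn \<rho> t = complex_of_real (\<gamma>\<^sup>2 * (a t)\<^sup>2) \<and>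
      cmod (z \<rho> t - ?S) < e / 2"
    if t: "\<bar>t\<bar> < \<delta>" and \<rho>: "\<rho> > 0" and near: "cmod (z \<rho> t - ?S) \<le> e" for t \<rho>
  proof -
    let ?z = "z \<rho> t"
    have S: "cmod ?S = w0" using s w0 by auto
    have n1: "w0 - e \<le> cmod ?z" "cmod ?z \<le> w0 + e"
      using near S norm_triangle_ineq3[of ?z ?S] by (auto simp: abs_le_iff)
    have zb: "4 / 5 * w0 \<le> cmod ?z" "cmod ?z \<le> 2 * w0" using n1 e w0 by auto
    then have z0: "?z \<noteq> 0" using w0 by auto
    have "\<bar>Re ?z - s * w0\<bar> \<le> w0 / 5" using abs_Re_le_cmod[of "?z - ?S"] near e by simp
    then have Re0: "Re ?z \<noteq> 0" using s w0 by (auto simp: abs_le_iff)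
    have "dist ?z ?S < e0" using near e by (simp add: dist_norm)
    note PP = P(3)[OF e0(2)[OF this] \<delta>(2)[OF t]]
    have Qb: "\<bar>\<Omega>\<bar> / 2 \<le> cmod (?z\<^sup>2 - complex_of_real (w' t))"
      using PP norm_triangle_ineq3[of "?z\<^sup>2 - complex_of_real (w' t)" "complex_of_real \<Omega>"] by (auto simp: dist_norm abs_le_iff)
    then have Q0: "?z\<^sup>2 \<noteq> complex_of_real (vk j' (arc t))" using \<Omega> by (auto simp: w'_def)
    define E where "E = complex_of_real (\<gamma>\<^sup>2 * (b t)\<^sup>2) / (?z\<^sup>2 - complex_of_real (w' t)) - complex_of_real (\<gamma>\<^sup>2 / \<Omega>)"
    have E: "cmod E < \<bar>D0\<bar> / 4" using PP b02 by (simp add: E_def dist_norm)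
    define x where "x = \<kappa> * \<rho> * s / w0"
    define E2 where "E2 = \<i> * complex_of_real (\<kappa> * \<rho>) * (1 / ?S - 1 / ?z)"
    have ss: "s * s = 1" "s \<noteq> 0" using s by auto
    have E2: "cmod E2 \<le> \<bar>x\<bar> / 4"
    proof -
      have "1 / ?S - 1 / ?z = (?z - ?S) / (?S * ?z)" using z0 w0 ss by (simp add: divide_simps)
      then have "cmod (1 / ?S - 1 / ?z) = cmod (?z - ?S) / (w0 * cmod ?z)" by (simp only: norm_divide norm_mult S)
      also have "\<dots> \<le> (w0 / 5) / (w0 * (4 / 5 * w0))"
        using near e w0 zb by (intro frac_le mult_left_mono) (auto intro!: mult_pos_pos)
      also have "\<dots> = 1 / (4 * w0)" using w0 by (simp add: field_simps)
      finally have "\<kappa> * \<rho> * cmod (1 / ?S - 1 / ?z) \<le> \<kappa> * \<rho> * (1 / (4 * w0))"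
        using kappa \<rho> by (intro mult_left_mono) auto
      moreover have "cmod E2 = \<kappa> * \<rho> * cmod (1 / ?S - 1 / ?z)"
        unfolding E2_def norm_mult norm_of_real using kappa \<rho> by simp
      ultimately have "cmod E2 \<le> \<kappa> * \<rho> * (1 / (4 * w0))" by simp
      also have "\<dots> = \<bar>x\<bar> / 4" using s kappa \<rho> w0 by (auto simp: x_def abs_mult)
      finally show ?thesis .
    qed
    have invS: "\<i> * complex_of_real (\<kappa> * \<rho>) / ?S = \<i> * complex_of_real x"
    proof -
      have "1 / (s * w0) = s / w0" using ss w0 by (simp add: divide_simps)
      then have "x = \<kappa> * \<rho> / (s * w0)" unfolding x_def by (metis divide_inverse mult.assoc mult_1 times_divide_eq_right)
      then show ?thesis by simp
    qed
    \<comment> \<open>Around the limit \<open>D0 - \<i> x\<close> the error \<open>E\<close> is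
      small absolutely, while \<open>E2\<close> grows with \<rho> and is small only relative to the
      imaginary main term \<open>x\<close>.\<close>
    have Deq: "Dn \<rho> t = complex_of_real D0 - \<i> * complex_of_real x + (E2 - E)"
      unfolding Dn_def E_def E2_def D0_def \<Omega>_def[symmetric] invS[symmetric] by (simp add: algebra_simps)
    have "cmod (E2 - E) \<le> \<bar>D0\<bar> / 4 + \<bar>x\<bar> / 4"
      using norm_triangle_ineq4[of E2 E] E E2 by linarith
    then have Dl: "\<bar>D0\<bar> / 4 \<le> cmod (Dn \<rho> t)" unfolding Deq by (rule norm_real_plus_imaginary_ge)
    have Du: "cmod (Dn \<rho> t) \<le> (1 + \<gamma>\<^sup>2 / \<bar>\<Omega>\<bar> + \<bar>D0\<bar>) + \<kappa> * \<rho> / (4 / 5 * w0)"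
    proof -
      have "Dn \<rho> t = 1 - (\<i> * complex_of_real (\<kappa> * \<rho>) / ?z) - (E + complex_of_real (\<gamma>\<^sup>2 / \<Omega>))"
        by (simp add: Dn_def E_def)
      then have Dz: "cmod (Dn \<rho> t) = cmod (1 - (\<i> * complex_of_real (\<kappa> * \<rho>) / ?z) - (E + complex_of_real (\<gamma>\<^sup>2 / \<Omega>)))"
        by simp
      have "cmod (Dn \<rho> t) \<le> 1 + cmod (\<i> * complex_of_real (\<kappa> * \<rho>) / ?z) + (cmod E + cmod (complex_of_real (\<gamma>\<^sup>2 / \<Omega>)))"
        unfolding Dz
        using norm_triangle_ineq4[of "1 - \<i> * complex_of_real (\<kappa> * \<rho>) / ?z" "E + complex_of_real (\<gamma>\<^sup>2 / \<Omega>)"]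
          norm_triangle_ineq4[of 1 "\<i> * complex_of_real (\<kappa> * \<rho>) / ?z"]
          norm_triangle_ineq[of E "complex_of_real (\<gamma>\<^sup>2 / \<Omega>)"] norm_one[where 'a=complex] by linarith
      moreover have "cmod (\<i> * complex_of_real (\<kappa> * \<rho>) / ?z) \<le> \<kappa> * \<rho> / (4 / 5 * w0)"
      proof -
        have "cmod (\<i> * complex_of_real (\<kappa> * \<rho>) / ?z) = \<kappa> * \<rho> / cmod ?z"
          using kappa \<rho> by (simp add: norm_divide norm_mult)
        also have "\<dots> \<le> \<kappa> * \<rho> / (4 / 5 * w0)"
          using kappa \<rho> zb w0 by (intro divide_left_mono) (auto intro!: mult_pos_pos)
        finally show ?thesis .
      qed
      moreover have "cmod (complex_of_real (\<gamma>\<^sup>2 / \<Omega>)) = \<gamma>\<^sup>2 / \<bar>\<Omega>\<bar>" by (simp only: norm_of_real abs_divide abs_power2)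
      ultimately show ?thesis using E by linarith
    qed
    have "complex_of_real \<rho> * ?z = \<nu> (\<rho> *\<^sub>R arc t)" using \<rho> by (simp add: z_def)
    then have "complex_of_real \<rho> * ?z \<in> spectrum (B_matrix \<kappa> \<gamma> vk r (\<rho> *\<^sub>R arc t))"
      using sp[OF conic(3)[OF \<delta>(3)[OF t] \<rho>]] by simp
    from scaled_characteristic_equation[OF this \<rho> arc1 j _ _ z0 Q0] pos[OF arc1[of t]]
    have eq: "(?z\<^sup>2 - complex_of_real (vk j (arc t))) * Dn \<rho> t = complex_of_real (\<gamma>\<^sup>2 * (a t)\<^sup>2)"
      by (simp add: Dn_def w'_def a_def b_def)
    have "cmod (?z - ?S) < e / 2"
    proof -
      \<comment> \<open>The root of z^2 = \<open>vk j\<close> on the sheet at angle t, on the branch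
        of sign \<open>s\<close>. In z^2 - W^2 the factor z + W stays near 2 \<open>?S\<close>, so
        the smallness of the coupling \<open>a t\<close> forces z close to W.\<close>
      let ?W = "complex_of_real (s * w t)"
      have fac: "?z\<^sup>2 - complex_of_real (vk j (arc t)) = (?z - ?W) * (?z + ?W)"
      proof -
        have "?W * ?W = complex_of_real (vk j (arc t))"
          using s w2[of t] by (auto simp: power2_eq_square simp flip: of_real_mult)
        then show ?thesis by (simp add: power2_eq_square algebra_simps)
      qed
      have wt: "\<bar>w t - w0\<bar> < e / 2" 
        using \<delta>(4)[OF t] w0 D0 by (smt (verit) divide_nonneg_pos mult_nonneg_nonneg mult_pos_pos zero_le_power2 zero_less_abs_iff)
      have "cmod (?z + ?W) = cmod (2 * ?S + (?z - ?S) + (?W - ?S))" by simp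
      moreover have WS: "cmod (?W - ?S) = \<bar>w t - w0\<bar>"
      proof -
        have "?W - ?S = complex_of_real (s * (w t - w0))" by (simp add: algebra_simps)
        then have "cmod (?W - ?S) = \<bar>s * (w t - w0)\<bar>" by (simp only: norm_of_real)
        then show ?thesis using s by (auto simp: abs_mult)
      qed
      moreover have "cmod (2 * ?S) = 2 * w0" using S by (simp add: norm_mult)
      ultimately have "2 * w0 - e - e / 2 \<le> cmod (?z + ?W)"
        using near wt norm_diff_ineq[of "2 * ?S + (?z - ?S)" "?W - ?S"] norm_diff_ineq[of "2 * ?S" "?z - ?S"] by linarith
      then have sum: "w0 \<le> cmod (?z + ?W)" using e w0 by linarith
      have "cmod (?z - ?W) * cmod (?z + ?W) * cmod (Dn \<rho> t) = \<gamma>\<^sup>2 * (a t)\<^sup>2"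
        using arg_cong[OF eq[unfolded fac], of cmod] by (simp add: norm_mult norm_power power_mult_distrib)
      moreover have "cmod (?z - ?W) * (w0 * (\<bar>D0\<bar> / 4)) \<le> cmod (?z - ?W) * (cmod (?z + ?W) * cmod (Dn \<rho> t))"
        using sum Dl w0 by (intro mult_left_mono mult_mono) auto
      ultimately have "cmod (?z - ?W) * (w0 * (\<bar>D0\<bar> / 4)) \<le> \<gamma>\<^sup>2 * (a t)\<^sup>2" by (simp add: mult.assoc)
      then have "cmod (?z - ?W) \<le> 4 * (\<gamma>\<^sup>2 * (a t)\<^sup>2) / (\<bar>D0\<bar> * w0)"
        using D0 w0 by (simp add: pos_le_divide_eq mult_ac)
      moreover have "cmod (?z - ?S) \<le> cmod (?z - ?W) + cmod (?W - ?S)"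
        using norm_triangle_ineq[of "?z - ?W" "?W - ?S"] by simp
      ultimately show ?thesis using \<delta>(4)[OF t] WS by linarith
    qed
    with z0 zb Re0 Qb Dl Du eq show ?thesis by blast
  qed
  txt \<open>Continuity method: along the arc \<open>z\<close> starts at \<open>?S\<close>, and distance at most \<open>e\<close> implies distance
    less than \<open>e / 2\<close>. The length \<open>\<delta>\<close> of the arc does not depend on \<open>\<rho>\<close>.\<close>
  have near: "cmod (z \<rho> t - ?S) \<le> e" if t: "\<bar>t\<bar> < \<delta>" and \<rho>: "\<rho> > 0" for t \<rho>
  proof (rule ccontr)
    assume not: "\<not> cmod (z \<rho> t - ?S) \<le> e"
    define f where "f u = cmod (z \<rho> (u * t) - ?S)" for u
    have ut: "\<bar>u * t\<bar> < \<delta>" if "u \<in> {0..1}" for u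
      using that t mult_left_le_one_le[of "\<bar>t\<bar>" "\<bar>u\<bar>"] by (auto simp: abs_mult)
    have "continuous_on {0..1} (\<lambda>u. \<nu> (\<rho> *\<^sub>R arc (u * t)))"
      using ut \<delta>(3) conic(3) \<rho>
      by (intro continuous_on_compose2[OF cnu] continuous_intros continuous_on_compose2[OF carc]) auto
    then have "continuous_on {0..1} f"
      unfolding f_def z_def using \<rho> by (intro continuous_intros) auto
    moreover have "f 0 = 0"
    proof -
      have "omega vk j (\<rho> *\<^sub>R \<eta>) = \<rho> * w0" using \<rho> \<eta> by (simp add: omega_def w0_def w_def arc0)
      then have "z \<rho> 0 = ?S" using nu0[OF \<rho>] \<rho> by (simp add: z_def arc0)
      then show ?thesis by (simp add: f_def)
    qed
    moreover have "f 1 \<ge> e" using not by (simp add: f_def)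
    ultimately obtain u where u: "0 \<le> u" "u \<le> 1" "f u = e"
      using IVT'[of f 0 e 1] e by auto
    then have "cmod (z \<rho> (u * t) - ?S) < e / 2" using local_bounds[OF ut \<rho>, of u] by (simp add: f_def)
    then show False using u e by (simp add: f_def)
  qed
  \<comment> \<open>\<open>C1 * (1 + \<rho>)\<close> bounds |D|, and
    \<open>C * (1 + \<rho>)\<^sup>2\<close> bounds the whole coefficient of 2 Im z. The 8 in
    \<open>c\<close> below combines this 2 with |z|^2 \<le> 4 \<open>w0\<^sup>2\<close>.\<close>
  define C1 where "C1 = (1 + \<gamma>\<^sup>2 / \<bar>\<Omega>\<bar> + \<bar>D0\<bar>) + \<kappa> / (4 / 5 * w0)"
  define C where "C = C1\<^sup>2 + \<gamma>\<^sup>2 * \<gamma>\<^sup>2 / (\<bar>\<Omega>\<bar> / 2)\<^sup>2"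
  have C1: "C1 > 0" using kappa w0 unfolding C1_def by (intro add_pos_pos add_pos_nonneg) auto
  then have C: "C > 0" unfolding C_def by (intro add_pos_nonneg) auto
  define c where "c = \<gamma>\<^sup>2 * \<kappa> / (8 * w0\<^sup>2 * C)"
  have c: "c > 0" unfolding c_def using gamma kappa w0(1) C by (intro divide_pos_pos mult_pos_pos) auto
  have "\<rho> *\<^sub>R arc t \<in> \<Gamma> \<and> c * (\<rho> / (1 + \<rho>))\<^sup>2 * (a t)\<^sup>2 \<le> Im (\<nu> (\<rho> *\<^sub>R arc t))" if t: "\<bar>t\<bar> < \<delta>" and \<rho>: "\<rho> > 0" for t \<rho>
  proof
    show "\<rho> *\<^sub>R arc t \<in> \<Gamma>" using conic(3)[OF \<delta>(3)[OF t] \<rho>] .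
    note L = local_bounds[OF t \<rho> near[OF t \<rho>]]
    let ?z = "z \<rho> t" and ?G = "\<gamma>\<^sup>2 * (a t)\<^sup>2" and ?H = "\<gamma>\<^sup>2 * (b t)\<^sup>2"
    define m where "m = (cmod (Dn \<rho> t))\<^sup>2 + ?G * ?H / (cmod (?z\<^sup>2 - complex_of_real (w' t)))\<^sup>2"
    have id: "2 * Im ?z * m = ?G * (\<kappa> * \<rho>) / (cmod ?z)\<^sup>2"
      unfolding m_def
    proof (rule spectral_imaginary_part)
      show "?z\<^sup>2 \<noteq> complex_of_real (w' t)" using L \<Omega> by auto
      show "Dn \<rho> t \<noteq> 0" using L D0 by auto
    qed (use L in \<open>auto simp: Dn_def\<close>)
    have m0: "m > 0" unfolding m_def using L D0 by (intro add_pos_nonneg) auto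
    have mC: "m \<le> C * (1 + \<rho>)\<^sup>2"
    proof -
      have "cmod (Dn \<rho> t) \<le> C1 * (1 + \<rho>)"
      proof -
        have "0 \<le> (1 + \<gamma>\<^sup>2 / \<bar>\<Omega>\<bar> + \<bar>D0\<bar>) * \<rho> + \<kappa> / (4 / 5 * w0)"
          using \<rho> kappa w0 by (intro add_nonneg_nonneg mult_nonneg_nonneg) auto
        moreover have "C1 * (1 + \<rho>) = (1 + \<gamma>\<^sup>2 / \<bar>\<Omega>\<bar> + \<bar>D0\<bar>) + \<kappa> * \<rho> / (4 / 5 * w0) + ((1 + \<gamma>\<^sup>2 / \<bar>\<Omega>\<bar> + \<bar>D0\<bar>) * \<rho> + \<kappa> / (4 / 5 * w0))"
          unfolding C1_def by (simp add: algebra_simps add_divide_distrib)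
        ultimately show ?thesis using L by linarith
      qed
      then have "(cmod (Dn \<rho> t))\<^sup>2 \<le> (C1 * (1 + \<rho>))\<^sup>2" by (intro power_mono) auto
      moreover have "?G * ?H / (cmod (?z\<^sup>2 - complex_of_real (w' t)))\<^sup>2 \<le> \<gamma>\<^sup>2 * \<gamma>\<^sup>2 / (\<bar>\<Omega>\<bar> / 2)\<^sup>2"
      proof (rule frac_le)
        show "?G * ?H \<le> \<gamma>\<^sup>2 * \<gamma>\<^sup>2"
          using ab[OF arc1[of t]] by (intro mult_mono mult_left_le) (auto simp: a_def b_def)
        show "(\<bar>\<Omega>\<bar> / 2)\<^sup>2 \<le> (cmod (?z\<^sup>2 - complex_of_real (w' t)))\<^sup>2" using L by (intro power_mono) auto
      qed (use \<Omega> in auto)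
      moreover have "\<gamma>\<^sup>2 * \<gamma>\<^sup>2 / (\<bar>\<Omega>\<bar> / 2)\<^sup>2 * 1 \<le> \<gamma>\<^sup>2 * \<gamma>\<^sup>2 / (\<bar>\<Omega>\<bar> / 2)\<^sup>2 * (1 + \<rho>)\<^sup>2"
        using \<rho> by (intro mult_left_mono) (auto simp: one_le_power)
      ultimately show ?thesis unfolding m_def C_def by (simp add: power_mult_distrib distrib_right)
    qed
    have z4: "(cmod ?z)\<^sup>2 \<le> 4 * w0\<^sup>2" "0 < (cmod ?z)\<^sup>2"
      using L power_mono[of "cmod ?z" "2 * w0" 2] by (auto simp: power_mult_distrib)
    have "Im ?z = ?G * (\<kappa> * \<rho>) / ((cmod ?z)\<^sup>2 * (2 * m))"
      using id m0 z4(2) by (simp add: field_simps)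
    also have "\<dots> \<ge> ?G * (\<kappa> * \<rho>) / ((4 * w0\<^sup>2) * (2 * (C * (1 + \<rho>)\<^sup>2)))"
      using z4 m0 mC kappa \<rho> C w0(1) by (intro divide_left_mono mult_mono mult_pos_pos) auto
    finally have Imz: "?G * (\<kappa> * \<rho>) / ((4 * w0\<^sup>2) * (2 * (C * (1 + \<rho>)\<^sup>2))) \<le> Im ?z" .
    have "Im (\<nu> (\<rho> *\<^sub>R arc t)) = \<rho> * Im ?z"
    proof -
      have "\<nu> (\<rho> *\<^sub>R arc t) = complex_of_real \<rho> * ?z" using \<rho> by (simp add: z_def)
      then show ?thesis by simp
    qed
    moreover have "\<rho> * (?G * (\<kappa> * \<rho>) / ((4 * w0\<^sup>2) * (2 * (C * (1 + \<rho>)\<^sup>2)))) \<le> \<rho> * Im ?z"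
      using Imz \<rho> by (intro mult_left_mono) auto
    moreover have "c * (\<rho> / (1 + \<rho>))\<^sup>2 * (a t)\<^sup>2 = \<rho> * (?G * (\<kappa> * \<rho>) / ((4 * w0\<^sup>2) * (2 * (C * (1 + \<rho>)\<^sup>2))))"
      by (simp add: c_def power_divide power2_eq_square mult_ac)
    ultimately show "c * (\<rho> / (1 + \<rho>))\<^sup>2 * (a t)\<^sup>2 \<le> Im (\<nu> (\<rho> *\<^sub>R arc t))" by linarith
  qed
  then show ?thesis using \<delta>(1) c unfolding a_def arc_def by blast
qed

section \<open>The decay integral over a sector\<close>

text \<open>The majorant is integrable with an elementary integral, and its quadratic decay is
  enough for the integration across the sector. For w \<le> 1 it is at least 1, beyond that w^2
  \<le> w^(2l).\<close>

lemma exp_power_le: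
  assumes "l \<ge> 1" "(w::real) \<ge> 0"
  shows "exp (- (w ^ (2 * l))) \<le> 2 / (1 + w\<^sup>2)"
proof (cases "w \<le> 1")
  case True
  then have "w\<^sup>2 \<le> 1" using assms by (simp add: power_le_one)
  then have "1 \<le> 2 / (1 + w\<^sup>2)" by (simp add: add_pos_nonneg)
  moreover have "exp (- (w ^ (2 * l))) \<le> 1" using assms by simp
  ultimately show ?thesis by linarith
next
  case False
  then have "w\<^sup>2 \<le> w ^ (2 * l)" using assms by (intro power_increasing) auto
  then have "1 + w\<^sup>2 \<le> exp (w ^ (2 * l))" using exp_ge_add_one_self[of "w ^ (2 * l)"] by linarith
  moreover have p: "1 + w\<^sup>2 > 0" by (simp add: add_pos_nonneg)
  ultimately have "1 / exp (w ^ (2 * l)) \<le> 1 / (1 + w\<^sup>2)" by (intro divide_left_mono) auto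
  also have "\<dots> \<le> 2 / (1 + w\<^sup>2)" using p by (intro divide_right_mono) auto
  finally show ?thesis by (simp add: exp_minus divide_inverse)
qed

lemma nn_integral_Lorentzian:
  assumes "M > 0"
  shows "(\<integral>\<^sup>+y. ennreal (2 / (1 + (M * y)\<^sup>2)) \<partial>lborel) = ennreal (2 * pi / M)"
proof -
  have "(\<integral>\<^sup>+y. ennreal (2 / (1 + y\<^sup>2)) \<partial>lborel) = ennreal M * (\<integral>\<^sup>+y. ennreal (2 / (1 + (M * y)\<^sup>2)) \<partial>lborel)"
    using lborel_nn_integral_scaleR[of M "\<lambda>y::real. ennreal (2 / (1 + y\<^sup>2))" 0] assms by simp
  moreover have "(\<integral>\<^sup>+y. ennreal (2 / (1 + y\<^sup>2)) \<partial>lborel) = ennreal (2 * pi)"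
  proof -
    have "has_bochner_integral lborel (\<lambda>y::real. 2 * (1 / (1 + y\<^sup>2))) (2 * pi)"
      using has_bochner_integral_inverse_one_plus_square by (rule has_bochner_integral_mult_right)
    then show ?thesis
      by (subst nn_integral_eq_integral) (auto simp: has_bochner_integral_iff)
  qed
  ultimately have "ennreal (1 / M) * (ennreal M * (\<integral>\<^sup>+y. ennreal (2 / (1 + (M * y)\<^sup>2)) \<partial>lborel)) = ennreal (1 / M) * ennreal (2 * pi)"
    by simp
  then show ?thesis using assms by (simp add: mult.assoc[symmetric] ennreal_mult[symmetric])
qed

text \<open>The cone of directions whose slope against \<open>\<eta>\<close> is below
  \<open>\<delta>\<close>. For positive \<open>\<delta>\<close> the inequality forces the component
  along \<open>\<eta>\<close> to be positive.\<close>

definition sector :: "real^2 \<Rightarrow> real \<Rightarrow> (real^2) set" where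
  "sector \<eta> \<delta> = {\<xi>. \<bar>\<xi> \<bullet> rot \<eta>\<bar> < \<delta> * (\<xi> \<bullet> \<eta>)}"

lemma rot_inner: "norm \<eta> = 1 \<Longrightarrow> \<eta> \<bullet> \<eta> = 1" "norm \<eta> = 1 \<Longrightarrow> rot \<eta> \<bullet> rot \<eta> = 1" "\<eta> \<bullet> rot \<eta> = 0" "rot \<eta> \<bullet> \<eta> = 0"
  using norm_2_sq[of \<eta>] by (simp_all add: inner_2 power2_eq_square)

lemma rot_decomposition: "norm \<eta> = 1 \<Longrightarrow> \<xi> = (\<xi> \<bullet> \<eta>) *\<^sub>R \<eta> + (\<xi> \<bullet> rot \<eta>) *\<^sub>R rot \<eta>"
proof -
  assume "norm \<eta> = 1"
  then have n: "\<eta> $ 1 * \<eta> $ 1 + \<eta> $ 2 * \<eta> $ 2 = 1" using norm_2_sq[of \<eta>] by (simp add: power2_eq_square)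
  have "(x * a + y * b) * a + (x * - b + y * a) * - b = x * (a * a + b * b)"
    "(x * a + y * b) * b + (x * - b + y * a) * a = y * (a * a + b * b)" for x y a b :: real by algebra+
  then show ?thesis by (simp add: vec2_eq_iff inner_2 n)
qed

lemma norm_rot_decomposition:
  "norm \<eta> = 1 \<Longrightarrow> (norm (x *\<^sub>R \<eta> + y *\<^sub>R rot \<eta>))\<^sup>2 = x\<^sup>2 + y\<^sup>2"
  unfolding power2_norm_eq_inner using rot_inner[of \<eta>] by (simp add: inner_simps power2_eq_square)

lemma open_sector: "open (sector \<eta> \<delta>)"
  unfolding sector_def by (intro open_Collect_less continuous_intros)

lemma conical_sector:
  assumes "norm \<eta> = 1" "\<delta> > 0"
  shows "conical_nbhd \<eta> (sector \<eta> \<delta>)"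
  unfolding conical_nbhd_def
proof (intro conjI ballI allI impI)
  show "\<eta> \<in> sector \<eta> \<delta>" using assms rot_inner[of \<eta>] by (simp add: sector_def)
  fix \<xi> \<rho> assume "\<xi> \<in> sector \<eta> \<delta>" "\<rho> > (0::real)"
  then have "\<rho> * \<bar>\<xi> \<bullet> rot \<eta>\<bar> < \<rho> * (\<delta> * (\<xi> \<bullet> \<eta>))" by (simp add: sector_def)
  then show "\<rho> *\<^sub>R \<xi> \<in> sector \<eta> \<delta>" using \<open>\<rho> > 0\<close> by (simp add: sector_def abs_mult mult_ac)
qed (auto simp: open_sector, simp add: sector_def)

lemma radial_integral_finite:
  assumes "\<sigma> > (2::real)"
  shows "(\<integral>\<^sup>+y. indicator {0..1} y + ennreal (y powr (1 - \<sigma>)) * indicator {1..} y \<partial>lborel) = ennreal (1 + 1 / (\<sigma> - 2))"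
proof -
  have "(\<integral>\<^sup>+y. ennreal (indicator {1..} y * (y powr (1 - \<sigma>))) \<partial>lborel) = ennreal (- (1 powr (1 - \<sigma> + 1)) / (1 - \<sigma> + 1))"
  proof (rule nn_integral_has_integral_lborel)
    have "(\<lambda>x. indicator {1..} x * (x powr (1 - \<sigma>))) = (\<lambda>x. if x \<in> {1..} then x powr (1 - \<sigma>) else 0)"
      by (auto simp: fun_eq_iff)
    then show "((\<lambda>x. indicator {1..} x * (x powr (1 - \<sigma>))) has_integral - (1 powr (1 - \<sigma> + 1)) / (1 - \<sigma> + 1)) UNIV"
      using has_integral_powr_to_inf[of "1 - \<sigma>" 1] assms by (simp only: has_integral_restrict_UNIV)
  qed auto
  also have "- (1 powr (1 - \<sigma> + 1)) / (1 - \<sigma> + 1) = 1 / (\<sigma> - 2)"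
    using assms by (simp add: divide_simps)
  finally have "(\<integral>\<^sup>+y. ennreal (y powr (1 - \<sigma>)) * indicator {1..} y \<partial>lborel) = ennreal (1 / (\<sigma> - 2))"
    by (simp add: ennreal_mult mult.commute ennreal_indicator)
  then show ?thesis using assms by (subst nn_integral_add) (auto simp: ennreal_plus)
qed

text \<open>Tonelli in the coordinates x along and y across \<open>\<eta>\<close>. The y-integral is
  of order x / (T m(x)), so all dependence on t sits in the factor 1/T, and a convergent integral in
  x remains.\<close>

lemma sector_decay_integral:
  assumes \<eta>: "norm \<eta> = 1" and l: "l \<ge> 1" and c: "c > 0" and \<delta>: "0 < \<delta>" "\<delta> \<le> 1" and \<sigma>: "\<sigma> > 2"
  shows "\<exists>K>0. \<forall>t\<ge>0. (\<integral>\<^sup>+\<xi>. indicator (sector \<eta> \<delta>) \<xi> *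
      ennreal (exp (- (c * t * (min 1 (\<xi> \<bullet> \<eta>))\<^sup>2 * (\<bar>\<xi> \<bullet> rot \<eta>\<bar> / (\<xi> \<bullet> \<eta>)) ^ (2 * l))) * (1 + (norm \<xi>)\<^sup>2) powr (- \<sigma> / 2)) \<partial>lborel)
    \<le> ennreal (K * (1 + t) powr (- (1 / (2 * real l))))"
proof (intro exI conjI allI impI)
  let ?K = "exp c * 2 * pi * (1 + 1 / (\<sigma> - 2)) / c powr (1 / (2 * real l))"
  show "?K > 0" using c \<sigma> by (intro divide_pos_pos mult_pos_pos add_pos_pos) auto
  fix t :: real assume t: "t \<ge> 0"
  define F where "F \<xi> = indicator (sector \<eta> \<delta>) \<xi> *
      ennreal (exp (- (c * t * (min 1 (\<xi> \<bullet> \<eta>))\<^sup>2 * (\<bar>\<xi> \<bullet> rot \<eta>\<bar> / (\<xi> \<bullet> \<eta>)) ^ (2 * l))) * (1 + (norm \<xi>)\<^sup>2) powr (- \<sigma> / 2))" for \<xi>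
  have [measurable]: "sector \<eta> \<delta> \<in> sets borel" using open_sector by auto
  have [measurable]: "F \<in> borel_measurable borel" unfolding F_def by measurable
  \<comment> \<open>Collects time and constant under the power 2l, with 1 + t in place of t so that
    the bound is uniform down to t = 0.\<close>
  define T where "T = (c * (1 + t)) powr (1 / (2 * real l))"
  have T: "T > 0" "T ^ (2 * l) = c * (1 + t)"
    using c t l by (simp_all add: T_def powr_powr flip: powr_realpow)
  \<comment> \<open>Likewise brings the low-frequency factor \<open>(min 1 x)\<^sup>2\<close> under
    the power 2l.\<close>
  define m where "m x = min 1 x powr (1 / real l)" for x :: real
  have m: "m x > 0" "m x ^ (2 * l) = (min 1 x)\<^sup>2" if "x > 0" for x
  proof -
    show m0: "m x > 0" using that by (simp add: m_def)
    have "m x ^ (2 * l) = m x powr real (2 * l)" using m0 by (rule powr_realpow[symmetric])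
    also have "\<dots> = min 1 x powr 2" unfolding m_def powr_powr using l by simp
    finally show "m x ^ (2 * l) = (min 1 x)\<^sup>2" using that by (simp add: powr_numeral)
  qed
  let ?P = "\<lambda>p. fst p *\<^sub>R \<eta> + snd p *\<^sub>R rot \<eta>"
  let ?h = "\<lambda>x. indicator {0<..} x * ennreal (exp c * (1 + x\<^sup>2) powr (- \<sigma> / 2))"
  have "(\<integral>\<^sup>+\<xi>. F \<xi> \<partial>lborel) = (\<integral>\<^sup>+\<xi>. F \<xi> \<partial>(distr (lborel \<Otimes>\<^sub>M lborel) borel ?P))"
    by (simp only: lborel_real2_rot[OF \<eta>])
  also have "\<dots> = (\<integral>\<^sup>+p. F (?P p) \<partial>(lborel \<Otimes>\<^sub>M lborel))" by (subst nn_integral_distr) auto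
  also have "\<dots> = (\<integral>\<^sup>+x. \<integral>\<^sup>+y. F (?P (x, y)) \<partial>lborel \<partial>lborel)"
    by (rule lborel.nn_integral_fst[symmetric]) measurable
  also have "\<dots> \<le> (\<integral>\<^sup>+x. \<integral>\<^sup>+y. ?h x * ennreal (2 / (1 + (T * m x / x * y)\<^sup>2)) \<partial>lborel \<partial>lborel)"
  proof (intro nn_integral_mono)
    fix x y :: real
    have in1: "?P (x, y) \<bullet> \<eta> = x" "?P (x, y) \<bullet> rot \<eta> = y" using \<eta> by (simp_all add: inner_simps rot_inner)
    show "F (?P (x, y)) \<le> ?h x * ennreal (2 / (1 + (T * m x / x * y)\<^sup>2))"
    proof (cases "\<bar>y\<bar> < \<delta> * x")
      case True
      then have x: "x > 0" using \<delta> by (smt (verit) mult_nonneg_nonpos)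
      have yx: "\<bar>y\<bar> \<le> x" using True \<delta> x mult_right_mono[of \<delta> 1 x] by linarith
      define X where "X = (min 1 x)\<^sup>2 * (\<bar>y\<bar> / x) ^ (2 * l)"
      have X1: "X \<le> 1" unfolding X_def using x yx
        by (intro mult_le_one power_le_one) auto
      have "(T * m x / x * \<bar>y\<bar>) ^ (2 * l) = T ^ (2 * l) * m x ^ (2 * l) * (\<bar>y\<bar> / x) ^ (2 * l)"
        by (simp add: power_mult_distrib power_divide)
      then have w: "(T * m x / x * \<bar>y\<bar>) ^ (2 * l) = c * (1 + t) * X" using T m[OF x] by (simp add: X_def)
      txt \<open>Since \<open>X \<le> 1\<close>, replacing \<open>t\<close> by \<open>1 + t\<close> costs only the factor \<open>exp c\<close>.\<close>
      have "exp (- (c * t * X)) = exp (c * X) * exp (- ((T * m x / x * \<bar>y\<bar>) ^ (2 * l)))"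
        unfolding w by (simp add: algebra_simps flip: exp_add)
      also have "\<dots> \<le> exp c * (2 / (1 + (T * m x / x * \<bar>y\<bar>)\<^sup>2))"
        using X1 c T m[OF x] x l by (intro mult_mono exp_power_le) auto
      finally have 1: "exp (- (c * t * X)) \<le> exp c * (2 / (1 + (T * m x / x * y)\<^sup>2))"
        unfolding power_mult_distrib[of _ "\<bar>y\<bar>"] power_mult_distrib[of _ y] by simp
      have "(1 + (norm (?P (x, y)))\<^sup>2) powr (- \<sigma> / 2) \<le> (1 + x\<^sup>2) powr (- \<sigma> / 2)"
        using \<sigma> norm_rot_decomposition[OF \<eta>, of x y] by (intro powr_mono2') (auto simp: add_pos_nonneg)
      then have "exp (- (c * t * X)) * (1 + (norm (?P (x, y)))\<^sup>2) powr (- \<sigma> / 2) \<le> exp c * (2 / (1 + (T * m x / x * y)\<^sup>2)) * (1 + x\<^sup>2) powr (- \<sigma> / 2)"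
        using 1 by (intro mult_mono) (auto intro: order_trans[OF exp_ge_zero])
      then have "ennreal (exp (- (c * t * X)) * (1 + (norm (?P (x, y)))\<^sup>2) powr (- \<sigma> / 2)) \<le> ennreal (exp c * (1 + x\<^sup>2) powr (- \<sigma> / 2)) * ennreal (2 / (1 + (T * m x / x * y)\<^sup>2))"
        by (simp add: ennreal_mult[symmetric] mult_ac ennreal_leI)
      moreover have "F (?P (x, y)) = ennreal (exp (- (c * t * X)) * (1 + (norm (?P (x, y)))\<^sup>2) powr (- \<sigma> / 2))"
        unfolding F_def in1 using True in1 by (simp add: sector_def X_def mult.assoc)
      ultimately show ?thesis using x by simp
    next
      case False
      then have "?P (x, y) \<notin> sector \<eta> \<delta>" using in1 by (simp add: sector_def)
      then show ?thesis by (simp add: F_def)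
    qed
  qed
  also have "\<dots> = (\<integral>\<^sup>+x. ?h x * (\<integral>\<^sup>+y. ennreal (2 / (1 + (T * m x / x * y)\<^sup>2)) \<partial>lborel) \<partial>lborel)"
    by (intro nn_integral_cong nn_integral_cmult) measurable
  also have "\<dots> \<le> (\<integral>\<^sup>+x. ennreal (exp c * 2 * pi / T) * (indicator {0..1} x + ennreal (x powr (1 - \<sigma>)) * indicator {1..} x) \<partial>lborel)"
  proof (intro nn_integral_mono)
    fix x :: real
    show "?h x * (\<integral>\<^sup>+y. ennreal (2 / (1 + (T * m x / x * y)\<^sup>2)) \<partial>lborel)
      \<le> ennreal (exp c * 2 * pi / T) * (indicator {0..1} x + ennreal (x powr (1 - \<sigma>)) * indicator {1..} x)"
    proof (cases "x > 0")
      case True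
      then have M: "T * m x / x > 0" using T m by simp
      \<comment> \<open>Near 0 the width x / m(x) is x^(1 - 1/l) \<le> 1, because l \<ge> 1. Beyond
        1 it is x, and the Bessel weight leaves x^(1-\<sigma>), integrable at infinity as \<sigma> >
        2.\<close>
      have key: "(1 + x\<^sup>2) powr (- \<sigma> / 2) * (x / m x) \<le> (if x \<le> 1 then 1 else x powr (1 - \<sigma>))"
      proof (cases "x \<le> 1")
        case x1: True
        have "x / m x = x powr (1 - 1 / real l)" using True x1 by (simp add: m_def powr_diff)
        also have "\<dots> \<le> 1" using True x1 l by (intro powr_le1) auto
        finally have "x / m x \<le> 1" .
        moreover have "(1 + x\<^sup>2) powr (- \<sigma> / 2) \<le> (1 + x\<^sup>2) powr 0" using \<sigma> by (intro powr_mono) auto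
        ultimately show ?thesis using x1 True m[OF True] mult_le_one[of "(1 + x\<^sup>2) powr (- \<sigma> / 2)" "x / m x"]
          by (simp add: less_imp_le add_nonneg_eq_0_iff)
      next
        case x1: False
        then have "m x = 1" by (simp add: m_def)
        moreover have "(1 + x\<^sup>2) powr (- \<sigma> / 2) \<le> (x\<^sup>2) powr (- \<sigma> / 2)"
          using \<sigma> True by (intro powr_mono2') auto
        moreover have "(x\<^sup>2) powr (- \<sigma> / 2) = x powr (- \<sigma>)"
        proof -
          have "x\<^sup>2 = x powr 2" using True by (simp add: powr_numeral)
          then show ?thesis by (simp add: powr_powr)
        qed
        moreover have "x powr (- \<sigma>) * x = x powr (1 - \<sigma>)" using True powr_add[of x "- \<sigma>" 1] by simp
        ultimately show ?thesis using x1 True mult_right_mono[of "(1 + x\<^sup>2) powr (- \<sigma> / 2)" "x powr (- \<sigma>)" x] by simp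
      qed
      have "?h x * (\<integral>\<^sup>+y. ennreal (2 / (1 + (T * m x / x * y)\<^sup>2)) \<partial>lborel) = ennreal (exp c * (1 + x\<^sup>2) powr (- \<sigma> / 2)) * ennreal (2 * pi / (T * m x / x))"
        unfolding nn_integral_Lorentzian[OF M] using True by simp
      also have "\<dots> = ennreal (exp c * 2 * pi / T * ((1 + x\<^sup>2) powr (- \<sigma> / 2) * (x / m x)))"
        by (subst ennreal_mult'[symmetric]) (simp_all add: mult_ac)
      also have "\<dots> \<le> ennreal (exp c * 2 * pi / T * (if x \<le> 1 then 1 else x powr (1 - \<sigma>)))"
        using T by (intro ennreal_leI mult_left_mono key) auto
      also have "\<dots> = ennreal (exp c * 2 * pi / T) * ennreal (if x \<le> 1 then 1 else x powr (1 - \<sigma>))"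
        using T by (intro ennreal_mult) auto
      also have "\<dots> \<le> ennreal (exp c * 2 * pi / T) * (indicator {0..1} x + ennreal (x powr (1 - \<sigma>)) * indicator {1..} x)"
        using True by (intro mult_left_mono) (auto simp: indicator_def)
      finally show ?thesis .
    qed simp
  qed
  also have "\<dots> = ennreal (exp c * 2 * pi / T) * ennreal (1 + 1 / (\<sigma> - 2))"
    by (subst nn_integral_cmult) (auto simp: radial_integral_finite[OF \<sigma>])
  also have "\<dots> = ennreal (?K * (1 + t) powr (- (1 / (2 * real l))))"
  proof -
    have "T = c powr (1 / (2 * real l)) * (1 + t) powr (1 / (2 * real l))"
      using c t by (simp add: T_def powr_mult)
    then have eq: "exp c * 2 * pi / T * (1 + 1 / (\<sigma> - 2)) = ?K * (1 + t) powr (- (1 / (2 * real l)))"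
    proof -
      assume T_eq: "T = c powr (1 / (2 * real l)) * (1 + t) powr (1 / (2 * real l))"
      have "e / (a * b) * r = e * r / a * inverse b" for e a b r :: real by (simp add: divide_inverse)
      then show ?thesis unfolding T_eq powr_minus .
    qed
    show ?thesis unfolding eq[symmetric] using T by (intro ennreal_mult'[symmetric]) simp
  qed
  finally show "(\<integral>\<^sup>+\<xi>. indicator (sector \<eta> \<delta>) \<xi> *
      ennreal (exp (- (c * t * (min 1 (\<xi> \<bullet> \<eta>))\<^sup>2 * (\<bar>\<xi> \<bullet> rot \<eta>\<bar> / (\<xi> \<bullet> \<eta>)) ^ (2 * l))) * (1 + (norm \<xi>)\<^sup>2) powr (- \<sigma> / 2)) \<partial>lborel)
    \<le> ennreal (?K * (1 + t) powr (- (1 / (2 * real l))))"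
    unfolding F_def .
qed

section \<open>Decay estimates\<close>

lemma Lp_norm_ennreal:
  assumes "p > 0"
  shows "Lp_norm (ennreal p) f = (if Lp_int p f = \<infinity> then \<infinity> else ennreal (enn2real (Lp_int p f) powr (1 / p)))"
  using assms by (simp add: Lp_norm_def Lp_int_def Let_def)

lemma norm_bessel_symbol: "norm (bessel_symbol s \<xi>) = (1 + (norm \<xi>)\<^sup>2) powr (s / 2)"
  by (simp add: bessel_symbol_def)

text \<open>The support condition and the multiplier relation each provide their own representative
  of the transform of \<open>f\<close>; uniqueness reconciles them almost everywhere.\<close>

lemma multiplier_data:
  assumes f: "fourier_supported \<Gamma> f" and g: "fourier_multiplier m f g"
  obtains F G where "has_fourier_transform f F" "\<And>\<xi>. \<xi> \<notin> \<Gamma> \<Longrightarrow> F \<xi> = 0"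
    "has_fourier_transform g G" "AE \<xi> in lborel. G \<xi> = m \<xi> * F \<xi>"
proof -
  obtain F where F: "has_fourier_transform f F" "\<And>\<xi>. \<xi> \<notin> \<Gamma> \<Longrightarrow> F \<xi> = 0"
    using f by (auto simp: fourier_supported_def)
  obtain F' where F': "has_fourier_transform f F'" "has_fourier_transform g (\<lambda>\<xi>. m \<xi> * F' \<xi>)"
    using g by (auto simp: fourier_multiplier_def)
  have "AE \<xi> in lborel. m \<xi> * F' \<xi> = m \<xi> * F \<xi>"
    using has_fourier_transform_unique[OF F'(1) F(1)] by eventually_elim simp
  with F F'(2) that show ?thesis by blast
qed

text \<open>What the L^p theory needs to know about the eigenvalue. The factor \<open>a\<close> in
  the exponent of \<open>decay\<close> is there because Hoelder's inequality integrates a power of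
  the multiplier.\<close>

locale damped_multiplier =
  fixes \<Gamma> :: "(real^2) set" and \<nu> :: "real^2 \<Rightarrow> complex" and l :: nat
  assumes open_cone: "open \<Gamma>" and cont: "continuous_on \<Gamma> \<nu>" and Im_nonneg: "\<And>\<xi>. \<xi> \<in> \<Gamma> \<Longrightarrow> 0 \<le> Im (\<nu> \<xi>)"
    and decay: "\<And>a \<sigma>. a > 0 \<Longrightarrow> \<sigma> > 2 \<Longrightarrow> \<exists>K>0. \<forall>t\<ge>0.
      (\<integral>\<^sup>+\<xi>. indicator \<Gamma> \<xi> * ennreal (exp (- (a * t * Im (\<nu> \<xi>))) * (1 + (norm \<xi>)\<^sup>2) powr (- \<sigma> / 2)) \<partial>lborel)
        \<le> ennreal (K * (1 + t) powr (- (1 / (2 * real l))))"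
begin

abbreviation propagator :: "real \<Rightarrow> real^2 \<Rightarrow> complex" where
  "propagator t \<xi> \<equiv> exp (\<i> * complex_of_real t * \<nu> \<xi>)"

text \<open>The modulus of the propagator divided by the Bessel symbol, cut off to the cone: the
  factor that leads from the transform of \<langle>D\<rangle>^s f to that of the solution.\<close>

definition damping :: "real \<Rightarrow> real \<Rightarrow> real^2 \<Rightarrow> real" where
  "damping s t \<xi> = indicator \<Gamma> \<xi> * (exp (- (t * Im (\<nu> \<xi>))) * (1 + (norm \<xi>)\<^sup>2) powr (- s / 2))"

lemma measurable_nu[measurable]: "(\<lambda>\<xi>. if \<xi> \<in> \<Gamma> then \<nu> \<xi> else 0) \<in> borel_measurable borel"
  using open_cone cont by (intro borel_measurable_continuous_on_if) auto

text \<open>Nothing is known about \<open>\<nu>\<close> outside the cone, not even measurability, so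
  it is replaced by 0 there.\<close>

lemma damping_eq: "damping s t \<xi> = indicator \<Gamma> \<xi> * (exp (- (t * Im (if \<xi> \<in> \<Gamma> then \<nu> \<xi> else 0))) * (1 + (norm \<xi>)\<^sup>2) powr (- s / 2))"
  by (simp add: damping_def)

lemma measurable_damping[measurable]: "damping s t \<in> borel_measurable borel"
proof -
  have [measurable]: "\<Gamma> \<in> sets borel" using open_cone by auto
  show ?thesis unfolding damping_eq[abs_def] by measurable
qed

lemma damping_nonneg: "0 \<le> damping s t \<xi>"
  by (simp add: damping_def)

lemma damping_le_1:
  assumes "s \<ge> 0" "t \<ge> 0"
  shows "damping s t \<xi> \<le> 1"
proof (cases "\<xi> \<in> \<Gamma>")
  case True
  have "(1 + (norm \<xi>)\<^sup>2) powr (- s / 2) \<le> (1 + (norm \<xi>)\<^sup>2) powr 0"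
    using assms by (intro powr_mono) auto
  then have "(1 + (norm \<xi>)\<^sup>2) powr (- s / 2) \<le> 1" by (simp add: add_nonneg_eq_0_iff)
  then show ?thesis using True assms Im_nonneg[OF True] by (auto simp: damping_def intro!: mult_le_one)
qed (simp add: damping_def)

lemma damping_powr_integral:
  assumes "a > 0" "s * a > 2"
  shows "\<exists>K>0. \<forall>t\<ge>0. (\<integral>\<^sup>+\<xi>. ennreal (damping s t \<xi> powr a) \<partial>lborel) \<le> ennreal (K * (1 + t) powr (- (1 / (2 * real l))))"
proof -
  have "ennreal (damping s t \<xi> powr a) = indicator \<Gamma> \<xi> * ennreal (exp (- (a * t * Im (\<nu> \<xi>))) * (1 + (norm \<xi>)\<^sup>2) powr (- (s * a) / 2))" for t \<xi>
    using assms(1) by (auto simp: damping_def indicator_def powr_mult powr_powr exp_powr_real mult_ac)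
  then show ?thesis using decay[OF assms] by simp
qed

lemma measurable_propagated:
  assumes [measurable]: "F \<in> borel_measurable borel" and "\<And>\<xi>. \<xi> \<notin> \<Gamma> \<Longrightarrow> F \<xi> = 0"
  shows "(\<lambda>\<xi>. propagator t \<xi> * F \<xi>) \<in> borel_measurable borel"
proof -
  have "(\<lambda>\<xi>. propagator t \<xi> * F \<xi>) = (\<lambda>\<xi>. exp (\<i> * complex_of_real t * (if \<xi> \<in> \<Gamma> then \<nu> \<xi> else 0)) * F \<xi>)"
    using assms(2) by (auto simp: fun_eq_iff)
  then show ?thesis by (simp only:) measurable
qed

lemma norm_propagated:
  assumes 0: "\<And>\<xi>. \<xi> \<notin> \<Gamma> \<Longrightarrow> F \<xi> = 0" and G: "AE \<xi> in lborel. G \<xi> = bessel_symbol s \<xi> * F \<xi>"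
  shows "AE \<xi> in lborel. norm (propagator t \<xi> * F \<xi>) = damping s t \<xi> * norm (G \<xi>)"
  using G
proof eventually_elim
  case (elim \<xi>)
  show ?case
  proof (cases "\<xi> \<in> \<Gamma>")
    case True
    have "(1 + (norm \<xi>)\<^sup>2) powr (- s / 2) * (1 + (norm \<xi>)\<^sup>2) powr (s / 2) = 1"
      by (simp add: powr_add[symmetric] add_nonneg_eq_0_iff)
    then show ?thesis using True elim by (simp add: damping_def norm_mult norm_bessel_symbol mult.assoc)
  qed (simp add: damping_def 0)
qed

text \<open>A bounded transform times an integrable damping factor is integrable, and its inverse
  transform is bounded by the integral.\<close>

lemma damped_estimate_L1:
  assumes s: "s > 2"
  shows "\<exists>C>0. \<forall>t\<ge>0. \<forall>f g. fourier_supported \<Gamma> f \<and> fourier_multiplier (bessel_symbol s) f g \<and> Lp_norm (ennreal 1) g < \<infinity> \<longrightarrow>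
    (\<exists>h. fourier_multiplier (propagator t) f h \<and>
       Lp_norm \<infinity> h \<le> ennreal (C * (1 + t) powr (- (1 / (2 * real l)))) * Lp_norm (ennreal 1) g)"
proof -
  obtain K where K: "K > 0" "\<And>t. t \<ge> 0 \<Longrightarrow> (\<integral>\<^sup>+\<xi>. ennreal (damping s t \<xi> powr 1) \<partial>lborel) \<le> ennreal (K * (1 + t) powr (- (1 / (2 * real l))))"
    using damping_powr_integral[of 1 s] s by auto
  have "\<exists>h. fourier_multiplier (propagator t) f h \<and>
       Lp_norm \<infinity> h \<le> ennreal (K * (1 + t) powr (- (1 / (2 * real l)))) * Lp_norm (ennreal 1) g"
    if t: "t \<ge> 0" and f: "fourier_supported \<Gamma> f" and g: "fourier_multiplier (bessel_symbol s) f g" and fin: "Lp_norm (ennreal 1) g < \<infinity>" for t f g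
  proof -
    obtain F G where F: "has_fourier_transform f F" "\<And>\<xi>. \<xi> \<notin> \<Gamma> \<Longrightarrow> F \<xi> = 0"
      and G: "has_fourier_transform g G" "AE \<xi> in lborel. G \<xi> = bessel_symbol s \<xi> * F \<xi>"
      by (rule multiplier_data[OF f g]) blast
    have [measurable]: "F \<in> borel_measurable borel" "G \<in> borel_measurable borel" "g \<in> borel_measurable borel"
      using F(1) G(1) by (auto simp: has_fourier_transform_def tempered_measurable)
    let ?H = "\<lambda>\<xi>. propagator t \<xi> * F \<xi>"
    have Hm[measurable]: "?H \<in> borel_measurable borel" by (rule measurable_propagated) (use F(2) in auto)
    let ?k = "K * (1 + t) powr (- (1 / (2 * real l)))"
    have fin': "Lp_int 1 g \<noteq> \<infinity>" using fin Lp_norm_ennreal[of 1 g] by (auto split: if_splits)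
    then have gi: "integrable lborel g" by (simp add: integrable_iff_bounded Lp_int_def less_top)
    define N where "N = (LBINT x. norm (g x))"
    have N: "N \<ge> 0" "Lp_int 1 g = ennreal N"
      using gi by (simp_all add: N_def Lp_int_def nn_integral_eq_integral)
    have gN: "Lp_norm (ennreal 1) g = ennreal N" using N Lp_norm_ennreal[of 1 g] by simp
    have np: "AE \<xi> in lborel. norm (?H \<xi>) = damping s t \<xi> * norm (G \<xi>)"
      using F(2) G(2) by (rule norm_propagated)
    have "AE \<xi> in lborel. norm (?H \<xi>) \<le> damping s t \<xi> * N"
      using np fourier_transform_integrable_bound[OF G(1) gi]
    proof eventually_elim
      case (elim \<xi>)
      have "N / (2 * pi) \<le> N / 1" using N pi_ge_two by (intro divide_left_mono) auto
      then have "norm (G \<xi>) \<le> N" using elim(2) by (simp add: N_def)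
      then show ?case using elim(1) damping_nonneg by (simp add: mult_left_mono)
    qed
    then have "(\<integral>\<^sup>+\<xi>. ennreal (norm (?H \<xi>)) \<partial>lborel) \<le> (\<integral>\<^sup>+\<xi>. ennreal (damping s t \<xi> powr 1) * ennreal N \<partial>lborel)"
      using damping_nonneg N by (intro nn_integral_mono_AE) (auto simp: ennreal_mult[symmetric] elim!: eventually_mono intro!: ennreal_leI)
    also have "\<dots> = (\<integral>\<^sup>+\<xi>. ennreal (damping s t \<xi> powr 1) \<partial>lborel) * ennreal N"
      by (rule nn_integral_multc) measurable
    also have "\<dots> \<le> ennreal ?k * ennreal N" by (intro mult_right_mono K t) auto
    finally have Hb: "(\<integral>\<^sup>+\<xi>. ennreal (norm (?H \<xi>)) \<partial>lborel) \<le> ennreal (?k * N)"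
      using N K by (simp add: ennreal_mult)
    then have Hi: "integrable lborel ?H"
      by (intro integrableI_bounded) (auto intro: le_less_trans)
    then obtain h where h: "h \<in> borel_measurable borel" "has_fourier_transform h ?H" "\<And>x. norm (h x) \<le> (LBINT \<xi>. norm (?H \<xi>)) / (2 * pi)"
      using inverse_fourier_transform_integrable by blast
    have "ennreal (LBINT \<xi>. norm (?H \<xi>)) \<le> ennreal (?k * N)"
      using Hb nn_integral_eq_integral[OF integrable_norm[OF Hi]] by simp
    then have I: "(LBINT \<xi>. norm (?H \<xi>)) \<le> ?k * N"
      using K N by (subst (asm) ennreal_le_iff) auto
    have hb: "norm (h x) \<le> ?k * N" for x
    proof -
      have "(LBINT \<xi>. norm (?H \<xi>)) / (2 * pi) \<le> (LBINT \<xi>. norm (?H \<xi>)) / 1"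
        using pi_ge_two by (intro divide_left_mono integral_nonneg) auto
      then show ?thesis using h(3)[of x] I by simp
    qed
    have "Lp_norm \<infinity> h \<le> ennreal (?k * N)"
      unfolding Lp_norm_def using h(1) hb by (auto intro!: esssup_I AE_I2 ennreal_leI)
    moreover have "ennreal (?k * N) = ennreal ?k * ennreal N" using K N by (intro ennreal_mult) auto
    ultimately have "Lp_norm \<infinity> h \<le> ennreal ?k * Lp_norm (ennreal 1) g" unfolding gN by simp
    moreover have "fourier_multiplier (propagator t) f h"
      unfolding fourier_multiplier_def using F(1) h(2) by blast
    ultimately show ?thesis by blast
  qed
  then show ?thesis using K(1) by blast
qed

text \<open>With 1/p = \<theta> + 1/q, the damping in L^(1/\<theta>) maps the transform from L^q to
  L^p, between two uses of Hausdorff--Young. Taking the norm raises the decay integral to the power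
  \<theta>.\<close>

lemma damped_estimate_Lp:
  assumes p: "1 < p" "p \<le> 2" and q: "q = p / (p - 1)" and s: "s > 2 * (1 / p - 1 / q)"
  shows "\<exists>C>0. \<forall>t\<ge>0. \<forall>f g. fourier_supported \<Gamma> f \<and> fourier_multiplier (bessel_symbol s) f g \<and> Lp_norm (ennreal p) g < \<infinity> \<longrightarrow>
    (\<exists>h. fourier_multiplier (propagator t) f h \<and>
       Lp_norm (ennreal q) h \<le> ennreal (C * (1 + t) powr (- (1 / (2 * real l)) * (1 / p - 1 / q))) * Lp_norm (ennreal p) g)"
proof -
  have q1: "q > 1" and pq: "q - 1 = q / p" "1 / p + 1 / q = 1" using p by (simp_all add: q field_simps)
  obtain C0 where C0: "C0 > 0"
    and fwd: "\<And>g G A. has_fourier_transform g G \<Longrightarrow> 0 \<le> A \<Longrightarrow> Lp_int p g \<le> ennreal A \<Longrightarrow> Lp_int q G \<le> ennreal (C0 * A powr (q - 1))"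
    and bwd: "\<And>G A. G \<in> borel_measurable borel \<Longrightarrow> 0 \<le> A \<Longrightarrow> Lp_int p G \<le> ennreal A \<Longrightarrow>
        \<exists>h. has_fourier_transform h G \<and> Lp_int q h \<le> ennreal (C0 * A powr (q - 1))"
    using Hausdorff_Young_transform[OF p q] by blast
  define \<theta> where "\<theta> = 1 / p - 1 / q"
  have "\<exists>K>0. \<forall>t\<ge>0. \<forall>G H B. G \<in> borel_measurable borel \<and> H \<in> borel_measurable borel \<and> 0 \<le> B \<and> Lp_int q G \<le> ennreal B \<and>
      (AE \<xi> in lborel. norm (H \<xi>) = damping s t \<xi> * norm (G \<xi>)) \<longrightarrow>
      Lp_int p H \<le> ennreal ((K * (1 + t) powr (- (1 / (2 * real l)) * \<theta>) * B powr (1 / q)) powr p)"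
  proof (cases "p = 2")
    case True
    then have q2: "q = 2" and th: "\<theta> = 0" using q by (simp_all add: \<theta>_def)
    have "s \<ge> 0" using s True q2 by simp
    have "Lp_int p H \<le> ennreal ((1 * (1 + t) powr (- (1 / (2 * real l)) * \<theta>) * B powr (1 / q)) powr p)"
      if "t \<ge> 0" "0 \<le> B" "Lp_int q G \<le> ennreal B" and H: "AE \<xi> in lborel. norm (H \<xi>) = damping s t \<xi> * norm (G \<xi>)" for t G H B
    proof -
      have "Lp_int p H \<le> Lp_int q G"
        unfolding Lp_int_def True q2
      proof (rule nn_integral_mono_AE)
        show "AE \<xi> in lborel. ennreal (norm (H \<xi>) powr 2) \<le> ennreal (norm (G \<xi>) powr 2)"
          using H
        proof eventually_elim
          case (elim \<xi>)
          have "norm (H \<xi>) \<le> norm (G \<xi>)"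
            unfolding elim using damping_le_1[OF \<open>s \<ge> 0\<close> \<open>t \<ge> 0\<close>] damping_nonneg by (intro mult_left_le_one_le) auto
          then show ?case by (intro ennreal_leI powr_mono2) auto
        qed
      qed
      also have "\<dots> \<le> ennreal B" by fact
      finally show ?thesis using that th True q2 by (simp add: powr_powr)
    qed
    then show ?thesis by (intro exI[of _ 1]) auto
  next
    case False
    then have p2: "p < 2" using p by simp
    have qp: "q > p" using p p2 by (simp add: q field_simps)
    have th: "\<theta> > 0" using qp p by (simp add: \<theta>_def field_simps)
    \<comment> \<open>Hoelder's exponent for the damping; \<open>s * a > 2\<close> is the hypothesis
      on the regularity.\<close>
    define a where "a = 1 / \<theta>"
    have a: "a > 0" "s * a > 2" using th s by (simp_all add: a_def \<theta>_def[symmetric] pos_less_divide_eq)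
    obtain K where K: "K > 0" "\<And>t. t \<ge> 0 \<Longrightarrow> (\<integral>\<^sup>+\<xi>. ennreal (damping s t \<xi> powr a) \<partial>lborel) \<le> ennreal (K * (1 + t) powr (- (1 / (2 * real l))))"
      using damping_powr_integral[OF a] by auto
    have ap: "a / p > 1" and qp1: "q / p > 1" and aqp: "1 / (a / p) + 1 / (q / p) = 1"
    proof -
      have "p * \<theta> = 1 - p / q" using p by (simp add: \<theta>_def right_diff_distrib)
      moreover have "0 < p / q" "p / q < 1" using p q1 qp by auto
      ultimately have pt: "p * \<theta> < 1" "0 < p * \<theta>" "p * \<theta> + p / q = 1" by auto
      have "a / p = 1 / (p * \<theta>)" by (simp add: a_def)
      then show "a / p > 1" "1 / (a / p) + 1 / (q / p) = 1" using pt by auto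
      show "q / p > 1" using qp p by simp
    qed
    have "Lp_int p H \<le> ennreal (((K powr \<theta>) * (1 + t) powr (- (1 / (2 * real l)) * \<theta>) * B powr (1 / q)) powr p)"
      if t: "t \<ge> 0" and [measurable]: "G \<in> borel_measurable borel" "H \<in> borel_measurable borel" and B: "0 \<le> B" "Lp_int q G \<le> ennreal B"
        and H: "AE \<xi> in lborel. norm (H \<xi>) = damping s t \<xi> * norm (G \<xi>)" for t G H B
    proof -
      let ?k = "K * (1 + t) powr (- (1 / (2 * real l)))"
      have "Lp_int p H = (\<integral>\<^sup>+\<xi>. ennreal (damping s t \<xi> powr p * norm (G \<xi>) powr p) \<partial>lborel)"
        unfolding Lp_int_def using H damping_nonneg
        by (intro nn_integral_cong_AE) (auto simp: powr_mult elim!: eventually_mono)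
      also have "\<dots> \<le> ennreal (?k powr (1 / (a / p)) * B powr (1 / (q / p)))"
      proof (rule nn_integral_Holder[OF ap qp1 aqp])
        show "(\<integral>\<^sup>+\<xi>. ennreal ((damping s t \<xi> powr p) powr (a / p)) \<partial>lborel) \<le> ennreal ?k"
          using K(2)[OF t] p by (simp add: powr_powr)
        show "(\<integral>\<^sup>+\<xi>. ennreal ((norm (G \<xi>) powr p) powr (q / p)) \<partial>lborel) \<le> ennreal B"
          using B p by (simp add: powr_powr Lp_int_def)
      qed (use K B in auto)
      also have "?k powr (1 / (a / p)) * B powr (1 / (q / p)) = ((K powr \<theta>) * (1 + t) powr (- (1 / (2 * real l)) * \<theta>) * B powr (1 / q)) powr p"
        using K t B p by (simp add: powr_mult powr_powr a_def mult_ac)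
      finally show ?thesis .
    qed
    then show ?thesis using K by (intro exI[of _ "K powr \<theta>"]) auto
  qed
  then obtain K where K: "K > 0" and HK: "\<And>t G H B. t \<ge> 0 \<Longrightarrow> G \<in> borel_measurable borel \<Longrightarrow> H \<in> borel_measurable borel \<Longrightarrow> 0 \<le> B \<Longrightarrow> Lp_int q G \<le> ennreal B \<Longrightarrow>
      AE \<xi> in lborel. norm (H \<xi>) = damping s t \<xi> * norm (G \<xi>) \<Longrightarrow>
      Lp_int p H \<le> ennreal ((K * (1 + t) powr (- (1 / (2 * real l)) * \<theta>) * B powr (1 / q)) powr p)"
    by blast
  \<comment> \<open>Each of the two applications of Hausdorff--Young contributes
    \<open>C0 powr (1 / q)\<close>, the middle factor is Hoelder's.\<close>
  define C where "C = C0 powr (1 / q) * K * C0 powr (1 / q)"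
  have C: "C > 0" using C0 K by (simp add: C_def)
  have "\<exists>h. fourier_multiplier (propagator t) f h \<and>
       Lp_norm (ennreal q) h \<le> ennreal (C * (1 + t) powr (- (1 / (2 * real l)) * \<theta>)) * Lp_norm (ennreal p) g"
    if t: "t \<ge> 0" and f: "fourier_supported \<Gamma> f" and g: "fourier_multiplier (bessel_symbol s) f g" and fin: "Lp_norm (ennreal p) g < \<infinity>" for t f g
  proof -
    obtain F G where F: "has_fourier_transform f F" "\<And>\<xi>. \<xi> \<notin> \<Gamma> \<Longrightarrow> F \<xi> = 0"
      and G: "has_fourier_transform g G" "AE \<xi> in lborel. G \<xi> = bessel_symbol s \<xi> * F \<xi>"
      by (rule multiplier_data[OF f g]) blast
    have Fm: "F \<in> borel_measurable borel" and Gm: "G \<in> borel_measurable borel"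
      using F(1) G(1) by (auto simp: has_fourier_transform_def tempered_measurable)
    let ?H = "\<lambda>\<xi>. propagator t \<xi> * F \<xi>" and ?d = "(1 + t) powr (- (1 / (2 * real l)) * \<theta>)"
    have Hm: "?H \<in> borel_measurable borel" using Fm F(2) by (rule measurable_propagated)
    have fin': "Lp_int p g \<noteq> \<infinity>" using fin p by (auto simp: Lp_norm_ennreal split: if_splits)
    define A where "A = enn2real (Lp_int p g)"
    have A: "A \<ge> 0" "Lp_int p g = ennreal A" using fin' by (simp_all add: A_def less_top)
    have gA: "Lp_norm (ennreal p) g = ennreal (A powr (1 / p))" using A p by (simp add: Lp_norm_ennreal)
    define B where "B = C0 * A powr (q - 1)"
    have B: "B \<ge> 0" "Lp_int q G \<le> ennreal B" using fwd[OF G(1) A(1)] A(2) C0 by (auto simp: B_def)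
    define D where "D = K * ?d * B powr (1 / q)"
    have D: "D \<ge> 0" using K by (simp add: D_def)
    have np: "AE \<xi> in lborel. norm (?H \<xi>) = damping s t \<xi> * norm (G \<xi>)"
      using F(2) G(2) by (rule norm_propagated)
    have HD: "Lp_int p ?H \<le> ennreal (D powr p)"
      unfolding D_def by (rule HK[OF t Gm Hm B np])
    obtain h where h: "has_fourier_transform h ?H" "Lp_int q h \<le> ennreal (C0 * (D powr p) powr (q - 1))"
      using bwd[OF Hm _ HD] by auto
    have "Lp_norm (ennreal q) h \<le> ennreal ((C0 * (D powr p) powr (q - 1)) powr (1 / q))"
    proof -
      have "Lp_int q h \<noteq> \<infinity>" using h(2) by (auto simp: top_unique)
      moreover have "enn2real (Lp_int q h) \<le> C0 * (D powr p) powr (q - 1)"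
        using h(2) C0 by (intro enn2real_leI) auto
      ultimately show ?thesis using q1 by (auto simp: Lp_norm_ennreal intro!: ennreal_leI powr_mono2)
    qed
    also have "(C0 * (D powr p) powr (q - 1)) powr (1 / q) = C0 powr (1 / q) * D"
      using C0 D p q1 by (cases "D = 0") (simp_all add: powr_mult powr_powr pq(1))
    also have "\<dots> = C * ?d * A powr (1 / p)"
    proof -
      have "B powr (1 / q) = C0 powr (1 / q) * A powr (1 / p)"
        using C0 A q1 by (simp add: B_def powr_mult powr_powr pq(1))
      then show ?thesis by (simp add: D_def C_def mult_ac)
    qed
    also have "ennreal (C * ?d * A powr (1 / p)) = ennreal (C * ?d) * Lp_norm (ennreal p) g"
      unfolding gA using C by (intro ennreal_mult) auto
    finally have "Lp_norm (ennreal q) h \<le> ennreal (C * ?d) * Lp_norm (ennreal p) g" .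
    moreover have "fourier_multiplier (propagator t) f h"
      unfolding fourier_multiplier_def using F(1) h(1) by blast
    ultimately show ?thesis by blast
  qed
  then show ?thesis using C unfolding \<theta>_def by blast
qed

end

text \<open>Dissipation is expressed in the angle, the sector in the slope; for slopes up to 1 they
  agree within a factor 2. The lower bound is |sin y| \<le> |y| at y = arctan v.\<close>

lemma arctan_abs_bounds:
  assumes "\<bar>v\<bar> \<le> 1"
  shows "\<bar>arctan v\<bar> \<le> \<bar>v\<bar>" "\<bar>v\<bar> / 2 \<le> \<bar>arctan v\<bar>"
proof -
  show "\<bar>v\<bar> / 2 \<le> \<bar>arctan v\<bar>"
  proof -
    have "v\<^sup>2 \<le> 1" using assms by (simp add: abs_square_le_1)
    then have "sqrt (1 + v\<^sup>2) \<le> sqrt (2\<^sup>2)" by (subst real_sqrt_le_iff) simp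
    then have "sqrt (1 + v\<^sup>2) \<le> 2" by simp
    moreover have "sqrt (1 + v\<^sup>2) > 0" by (simp add: add_pos_nonneg)
    ultimately have "\<bar>v\<bar> / 2 \<le> \<bar>v\<bar> / sqrt (1 + v\<^sup>2)" by (intro divide_left_mono) auto
    also have "\<dots> = \<bar>sin (arctan v)\<bar>" by (simp add: sin_arctan)
    also have "\<dots> \<le> \<bar>arctan v\<bar>" by (rule abs_sin_x_le_abs_x)
    finally show ?thesis .
  qed
  have "arctan x \<le> x" if "x \<ge> 0" for x :: real
  proof -
    have "(\<lambda>y. y - arctan y) 0 \<le> (\<lambda>y. y - arctan y) x"
    proof (rule DERIV_nonneg_imp_nondecreasing[OF that])
      fix y :: real
      have "inverse (1 + y\<^sup>2) \<le> 1" by (intro inverse_le_1_iff[THEN iffD2]) auto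
      then show "\<exists>d. ((\<lambda>y. y - arctan y) has_real_derivative d) (at y) \<and> 0 \<le> d"
        by (intro exI[of _ "1 - inverse (1 + y\<^sup>2)"]) (auto intro!: derivative_eq_intros)
    qed
    then show ?thesis by simp
  qed
  from this[of "\<bar>v\<bar>"] show "\<bar>arctan v\<bar> \<le> \<bar>v\<bar>" by (auto simp: abs_if arctan_minus split: if_splits)
qed

lemma sector_polar:
  assumes \<eta>: "norm \<eta> = 1" and \<xi>: "\<xi> \<in> sector \<eta> \<delta>" and \<delta>: "\<delta> > 0"
  shows "\<xi> \<bullet> \<eta> > 0" "\<xi> = norm \<xi> *\<^sub>R circ_arc \<eta> (arctan ((\<xi> \<bullet> rot \<eta>) / (\<xi> \<bullet> \<eta>)))" "\<xi> \<bullet> \<eta> \<le> norm \<xi>"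
    "\<bar>\<xi> \<bullet> rot \<eta>\<bar> / (\<xi> \<bullet> \<eta>) < \<delta>"
proof -
  define x y where "x = \<xi> \<bullet> \<eta>" and "y = \<xi> \<bullet> rot \<eta>"
  have less: "\<bar>y\<bar> < \<delta> * x" using \<xi> by (simp add: sector_def x_def y_def)
  then show x: "\<xi> \<bullet> \<eta> > 0" using \<delta> unfolding x_def[symmetric] by (smt (verit) mult_nonneg_nonpos)
  show "\<bar>\<xi> \<bullet> rot \<eta>\<bar> / (\<xi> \<bullet> \<eta>) < \<delta>" using less x by (simp add: x_def y_def field_simps)
  show "\<xi> \<bullet> \<eta> \<le> norm \<xi>" using norm_cauchy_schwarz[of \<xi> \<eta>] \<eta> by simp
  have x0: "x > 0" using x by (simp add: x_def)
  have dec: "\<xi> = x *\<^sub>R \<eta> + y *\<^sub>R rot \<eta>" unfolding x_def y_def by (rule rot_decomposition[OF \<eta>])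
  have "norm \<xi> = sqrt (x\<^sup>2 + y\<^sup>2)"
    using norm_rot_decomposition[OF \<eta>, of x y] dec by (metis norm_ge_zero real_sqrt_unique)
  also have "x\<^sup>2 + y\<^sup>2 = x\<^sup>2 * (1 + (y / x)\<^sup>2)" using x0 by (simp add: field_simps power_divide)
  also have "sqrt \<dots> = x * sqrt (1 + (y / x)\<^sup>2)" using x0 by (simp add: real_sqrt_mult)
  finally have n: "norm \<xi> = x * sqrt (1 + (y / x)\<^sup>2)" .
  have "sqrt (1 + (y / x)\<^sup>2) > 0" by (simp add: add_pos_nonneg)
  then have "norm \<xi> * cos (arctan (y / x)) = x" "norm \<xi> * sin (arctan (y / x)) = y"
    unfolding n cos_arctan sin_arctan using x0 by (simp_all add: field_simps)
  then have "norm \<xi> *\<^sub>R circ_arc \<eta> (arctan (y / x)) = x *\<^sub>R \<eta> + y *\<^sub>R rot \<eta>"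
    by (simp add: circ_arc_def scaleR_add_right)
  then show "\<xi> = norm \<xi> *\<^sub>R circ_arc \<eta> (arctan ((\<xi> \<bullet> rot \<eta>) / (\<xi> \<bullet> \<eta>)))"
    using dec unfolding x_def[symmetric] y_def[symmetric] by simp
qed

theorem theorem3p6:
  fixes \<kappa> \<gamma> :: real
    and A :: "real^2 \<Rightarrow> complex^2^2"
    and vk :: "2 \<Rightarrow> real^2 \<Rightarrow> real"
    and r :: "2 \<Rightarrow> real^2 \<Rightarrow> real^2"
    and j\<^sub>0 :: 2
    and \<eta>\<^sub>0 :: "real^2"
    and l :: nat
    and \<nu>p \<nu>m :: "real^2 \<Rightarrow> complex"
    and \<Gamma>\<^sub>0 :: "(real^2) set"
  assumes kappa: "\<kappa> > 0" and gamma: "\<gamma> \<noteq> 0"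
    and A1: "real_analytic_on_circle A"
    and A2: "\<And>\<eta>. \<eta> \<in> sphere 0 1 \<Longrightarrow> self_adjoint (A \<eta>) \<and> positive_definite (A \<eta>)"
    and eig: "eigensystem A vk r"
    and eig_analytic: "\<And>j. real_analytic_on_circle (vk j) \<and> real_analytic_on_circle (r j)"
    and A3: "\<And>\<eta>. \<eta> \<in> sphere 0 1 \<Longrightarrow> card (spectrum (A \<eta>)) = 2"
    and A4: "\<And>j \<eta>. hyperbolic_wrt \<kappa> \<gamma> vk r j \<eta> \<Longrightarrow>
               complex_of_real (\<gamma>\<^sup>2) \<noteq> 2 * complex_of_real (vk j \<eta>) - trace (A \<eta>)"
    and hyp: "hyperbolic_wrt \<kappa> \<gamma> vk r j\<^sub>0 \<eta>\<^sub>0"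
    and order: "vanishing_order (\<lambda>t. coupling r j\<^sub>0 (circ_arc \<eta>\<^sub>0 t)) = enat l"
    and contact: "contact_order vk j\<^sub>0 \<eta>\<^sub>0 \<ge> enat (2 * l)"
    and nu_plus: "hyperbolic_eigenvalue \<kappa> \<gamma> vk r j\<^sub>0 \<eta>\<^sub>0 1 \<Gamma>\<^sub>0 \<nu>p"
    and nu_minus: "hyperbolic_eigenvalue \<kappa> \<gamma> vk r j\<^sub>0 \<eta>\<^sub>0 (-1) \<Gamma>\<^sub>0 \<nu>m"
  shows "\<exists>\<Gamma>. conical_nbhd \<eta>\<^sub>0 \<Gamma> \<and> \<Gamma> \<subseteq> \<Gamma>\<^sub>0 \<and>
    (\<forall>(p::real) (q::ennreal) (s::real).
       1 \<le> p \<and> p \<le> 2 \<and> dual_exponents p q \<and> s > 2 * (1 / p - enn2real (1 / q)) \<longrightarrow>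
       (\<forall>\<nu>\<in>{\<nu>p, \<nu>m}. \<exists>C>0. \<forall>t\<ge>0. \<forall>f g.
          fourier_supported \<Gamma> f \<and> fourier_multiplier (bessel_symbol s) f g \<and>
          Lp_norm (ennreal p) g < \<infinity> \<longrightarrow>
          (\<exists>h. fourier_multiplier (\<lambda>\<xi>. exp (\<i> * complex_of_real t * \<nu> \<xi>)) f h \<and>
               Lp_norm q h
                 \<le> ennreal (C * (1 + t) powr (- (1 / (2 * real l)) * (1 / p - enn2real (1 / q))))
                    * Lp_norm (ennreal p) g)))"
proof -
  have \<eta>s: "\<eta>\<^sub>0 \<in> sphere 0 1" using hyp by (auto simp: hyperbolic_wrt_def hyperbolic_def)
  then have \<eta>: "norm \<eta>\<^sub>0 = 1" by simp
  obtain j' where j': "j\<^sub>0 \<noteq> j'" "(j\<^sub>0 = 1 \<and> j' = 2) \<or> (j\<^sub>0 = 2 \<and> j' = 1)"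
    using exhaust_2[of j\<^sub>0] by (metis one_neq_zero zero_neq_one exhaust_2 num1_eq1 one_add_one)
  have facts: "vk j \<zeta> > 0" "vk 1 \<zeta> \<noteq> vk 2 \<zeta>" "trace (A \<zeta>) = complex_of_real (vk 1 \<zeta> + vk 2 \<zeta>)"
    "(r 1 \<zeta> \<bullet> v)\<^sup>2 + (r 2 \<zeta> \<bullet> v)\<^sup>2 = (norm v)\<^sup>2" if "norm \<zeta> = 1" for \<zeta> j v
  proof -
    have z: "\<zeta> \<in> sphere 0 1" using that by simp
    note ef = eigensystem_facts[OF eig z conjunct2[OF A2[OF z]] A3[OF z]]
    show "vk j \<zeta> > 0" "vk 1 \<zeta> \<noteq> vk 2 \<zeta>" "trace (A \<zeta>) = complex_of_real (vk 1 \<zeta> + vk 2 \<zeta>)"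
      "(r 1 \<zeta> \<bullet> v)\<^sup>2 + (r 2 \<zeta> \<bullet> v)\<^sup>2 = (norm v)\<^sup>2"
      by (fact ef)+
  qed
  have ne: "vk j\<^sub>0 \<eta>\<^sub>0 \<noteq> vk j' \<eta>\<^sub>0" using facts(2)[OF \<eta>] j'(2) by auto
  have pythagoras: "(r j\<^sub>0 \<zeta> \<bullet> \<zeta>)\<^sup>2 + (r j' \<zeta> \<bullet> \<zeta>)\<^sup>2 = 1" if "norm \<zeta> = 1" for \<zeta>
    using facts(4)[OF that, of \<zeta>] j'(2) that by auto
  have a0: "r j\<^sub>0 \<eta>\<^sub>0 \<bullet> \<eta>\<^sub>0 = 0"
    by (rule hyperbolic_coupling_eq_0[OF gamma hyp j'(1) facts(1)[OF \<eta>] facts(1)[OF \<eta>] ne])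
  have b0: "(r j' \<eta>\<^sub>0 \<bullet> \<eta>\<^sub>0)\<^sup>2 = 1" using pythagoras[OF \<eta>] a0 by simp
  have ab: "(r j\<^sub>0 \<zeta> \<bullet> \<zeta>)\<^sup>2 \<le> 1 \<and> (r j' \<zeta> \<bullet> \<zeta>)\<^sup>2 \<le> 1" if "norm \<zeta> = 1" for \<zeta>
    using pythagoras[OF that] by (smt (verit) zero_le_power2)
  \<comment> \<open>(A4) is stated with the trace; replacing the trace by the sum of the eigenvalues
    leaves their difference.\<close>
  have nondeg: "\<gamma>\<^sup>2 \<noteq> vk j\<^sub>0 \<eta>\<^sub>0 - vk j' \<eta>\<^sub>0"
  proof
    assume "\<gamma>\<^sup>2 = vk j\<^sub>0 \<eta>\<^sub>0 - vk j' \<eta>\<^sub>0"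
    moreover have "vk 1 \<eta>\<^sub>0 + vk 2 \<eta>\<^sub>0 = vk j\<^sub>0 \<eta>\<^sub>0 + vk j' \<eta>\<^sub>0" using j'(2) by auto
    ultimately have "complex_of_real (\<gamma>\<^sup>2) = 2 * complex_of_real (vk j\<^sub>0 \<eta>\<^sub>0) - trace (A \<eta>\<^sub>0)"
      unfolding facts(3)[OF \<eta>] by simp
    with A4[OF hyp] show False by blast
  qed
  have vcont: "isCont (\<lambda>t. vk j (circ_arc \<eta>\<^sub>0 t)) 0" for j
    using analytic_on_circle_fps[OF conjunct1[OF eig_analytic] \<eta>s] has_fps_expansion_imp_continuous[where A=UNIV] by blast
  have rcont: "isCont (\<lambda>t. r j (circ_arc \<eta>\<^sub>0 t) \<bullet> circ_arc \<eta>\<^sub>0 t) 0" for j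
  proof -
    obtain F where "(\<lambda>t. coupling r j (circ_arc \<eta>\<^sub>0 t)) has_fps_expansion F"
      using coupling_fps[of r j, OF conjunct2[OF eig_analytic] \<eta>s] by blast
    from has_fps_expansion_imp_continuous[OF this, of UNIV] show ?thesis
      by (simp add: coupling_circ_arc[OF \<eta>])
  qed
  obtain F where F: "(\<lambda>t. coupling r j\<^sub>0 (circ_arc \<eta>\<^sub>0 t)) has_fps_expansion F"
    using coupling_fps[of r j\<^sub>0, OF conjunct2[OF eig_analytic] \<eta>s] by blast
  obtain c0 \<delta>0 where c0: "c0 > 0" "\<delta>0 > 0" "\<And>t. \<bar>t\<bar> < \<delta>0 \<Longrightarrow> c0 * \<bar>t\<bar> ^ l \<le> \<bar>r j\<^sub>0 (circ_arc \<eta>\<^sub>0 t) \<bullet> circ_arc \<eta>\<^sub>0 t\<bar>"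
    using vanishing_order_lower_bound[OF F order] by (auto simp: coupling_circ_arc[OF \<eta>])
  \<comment> \<open>For l = 0 the lower bound at t = 0 would contradict the vanishing of the
    coupling at \<open>\<eta>\<^sub>0\<close>.\<close>
  have l: "l \<ge> 1"
  proof (rule ccontr)
    assume "\<not> l \<ge> 1"
    then have "l = 0" by simp
    then have "c0 \<le> 0" using c0(3)[of 0] c0(2) a0 by simp
    with c0(1) show False by simp
  qed
  have diss: "\<exists>\<delta>>0. \<exists>c>0. \<forall>t \<rho>. \<bar>t\<bar> < \<delta> \<and> 0 < \<rho> \<longrightarrow> \<rho> *\<^sub>R circ_arc \<eta>\<^sub>0 t \<in> \<Gamma>\<^sub>0 \<and>
     c * (\<rho> / (1 + \<rho>))\<^sup>2 * (r j\<^sub>0 (circ_arc \<eta>\<^sub>0 t) \<bullet> circ_arc \<eta>\<^sub>0 t)\<^sup>2 \<le> Im (\<nu> (\<rho> *\<^sub>R circ_arc \<eta>\<^sub>0 t))"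
    if "hyperbolic_eigenvalue \<kappa> \<gamma> vk r j\<^sub>0 \<eta>\<^sub>0 s \<Gamma>\<^sub>0 \<nu>" "s = 1 \<or> s = -1" for s \<nu>
    by (rule hyperbolic_eigenvalue_dissipation[OF kappa gamma j'(1) \<eta> _ ne nondeg b0 a0 ab vcont vcont rcont rcont that(2,1)])
      (auto intro: facts(1))
  obtain \<delta>p cp where dp: "\<delta>p > 0" "cp > 0" "\<And>t \<rho>. \<bar>t\<bar> < \<delta>p \<Longrightarrow> 0 < \<rho> \<Longrightarrow> \<rho> *\<^sub>R circ_arc \<eta>\<^sub>0 t \<in> \<Gamma>\<^sub>0 \<and>
     cp * (\<rho> / (1 + \<rho>))\<^sup>2 * (r j\<^sub>0 (circ_arc \<eta>\<^sub>0 t) \<bullet> circ_arc \<eta>\<^sub>0 t)\<^sup>2 \<le> Im (\<nu>p (\<rho> *\<^sub>R circ_arc \<eta>\<^sub>0 t))"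
    using diss[OF nu_plus] by auto
  obtain \<delta>m cm where dm: "\<delta>m > 0" "cm > 0" "\<And>t \<rho>. \<bar>t\<bar> < \<delta>m \<Longrightarrow> 0 < \<rho> \<Longrightarrow> \<rho> *\<^sub>R circ_arc \<eta>\<^sub>0 t \<in> \<Gamma>\<^sub>0 \<and>
     cm * (\<rho> / (1 + \<rho>))\<^sup>2 * (r j\<^sub>0 (circ_arc \<eta>\<^sub>0 t) \<bullet> circ_arc \<eta>\<^sub>0 t)\<^sup>2 \<le> Im (\<nu>m (\<rho> *\<^sub>R circ_arc \<eta>\<^sub>0 t))"
    using diss[OF nu_minus] by auto
  \<comment> \<open>The cap 1 serves the comparison of slope and angle and the sector integral; the
    other bounds keep the angle in the range of all local estimates, for both signs of the
    eigenvalue.\<close>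
  define \<delta> where "\<delta> = min 1 (min \<delta>0 (min \<delta>p \<delta>m))"
  have \<delta>: "0 < \<delta>" "\<delta> \<le> 1" "\<delta> \<le> \<delta>0" "\<delta> \<le> \<delta>p" "\<delta> \<le> \<delta>m" using c0 dp dm by (auto simp: \<delta>_def)
  \<comment> \<open>The 4 comes from \<open>\<rho> / (1 + \<rho>) \<ge> min 1 x / 2\<close> after
    squaring, the \<open>4 ^ l\<close> from |t| \<ge> |v|/2 raised to the power 2l.\<close>
  define c where "c = min cp cm * c0\<^sup>2 / (4 * 4 ^ l)"
  have c: "c > 0" using c0 dp dm by (simp add: c_def)
  let ?\<Gamma> = "sector \<eta>\<^sub>0 \<delta>"
  have main: "\<xi> \<in> \<Gamma>\<^sub>0 \<and> c * (min 1 (\<xi> \<bullet> \<eta>\<^sub>0))\<^sup>2 * (\<bar>\<xi> \<bullet> rot \<eta>\<^sub>0\<bar> / (\<xi> \<bullet> \<eta>\<^sub>0)) ^ (2 * l) \<le> Im (\<nu> \<xi>)"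
    if \<xi>: "\<xi> \<in> ?\<Gamma>" and \<nu>: "\<nu> \<in> {\<nu>p, \<nu>m}" for \<xi> \<nu>
  proof -
    note pol = sector_polar[OF \<eta> \<xi> \<delta>(1)]
    define x v \<rho> t where "x = \<xi> \<bullet> \<eta>\<^sub>0" and "v = (\<xi> \<bullet> rot \<eta>\<^sub>0) / (\<xi> \<bullet> \<eta>\<^sub>0)" and "\<rho> = norm \<xi>" and "t = arctan v"
    have x: "x > 0" "x \<le> \<rho>" using pol by (simp_all add: x_def \<rho>_def)
    have v: "\<bar>v\<bar> = \<bar>\<xi> \<bullet> rot \<eta>\<^sub>0\<bar> / (\<xi> \<bullet> \<eta>\<^sub>0)" "\<bar>v\<bar> < \<delta>" using pol by (simp_all add: v_def)
    have \<xi>eq: "\<xi> = \<rho> *\<^sub>R circ_arc \<eta>\<^sub>0 t" using pol(2) by (simp add: \<rho>_def t_def v_def)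
    have v1: "\<bar>v\<bar> \<le> 1" using v \<delta> by linarith
    have t: "\<bar>t\<bar> < \<delta>" "\<bar>v\<bar> / 2 \<le> \<bar>t\<bar>" using arctan_abs_bounds[OF v1] v unfolding t_def by linarith+
    have \<rho>: "\<rho> > 0" using x by simp
    let ?a = "r j\<^sub>0 (circ_arc \<eta>\<^sub>0 t) \<bullet> circ_arc \<eta>\<^sub>0 t"
    have im: "\<xi> \<in> \<Gamma>\<^sub>0" "min cp cm * (\<rho> / (1 + \<rho>))\<^sup>2 * ?a\<^sup>2 \<le> Im (\<nu> \<xi>)"
    proof -
      have P: "\<rho> *\<^sub>R circ_arc \<eta>\<^sub>0 t \<in> \<Gamma>\<^sub>0 \<and> cp * (\<rho> / (1 + \<rho>))\<^sup>2 * ?a\<^sup>2 \<le> Im (\<nu>p (\<rho> *\<^sub>R circ_arc \<eta>\<^sub>0 t))"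
        using dp(3)[OF _ \<rho>] t \<delta> by auto
      have M: "cm * (\<rho> / (1 + \<rho>))\<^sup>2 * ?a\<^sup>2 \<le> Im (\<nu>m (\<rho> *\<^sub>R circ_arc \<eta>\<^sub>0 t))"
        using dm(3)[OF _ \<rho>] t \<delta> by auto
      have "min cp cm * (\<rho> / (1 + \<rho>))\<^sup>2 * ?a\<^sup>2 \<le> cp * (\<rho> / (1 + \<rho>))\<^sup>2 * ?a\<^sup>2" "min cp cm * (\<rho> / (1 + \<rho>))\<^sup>2 * ?a\<^sup>2 \<le> cm * (\<rho> / (1 + \<rho>))\<^sup>2 * ?a\<^sup>2"
        by (intro mult_right_mono; simp)+
      with P M \<nu> show "\<xi> \<in> \<Gamma>\<^sub>0" "min cp cm * (\<rho> / (1 + \<rho>))\<^sup>2 * ?a\<^sup>2 \<le> Im (\<nu> \<xi>)"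
        unfolding \<xi>eq[symmetric] by auto
    qed
    have r4: "(min 1 x)\<^sup>2 / 4 \<le> (\<rho> / (1 + \<rho>))\<^sup>2"
    proof -
      have "min 1 x / 2 \<le> \<rho> / (1 + \<rho>)"
      proof -
        have "min 1 x * (1 + \<rho>) \<le> 2 * \<rho>"
        proof (cases "\<rho> \<le> 1")
          case True
          then have "min 1 x * (1 + \<rho>) \<le> \<rho> * 2" using x by (intro mult_mono) auto
          then show ?thesis by simp
        next
          case False
          then have "min 1 x * (1 + \<rho>) \<le> 1 * (1 + \<rho>)" by (intro mult_right_mono) auto
          also have "\<dots> \<le> 2 * \<rho>" using False by simp
          finally show ?thesis .
        qed
        then show ?thesis using \<rho> by (simp add: field_simps)
      qed
      then have "(min 1 x / 2)\<^sup>2 \<le> (\<rho> / (1 + \<rho>))\<^sup>2" using x by (intro power_mono) auto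
      then show ?thesis by (simp add: power_divide)
    qed
    have a2: "c0\<^sup>2 * (\<bar>v\<bar> ^ (2 * l) / 4 ^ l) \<le> ?a\<^sup>2"
    proof -
      have "c0 * (\<bar>v\<bar> / 2) ^ l \<le> c0 * \<bar>t\<bar> ^ l" using c0(1) t by (intro mult_left_mono power_mono) auto
      also have "\<dots> \<le> \<bar>?a\<bar>" using c0(3)[of t] t \<delta> by simp
      finally have "(c0 * (\<bar>v\<bar> / 2) ^ l)\<^sup>2 \<le> \<bar>?a\<bar>\<^sup>2" using c0(1) by (intro power_mono) auto
      moreover have "(c0 * (\<bar>v\<bar> / 2) ^ l)\<^sup>2 = c0\<^sup>2 * (\<bar>v\<bar> ^ (2 * l) / 4 ^ l)"
      proof -
        have "(\<bar>v\<bar> / 2) ^ (l * 2) = ((\<bar>v\<bar> / 2)\<^sup>2) ^ l" by (simp add: power_mult[symmetric] mult.commute)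
        also have "\<dots> = \<bar>v\<bar> ^ (2 * l) / 4 ^ l" by (simp add: power_divide power_mult)
        finally show ?thesis by (simp add: power_mult_distrib power_mult)
      qed
      ultimately show ?thesis by simp
    qed
    have "c * (min 1 x)\<^sup>2 * \<bar>v\<bar> ^ (2 * l) = min cp cm * (((min 1 x)\<^sup>2 / 4) * (c0\<^sup>2 * (\<bar>v\<bar> ^ (2 * l) / 4 ^ l)))"
      by (simp add: c_def)
    also have "\<dots> \<le> min cp cm * ((\<rho> / (1 + \<rho>))\<^sup>2 * ?a\<^sup>2)"
      using dp dm r4 a2 by (intro mult_left_mono mult_mono) auto
    also have "\<dots> \<le> Im (\<nu> \<xi>)" using im(2) by (simp add: mult.assoc)
    finally show ?thesis using im(1) v(1) by (simp add: x_def)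
  qed
  have damped: "damped_multiplier ?\<Gamma> \<nu> l" if \<nu>: "\<nu> \<in> {\<nu>p, \<nu>m}" for \<nu>
  proof
    show "open ?\<Gamma>" by (rule open_sector)
    have "continuous_on \<Gamma>\<^sub>0 \<nu>" using \<nu> nu_plus nu_minus by (auto simp: hyperbolic_eigenvalue_def)
    then show "continuous_on ?\<Gamma> \<nu>" by (rule continuous_on_subset) (use main \<nu> in blast)
    show "0 \<le> Im (\<nu> \<xi>)" if \<xi>: "\<xi> \<in> ?\<Gamma>" for \<xi>
    proof -
      have "0 \<le> c * (min 1 (\<xi> \<bullet> \<eta>\<^sub>0))\<^sup>2 * (\<bar>\<xi> \<bullet> rot \<eta>\<^sub>0\<bar> / (\<xi> \<bullet> \<eta>\<^sub>0)) ^ (2 * l)"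
        using c sector_polar(1)[OF \<eta> \<xi> \<delta>(1)] by (intro mult_nonneg_nonneg zero_le_power) auto
      then show ?thesis using main[OF \<xi> \<nu>] by linarith
    qed
    fix a \<sigma> :: real assume a: "a > 0" and \<sigma>: "\<sigma> > 2"
    obtain K where K: "K > 0" "\<And>t. t \<ge> 0 \<Longrightarrow> (\<integral>\<^sup>+\<xi>. indicator ?\<Gamma> \<xi> *
      ennreal (exp (- (a * c * t * (min 1 (\<xi> \<bullet> \<eta>\<^sub>0))\<^sup>2 * (\<bar>\<xi> \<bullet> rot \<eta>\<^sub>0\<bar> / (\<xi> \<bullet> \<eta>\<^sub>0)) ^ (2 * l))) * (1 + (norm \<xi>)\<^sup>2) powr (- \<sigma> / 2)) \<partial>lborel)
    \<le> ennreal (K * (1 + t) powr (- (1 / (2 * real l))))"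
      using sector_decay_integral[OF \<eta> l mult_pos_pos[OF a c] \<delta>(1,2) \<sigma>] by auto
    have "(\<integral>\<^sup>+\<xi>. indicator ?\<Gamma> \<xi> * ennreal (exp (- (a * t * Im (\<nu> \<xi>))) * (1 + (norm \<xi>)\<^sup>2) powr (- \<sigma> / 2)) \<partial>lborel)
        \<le> ennreal (K * (1 + t) powr (- (1 / (2 * real l))))" if t: "t \<ge> 0" for t
    proof (rule order_trans[OF _ K(2)[OF t]], rule nn_integral_mono)
      fix \<xi> :: "real^2"
      let ?e = "(min 1 (\<xi> \<bullet> \<eta>\<^sub>0))\<^sup>2 * (\<bar>\<xi> \<bullet> rot \<eta>\<^sub>0\<bar> / (\<xi> \<bullet> \<eta>\<^sub>0)) ^ (2 * l)"
      show "indicator ?\<Gamma> \<xi> * ennreal (exp (- (a * t * Im (\<nu> \<xi>))) * (1 + (norm \<xi>)\<^sup>2) powr (- \<sigma> / 2))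
        \<le> indicator ?\<Gamma> \<xi> * ennreal (exp (- (a * c * t * (min 1 (\<xi> \<bullet> \<eta>\<^sub>0))\<^sup>2 * (\<bar>\<xi> \<bullet> rot \<eta>\<^sub>0\<bar> / (\<xi> \<bullet> \<eta>\<^sub>0)) ^ (2 * l))) * (1 + (norm \<xi>)\<^sup>2) powr (- \<sigma> / 2))"
      proof (cases "\<xi> \<in> ?\<Gamma>")
        case True
        have "a * t * (c * ?e) \<le> a * t * Im (\<nu> \<xi>)"
          using main[OF True \<nu>] a t by (intro mult_left_mono) (auto simp: mult.assoc)
        then have "exp (- (a * t * Im (\<nu> \<xi>))) \<le> exp (- (a * c * t * (min 1 (\<xi> \<bullet> \<eta>\<^sub>0))\<^sup>2 * (\<bar>\<xi> \<bullet> rot \<eta>\<^sub>0\<bar> / (\<xi> \<bullet> \<eta>\<^sub>0)) ^ (2 * l)))"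
          by (simp add: mult_ac)
        then show ?thesis by (intro mult_left_mono ennreal_leI mult_right_mono) auto
      qed simp
    qed
    then show "\<exists>K>0. \<forall>t\<ge>0. (\<integral>\<^sup>+\<xi>. indicator ?\<Gamma> \<xi> * ennreal (exp (- (a * t * Im (\<nu> \<xi>))) * (1 + (norm \<xi>)\<^sup>2) powr (- \<sigma> / 2)) \<partial>lborel)
        \<le> ennreal (K * (1 + t) powr (- (1 / (2 * real l))))"
      using K(1) by blast
  qed
  show ?thesis
  proof (intro exI[of _ ?\<Gamma>] conjI allI impI ballI)
    show "conical_nbhd \<eta>\<^sub>0 ?\<Gamma>" by (rule conical_sector[OF \<eta> \<delta>(1)])
    show "?\<Gamma> \<subseteq> \<Gamma>\<^sub>0" using main by blast
    fix p :: real and q :: ennreal and s :: real and \<nu>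
    assume pqs: "1 \<le> p \<and> p \<le> 2 \<and> dual_exponents p q \<and> s > 2 * (1 / p - enn2real (1 / q))" and \<nu>: "\<nu> \<in> {\<nu>p, \<nu>m}"
    interpret damped_multiplier ?\<Gamma> \<nu> l by (rule damped[OF \<nu>])
    show "\<exists>C>0. \<forall>t\<ge>0. \<forall>f g.
          fourier_supported ?\<Gamma> f \<and> fourier_multiplier (bessel_symbol s) f g \<and>
          Lp_norm (ennreal p) g < \<infinity> \<longrightarrow>
          (\<exists>h. fourier_multiplier (\<lambda>\<xi>. exp (\<i> * complex_of_real t * \<nu> \<xi>)) f h \<and>
               Lp_norm q h
                 \<le> ennreal (C * (1 + t) powr (- (1 / (2 * real l)) * (1 / p - enn2real (1 / q))))
                    * Lp_norm (ennreal p) g)"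
    proof (cases "p = 1")
      case True
      then have q: "q = \<infinity>" using pqs by (simp add: dual_exponents_def)
      \<comment> \<open>In \<open>ennreal\<close> the reciprocal of \<infinity> is 0.\<close>
      then have "s > 2" using pqs True by simp
      from damped_estimate_L1[OF this] show ?thesis using True q by simp
    next
      case False
      then have p: "1 < p" "p \<le> 2" and q: "q \<noteq> \<infinity>" "p * enn2real q = p + enn2real q"
        using pqs by (auto simp: dual_exponents_def)
      define q' where "q' = enn2real q"
      have q': "q' = p / (p - 1)" using q(2) p by (simp add: q'_def field_simps)
      then have "q' > 0" using p by simp
      have qq: "q = ennreal q'" using q(1) by (simp add: q'_def less_top)
      have "enn2real (1 / q) = 1 / q'"
        unfolding qq using \<open>q' > 0\<close> by (simp add: divide_ennreal[symmetric] flip: ennreal_1)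
      then show ?thesis using damped_estimate_Lp[OF p q', of s] pqs unfolding qq by simp
    qed
  qed
qed

end
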